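(* Let $(X_i)_{i\ge1}$ be i.i.d. non-degenerate real step lengths and $(Y_i)_{i\ge1}$ i.i.d. positive waiting times, the $X$'s being independent of the $Y$'s. Let $S_n=\sum_{k=1}^nX_k$, let $\widetilde S$ be the associated continuous-time random walk and $\widetilde R=(\widetilde R_t)_{t\ge0}$ its process of weak record numbers. Suppose that $\mathrm{P}(S_n\ge0)\to\rho$ for some $0<\rho\le1$, and that $Y_1$ is in the domain of attraction of a stable distribution with parameter $\alpha\in(0,1)$, meaning that the cumulative distribution function $G$ of $Y_1$ satisfies $$1-G(x)\sim\frac{1}{\Gamma(1-\alpha)}x^{-\alpha}L_1(x),\qquad x\to\infty,$$ where $L_1$ is slowly varying at $+\infty$. Then $\widetilde R$ has a functional limit which is the inverse process of the stable subordinator with index $\alpha\rho$; that is, there is a function $u(\lambda)>0$ such that, as $\lambda\to\infty$, the processes $(\widetilde R_{\lambda t}/u(\lambda))_{t\ge0}$ converge weakly in the Skorokhod space $D[0,\infty)$ to this inverse process.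
   Context: The continuous-time random walk is $\widetilde S_t=\sum_{i=1}^{N(t)}X_i$, where $N(t)=\max\{k\ge0:\sum_{j=1}^kY_j\le t\}$, and $\widetilde S_0=0$. A weak record of the walk occurs at step $n$ if $S_n=\max_{0\le k\le n}S_k$, with $S_0=0$ counted as the first record. $\widetilde R_t$ is the number of weak records of the continuous-time walk obtained up to time $t$, i.e. the number of $n\in\{0,1,\dots,N(t)\}$ such that a weak record occurs at step $n$; thus $\widetilde R_0=1$. The stable subordinator with index $\beta\in(0,1)$ is the subordinator $(D_v)_{v\ge0}$ with $\mathrm{E}e^{-sD_v}=e^{-vs^\beta}$, $s\ge0$, and its inverse process is $Z_t=\inf\{v\ge0:D_v>t\}$. *)

theory Defs
  imports "HOL-Probability.Probability" "HOL-Library.Landau_Symbols"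
begin

section \<open>Random walks, waiting times and weak records\<close>

text \<open>Step lengths and waiting times are indexed from 1; the entries at index 0 are never used.\<close>

definition walk :: "(nat \<Rightarrow> 'a \<Rightarrow> real) \<Rightarrow> nat \<Rightarrow> 'a \<Rightarrow> real" where
  "walk X n \<omega> = (\<Sum>k=1..n. X k \<omega>)"

text \<open>For \<open>t \<ge> 0\<close> the set below contains 0. With i.i.d. positive waiting times it is finite
  almost surely; the value of \<open>Max\<close> on the exceptional null set is irrelevant.\<close>

definition renewal_count :: "(nat \<Rightarrow> 'a \<Rightarrow> real) \<Rightarrow> real \<Rightarrow> 'a \<Rightarrow> nat" where
  "renewal_count Y t \<omega> = Max {k. (\<Sum>j=1..k. Y j \<omega>) \<le> t}"

definition weak_record :: "(nat \<Rightarrow> 'a \<Rightarrow> real) \<Rightarrow> nat \<Rightarrow> 'a \<Rightarrow> bool" where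
  "weak_record X n \<omega> \<longleftrightarrow> walk X n \<omega> = Max ((\<lambda>k. walk X k \<omega>) ` {0..n})"

definition ctrw_records ::
  "(nat \<Rightarrow> 'a \<Rightarrow> real) \<Rightarrow> (nat \<Rightarrow> 'a \<Rightarrow> real) \<Rightarrow> real \<Rightarrow> 'a \<Rightarrow> nat" where
  "ctrw_records X Y t \<omega> = card {n \<in> {0..renewal_count Y t \<omega>}. weak_record X n \<omega>}"

definition iid_sequence :: "'a measure \<Rightarrow> (nat \<Rightarrow> 'a \<Rightarrow> real) \<Rightarrow> bool" where
  "iid_sequence M X \<longleftrightarrow>
     prob_space.indep_vars M (\<lambda>_. borel) X {1..} \<and>
     (\<forall>i\<ge>1. distr M borel (X i) = distr M borel (X 1))"

definition independent_sequences ::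
  "'a measure \<Rightarrow> (nat \<Rightarrow> 'a \<Rightarrow> real) \<Rightarrow> (nat \<Rightarrow> 'a \<Rightarrow> real) \<Rightarrow> bool" where
  "independent_sequences M X Y \<longleftrightarrow>
     prob_space.indep_var M
       (PiM {1..} (\<lambda>_. borel)) (\<lambda>\<omega>. \<lambda>i\<in>{1..}. X i \<omega>)
       (PiM {1..} (\<lambda>_. borel)) (\<lambda>\<omega>. \<lambda>i\<in>{1..}. Y i \<omega>)"

definition slowly_varying :: "(real \<Rightarrow> real) \<Rightarrow> bool" where
  "slowly_varying L \<longleftrightarrow>
     (\<exists>A. L \<in> borel_measurable (restrict_space borel {A..}) \<and> (\<forall>x\<ge>A. L x > 0)) \<and>
     (\<forall>c>0. ((\<lambda>x. L (c * x) / L x) \<longlongrightarrow> 1) at_top)"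

section \<open>Stable subordinators and their inverses\<close>

definition subordinator :: "'b measure \<Rightarrow> (real \<Rightarrow> 'b \<Rightarrow> real) \<Rightarrow> bool" where
  "subordinator N D \<longleftrightarrow>
     prob_space N \<and>
     (\<forall>v\<ge>0. D v \<in> borel_measurable N) \<and>
     (AE \<omega> in N. D 0 \<omega> = 0 \<and> mono_on {0..} (\<lambda>v. D v \<omega>) \<and>
        (\<forall>v\<ge>0. continuous (at_right v) (\<lambda>v. D v \<omega>))) \<and>
     (\<forall>(v :: nat \<Rightarrow> real) n. 0 \<le> v 0 \<longrightarrow> mono v \<longrightarrow>
        prob_space.indep_vars N (\<lambda>_. borel) (\<lambda>i \<omega>. D (v (Suc i)) \<omega> - D (v i) \<omega>) {..<n}) \<and>
     (\<forall>v\<ge>0. \<forall>h\<ge>0.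
        distr N borel (\<lambda>\<omega>. D (v + h) \<omega> - D v \<omega>) = distr N borel (D h))"

definition stable_subordinator :: "'b measure \<Rightarrow> real \<Rightarrow> (real \<Rightarrow> 'b \<Rightarrow> real) \<Rightarrow> bool" where
  "stable_subordinator N \<beta> D \<longleftrightarrow>
     0 < \<beta> \<and> \<beta> < 1 \<and> subordinator N D \<and>
     (\<forall>v\<ge>0. \<forall>s\<ge>0. (\<integral>\<omega>. exp (- s * D v \<omega>) \<partial>N) = exp (- v * s powr \<beta>))"

definition inverse_process :: "(real \<Rightarrow> 'b \<Rightarrow> real) \<Rightarrow> real \<Rightarrow> 'b \<Rightarrow> real" where
  "inverse_process D t \<omega> = Inf {v. 0 \<le> v \<and> D v \<omega> > t}"

section \<open>The Skorokhod space of functions on the half-line\<close>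

definition cadlag_paths :: "(real \<Rightarrow> real) set" where
  "cadlag_paths = {x \<in> extensional {0..}.
     (\<forall>t\<ge>0. continuous (at_right t) x) \<and> (\<forall>t>0. \<exists>l. (x \<longlongrightarrow> l) (at_left t))}"

definition time_changes :: "(real \<Rightarrow> real) set" where
  "time_changes = {h. continuous_on {0..} h \<and> strict_mono_on {0..} h \<and> h ` {0..} = {0..}}"

text \<open>The Skorokhod (J1) topology is the metrizable topology in which \<open>x\<^sub>n\<close> converges to \<open>x\<close> iff
  there are time changes \<open>h\<^sub>n\<close> with \<open>\<bar>h\<^sub>n t - t\<bar>\<close> tending to 0 uniformly in \<open>t \<ge> 0\<close> and
  \<open>\<bar>x\<^sub>n (h\<^sub>n t) - x t\<bar>\<close> tending to 0 uniformly on every \<open>[0, T]\<close>. The sets below, for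
  \<open>T, e > 0\<close>, form a base of the neighbourhood filter of \<open>x\<close> in it: they are countably generated
  (take \<open>T = n\<close>, \<open>e = 1/n\<close>) and yield exactly these convergent sequences. The individual sets
  need not be open.\<close>

definition skorokhod_nbhd :: "(real \<Rightarrow> real) \<Rightarrow> real \<Rightarrow> real \<Rightarrow> (real \<Rightarrow> real) set" where
  "skorokhod_nbhd x T e = {y \<in> cadlag_paths. \<exists>h\<in>time_changes.
     (\<forall>t\<ge>0. \<bar>h t - t\<bar> < e) \<and> (\<forall>t\<in>{0..T}. \<bar>y (h t) - x t\<bar> < e)}"

definition skorokhod_open :: "(real \<Rightarrow> real) set \<Rightarrow> bool" where
  "skorokhod_open U \<longleftrightarrow>
     U \<subseteq> cadlag_paths \<and> (\<forall>x\<in>U. \<exists>T>0. \<exists>e>0. skorokhod_nbhd x T e \<subseteq> U)"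

definition skorokhod_topology :: "(real \<Rightarrow> real) topology" where
  "skorokhod_topology = topology skorokhod_open"

lemma skorokhod_nbhd_mono:
  "T' \<le> T \<Longrightarrow> e \<le> e' \<Longrightarrow> skorokhod_nbhd x T e \<subseteq> skorokhod_nbhd x T' e'"
  unfolding skorokhod_nbhd_def
proof (intro subsetI CollectI conjI)
  assume le: "T' \<le> T" "e \<le> e'"
  fix y assume y: "y \<in> {y \<in> cadlag_paths. \<exists>h\<in>time_changes.
     (\<forall>t\<ge>0. \<bar>h t - t\<bar> < e) \<and> (\<forall>t\<in>{0..T}. \<bar>y (h t) - x t\<bar> < e)}"
  then show "y \<in> cadlag_paths" by simp
  from y obtain h where h: "h \<in> time_changes"
    "\<forall>t\<ge>0. \<bar>h t - t\<bar> < e" "\<forall>t\<in>{0..T}. \<bar>y (h t) - x t\<bar> < e"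
    by auto
  have "\<forall>t\<ge>0. \<bar>h t - t\<bar> < e'"
    using h(2) le(2) less_le_trans by blast
  moreover have "\<forall>t\<in>{0..T'}. \<bar>y (h t) - x t\<bar> < e'"
  proof
    fix t assume "t \<in> {0..T'}"
    then have "t \<in> {0..T}" using le(1) by simp
    then show "\<bar>y (h t) - x t\<bar> < e'" using h(3) le(2) less_le_trans by blast
  qed
  ultimately show "\<exists>h\<in>time_changes.
     (\<forall>t\<ge>0. \<bar>h t - t\<bar> < e') \<and> (\<forall>t\<in>{0..T'}. \<bar>y (h t) - x t\<bar> < e')"
    using h(1) by blast
qed

lemma istopology_skorokhod_open: "istopology skorokhod_open"
  unfolding istopology_def
proof (intro conjI allI impI)
  fix U V assume U: "skorokhod_open U" and V: "skorokhod_open V"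
  show "skorokhod_open (U \<inter> V)"
    unfolding skorokhod_open_def
  proof (intro conjI ballI)
    show "U \<inter> V \<subseteq> cadlag_paths" using U by (auto simp: skorokhod_open_def)
    fix x assume "x \<in> U \<inter> V"
    then obtain T e T' e' where T: "T > 0" "e > 0" "skorokhod_nbhd x T e \<subseteq> U"
      and T': "T' > 0" "e' > 0" "skorokhod_nbhd x T' e' \<subseteq> V"
      using U V unfolding skorokhod_open_def by (meson IntD1 IntD2)
    have "skorokhod_nbhd x (max T T') (min e e') \<subseteq> U \<inter> V"
      using T(3) T'(3) skorokhod_nbhd_mono[of T "max T T'" "min e e'" e x]
        skorokhod_nbhd_mono[of T' "max T T'" "min e e'" e' x] by auto
    moreover have "max T T' > 0" "min e e' > 0" using T T' by auto
    ultimately show "\<exists>T>0. \<exists>e>0. skorokhod_nbhd x T e \<subseteq> U \<inter> V" by blast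
  qed
next
  fix \<K> assume K: "\<forall>K\<in>\<K>. skorokhod_open K"
  show "skorokhod_open (\<Union> \<K>)"
    unfolding skorokhod_open_def
  proof (intro conjI ballI)
    show "\<Union> \<K> \<subseteq> cadlag_paths" using K by (auto simp: skorokhod_open_def)
    fix x assume "x \<in> \<Union> \<K>"
    then obtain V where V: "V \<in> \<K>" "x \<in> V" by blast
    then obtain T e where "T > 0" "e > 0" "skorokhod_nbhd x T e \<subseteq> V"
      using K unfolding skorokhod_open_def by blast
    moreover have "V \<subseteq> \<Union> \<K>" using V by blast
    ultimately show "\<exists>T>0. \<exists>e>0. skorokhod_nbhd x T e \<subseteq> \<Union> \<K>" by blast
  qed
qed

lemma openin_skorokhod: "openin skorokhod_topology = skorokhod_open"
  by (simp add: skorokhod_topology_def istopology_skorokhod_open topology_inverse')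

lemma topspace_skorokhod: "topspace skorokhod_topology = cadlag_paths"
proof -
  have "skorokhod_open cadlag_paths"
    by (auto simp: skorokhod_open_def skorokhod_nbhd_def intro: exI[of _ 1])
  then show ?thesis
    unfolding topspace_def openin_skorokhod by (auto simp: skorokhod_open_def)
qed

section \<open>Weak convergence of random elements of a topological space\<close>

text \<open>A random element takes its values in the space up to a null set and is Borel measurable
  with respect to the completed measure. Passing to the completion makes values on null sets
  irrelevant.\<close>

definition random_element :: "'a measure \<Rightarrow> 'c topology \<Rightarrow> ('a \<Rightarrow> 'c) \<Rightarrow> bool" where
  "random_element M T X \<longleftrightarrow>
     (AE \<omega> in M. X \<omega> \<in> topspace T) \<and>
     (\<forall>U. openin T U \<longrightarrow> X -` U \<inter> space M \<in> sets (completion M))"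

definition converges_weakly ::
  "'c topology \<Rightarrow> 'i filter \<Rightarrow> 'a measure \<Rightarrow> ('i \<Rightarrow> 'a \<Rightarrow> 'c) \<Rightarrow> 'b measure \<Rightarrow> ('b \<Rightarrow> 'c) \<Rightarrow> bool" where
  "converges_weakly T F M X N Z \<longleftrightarrow>
     (\<forall>\<^sub>F i in F. random_element M T (X i)) \<and> random_element N T Z \<and>
     (\<forall>f. continuous_map T euclideanreal f \<longrightarrow> bounded (f ` topspace T) \<longrightarrow>
        ((\<lambda>i. \<integral>\<omega>. f (X i \<omega>) \<partial>(completion M)) \<longlongrightarrow> (\<integral>\<omega>. f (Z \<omega>) \<partial>(completion N))) F)"

end

theory Submission
  imports Defs
begin

text \<open>At a weak record the pairs of steps and waiting times start afresh, so the times of successive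
  records of the continuous-time walk have i.i.d. increments. If \<open>f\<close> is the generating function of
  the number of steps between records and \<open>\<phi>\<close> the Laplace transform of a waiting time, such an
  increment has Laplace transform \<open>f (\<phi> s)\<close>. Sparre Andersen's identity
  \<open>- ln (1 - f z) = (\<Sum>n. z ^ n * P (S\<^sub>n \<ge> 0) / n)\<close> together with \<open>P (S\<^sub>n \<ge> 0) \<longlonglongrightarrow> \<rho>\<close> turns the
  regular variation of \<open>1 - \<phi>\<close> at 0, of index \<open>\<alpha>\<close>, into regular variation of
  \<open>\<psi> = 1 - f \<circ> \<phi>\<close>, of index \<open>\<alpha> * \<rho>\<close>. With \<open>u l = 1 / \<psi> (1 / l)\<close>, the time of record number
  \<open>u l * v\<close> divided by \<open>l\<close> converges jointly in \<open>v\<close> to the stable subordinator, because its mixed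
  moments of \<open>exp (- _)\<close> do. Inverting, the finite-dimensional laws of the scaled record
  counts converge; as paths are increasing and the limit is continuous, this gives convergence in
  the Skorokhod space.\<close>

text \<open>Three obstacles shape the proof. Nothing explicit is known about
  \<open>ladder_gf\<close>. But only ratios of \<open>psi\<close> matter, and in the logarithm of
  \<open>psi X Y (c * s) / psi X Y s\<close> the coefficients P(S_n \<ge> 0) multiply numbers (z ^ n
  - w ^ n) / n of one sign with explicit sum ln ((1 - w) / (1 - z)), so replacing them by \<rho>
  costs little. Next, a record time is a sum of a random number of waiting times. Integrating these
  out first attaches a factor to each step, so Laplace transforms become weighted ladder
  probabilities. Finally, the Skorokhod topology enters through all its open sets and continuous
  functions. Monotone paths are therefore coded by finitely many rounded values. Codes are countably
  many, a fine code pins down a path near a continuous limit, and convergence of each code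
  probability to a probability law rules out loss of mass. A code is a finite set of inequalities
  between level-crossing times and fixed times, and exp (- time) lies in [0, 1], where polynomials
  are dense.\<close>

lemma measure_Collect_eq_integral:
  "measure M {\<omega>\<in>space M. P \<omega>} = (\<integral>\<omega>. of_bool (P \<omega>) \<partial>M)"
proof -
  have "{\<omega>\<in>space M. P \<omega>} \<inter> space M = {\<omega>\<in>space M. P \<omega>}" by auto
  \<comment> \<open>For a set outside the sigma-algebra both sides are 0, so the equation holds for
    every predicate.\<close>
  then have "measure M {\<omega>\<in>space M. P \<omega>} = (\<integral>\<omega>. indicator {\<omega>\<in>space M. P \<omega>} \<omega> \<partial>M)"
    by (simp only: Bochner_Integration.integral_indicator)
  also have "\<dots> = (\<integral>\<omega>. of_bool (P \<omega>) \<partial>M)"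
    by (rule Bochner_Integration.integral_cong) (auto simp: indicator_def)
  finally show ?thesis .
qed

section \<open>Record indices of a deterministic walk\<close>

text \<open>The combinatorics of records is done for one fixed sequence;
  \<open>weak_record_iff\<close> connects it with \<open>walk\<close> and
  \<open>weak_record\<close>. The same sum also serves the waiting times.\<close>

definition partial_sum :: "(nat \<Rightarrow> real) \<Rightarrow> nat \<Rightarrow> real" where
  "partial_sum x n = (\<Sum>k=1..n. x k)"

definition record_at :: "(nat \<Rightarrow> real) \<Rightarrow> nat \<Rightarrow> bool" where
  "record_at x n \<longleftrightarrow> (\<forall>k\<le>n. partial_sum x k \<le> partial_sum x n)"

text \<open>Index 0 is left out: the count then vanishes at 0 and is additive when the walk is
  restarted at a record. The count \<open>ctrw_records\<close> is larger by one.\<close>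

definition record_count :: "(nat \<Rightarrow> real) \<Rightarrow> nat \<Rightarrow> nat" where
  "record_count x n = card {j\<in>{1..n}. record_at x j}"

text \<open>The k-th weak ladder epoch as a relation, because a given sequence may have fewer than k
  records.\<close>

definition ladder :: "(nat \<Rightarrow> real) \<Rightarrow> nat \<Rightarrow> nat \<Rightarrow> bool" where
  "ladder x k n \<longleftrightarrow> record_at x n \<and> record_count x n = k"

text \<open>A step of the walk made after exactly \<open>j\<close> records (index 0 not counted) carries the weight
  \<open>z j\<close>.\<close>

definition ladder_weight :: "(nat \<Rightarrow> real) \<Rightarrow> (nat \<Rightarrow> real) \<Rightarrow> nat \<Rightarrow> real" where
  "ladder_weight z x n = (\<Prod>m=1..n. z (record_count x (m - 1)))"

lemma partial_sum_0 [simp]: "partial_sum x 0 = 0"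
  by (simp add: partial_sum_def)

lemma partial_sum_Suc [simp]: "partial_sum x (Suc n) = partial_sum x n + x (Suc n)"
  by (simp add: partial_sum_def)

lemma record_at_0 [simp]: "record_at x 0"
  by (simp add: record_at_def)

lemma record_count_0 [simp]: "record_count x 0 = 0"
  by (simp add: record_count_def)

lemma record_count_Suc: "record_count x (Suc n) = record_count x n + (if record_at x (Suc n) then 1 else 0)"
proof -
  have "{j\<in>{1..Suc n}. record_at x j} =
      {j\<in>{1..n}. record_at x j} \<union> (if record_at x (Suc n) then {Suc n} else {})"
    by (auto simp: le_Suc_eq)
  then show ?thesis by (auto simp: record_count_def)
qed

lemma partial_sum_shift: "partial_sum (\<lambda>i. x (i + n)) j = partial_sum x (n + j) - partial_sum x n"
  by (induction j) (simp_all add: add.commute)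

text \<open>S_n dominates everything before it, so a later value is a record of the whole walk iff
  it dominates the values from n on.\<close>

lemma record_at_shift:
  assumes "record_at x n"
  shows "record_at (\<lambda>i. x (i + n)) j \<longleftrightarrow> record_at x (n + j)"
proof
  assume *: "record_at (\<lambda>i. x (i + n)) j"
  have ge: "partial_sum x n \<le> partial_sum x (n + j)"
    using *[unfolded record_at_def, rule_format, of 0] by (simp add: partial_sum_shift)
  show "record_at x (n + j)"
    unfolding record_at_def
  proof (intro allI impI)
    fix k assume k: "k \<le> n + j"
    show "partial_sum x k \<le> partial_sum x (n + j)"
    proof (cases "k \<le> n")
      case True
      then show ?thesis using assms ge unfolding record_at_def by (meson order_trans)
    next
      case False
      then have "k - n \<le> j" "n + (k - n) = k" using k by auto
      then show ?thesis
        using *[unfolded record_at_def, rule_format, of "k - n"] by (simp add: partial_sum_shift)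
    qed
  qed
next
  assume "record_at x (n + j)"
  then show "record_at (\<lambda>i. x (i + n)) j" by (simp add: record_at_def partial_sum_shift)
qed

lemma record_count_shift:
  assumes "record_at x n"
  shows "record_count x (n + j) = record_count x n + record_count (\<lambda>i. x (i + n)) j"
proof (induction j)
  case (Suc j)
  then show ?case using record_at_shift[OF assms, of "Suc j"] by (simp add: record_count_Suc)
qed simp

lemma ladder_shift:
  assumes "ladder x k n"
  shows "ladder (\<lambda>i. x (i + n)) r j \<longleftrightarrow> ladder x (k + r) (n + j)"
  using assms record_at_shift[of x n j] record_count_shift[of x n j] by (auto simp: ladder_def)

lemma record_count_mono: "m \<le> n \<Longrightarrow> record_count x m \<le> record_count x n"
  by (induction rule: dec_induct) (simp_all add: record_count_Suc)

lemma record_count_less: "m < n \<Longrightarrow> record_at x n \<Longrightarrow> record_count x m < record_count x n"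
  using record_count_mono[of m "n - 1" x] record_count_Suc[of x "n - 1"] by (cases n) auto

lemma ladder_unique: "ladder x k n \<Longrightarrow> ladder x k m \<Longrightarrow> n = m"
  using record_count_less[of n m x] record_count_less[of m n x] unfolding ladder_def
  by (metis less_irrefl nat_neq_iff)

lemma ladder_0: "ladder x 0 n \<longleftrightarrow> n = 0"
  using ladder_unique[of x 0 n 0] by (auto simp: ladder_def)

lemma ladder_at_0: "ladder x k 0 \<longleftrightarrow> k = 0"
  by (auto simp: ladder_def)

lemma ladder_SucE:
  assumes "ladder x (Suc k) n'"
  obtains n where "n < n'" "ladder x k n"
proof -
  have n': "n' > 0" using assms ladder_at_0 by (cases n') auto
  \<comment> \<open>The last record before n'; from it up to n' - 1 the count is constant.\<close>
  define n where "n = Max {m. m < n' \<and> record_at x m}"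
  have "n \<in> {m. m < n' \<and> record_at x m}"
    unfolding n_def by (rule Max_in) (use n' in auto)
  then have n: "n < n'" "record_at x n" by auto
  have nr: "\<not> record_at x m" if "n < m" "m < n'" for m
    using that Max_ge[of "{m. m < n' \<and> record_at x m}" m] by (auto simp: n_def[symmetric])
  have eq: "record_count x m = record_count x n" if "n \<le> m" "m < n'" for m
    using that
  proof (induction m rule: dec_induct)
    case (step m)
    then show ?case using nr[of "Suc m"] by (simp add: record_count_Suc)
  qed simp
  have "record_count x (n' - 1) = record_count x n" by (rule eq) (use n in auto)
  then have "record_count x n' = record_count x n + 1"
    using n' assms record_count_Suc[of x "n' - 1"] by (simp add: ladder_def)
  then show ?thesis using that[OF n(1)] n assms by (simp add: ladder_def)
qed

lemma ladder_weight_0 [simp]: "ladder_weight z x 0 = 1"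
  by (simp add: ladder_weight_def)

lemma ladder_weight_Suc: "ladder_weight z x (Suc n) = ladder_weight z x n * z (record_count x n)"
  by (simp add: ladder_weight_def)

text \<open>From record k up to the step that produces record k + 1 the count stays k, so all n' - n
  steps carry the weight z k.\<close>

lemma ladder_weight_ladder_Suc:
  assumes "ladder x k n" "ladder x (Suc k) n'" "n < n'"
  shows "ladder_weight z x n' = ladder_weight z x n * z k ^ (n' - n)"
proof -
  have *: "record_count x m = k" if "n \<le> m" "m < n'" for m
    using record_count_mono[OF that(1), of x] record_count_less[OF that(2), of x] assms by (simp add:
        ladder_def)
  have **: "m \<le> n' \<Longrightarrow> ladder_weight z x m = ladder_weight z x n * z k ^ (m - n)" if "n \<le> m" for m
    using that
  proof (induction m rule: dec_induct)
    case (step m)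
    then show ?case using *[of m] by (simp add: ladder_weight_Suc Suc_diff_le)
  qed simp
  show ?thesis using **[of n'] assms by simp
qed

text \<open>Renewal equation along a single path. Record k + 1 has a unique predecessor record, so
  the sum has at most one nonzero term, and the second factor sees only the steps after n.\<close>

lemma ladder_Suc_decomp:
  "of_bool (ladder x (Suc k) n') * ladder_weight z x n' =
     (\<Sum>n<n'. (of_bool (ladder x k n) * ladder_weight z x n) *
        (z k ^ (n' - n) * of_bool (ladder (\<lambda>i. x (i + n)) 1 (n' - n))))"
proof -
  have *: "ladder (\<lambda>i. x (i + n)) 1 (n' - n) \<longleftrightarrow> ladder x (Suc k) n'" if "ladder x k n" "n < n'" for n
    using ladder_shift[OF that(1), of 1 "n' - n"] that by simp
  show ?thesis
  proof (cases "ladder x (Suc k) n'")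
    case True
    then obtain n where n: "n < n'" "ladder x k n" by (rule ladder_SucE)
    have "(\<Sum>n<n'. (of_bool (ladder x k n) * ladder_weight z x n) *
        (z k ^ (n' - n) * of_bool (ladder (\<lambda>i. x (i + n)) 1 (n' - n)))) =
        (\<Sum>m\<in>{n}. (of_bool (ladder x k m) * ladder_weight z x m) *
        (z k ^ (n' - m) * of_bool (ladder (\<lambda>i. x (i + m)) 1 (n' - m))))"
      by (rule sum.mono_neutral_right) (use n in \<open>auto dest: ladder_unique[OF n(2)]\<close>)
    also have "\<dots> = ladder_weight z x n * z k ^ (n' - n)"
      using True n *[OF n(2,1)] by simp
    finally show ?thesis using True ladder_weight_ladder_Suc[OF n(2) True n(1)] by simp
  next
    case False
    have "(of_bool (ladder x k n) * ladder_weight z x n) *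
        (z k ^ (n' - n) * of_bool (ladder (\<lambda>i. x (i + n)) 1 (n' - n))) = 0" if "n < n'" for n
      using *[of n] that False by auto
    then show ?thesis using False by (simp add: sum.neutral)
  qed
qed

section \<open>Cyclic rotations of a periodic walk\<close>

lemma sum_periodic:
  fixes f :: "nat \<Rightarrow> real"
  assumes "\<And>m. f (m + n) = f m"
  shows "(\<Sum>j<n. f (\<nu> + j)) = (\<Sum>j<n. f j)"
proof (induction \<nu>)
  case (Suc \<nu>)
  have "(\<Sum>j<n. f (Suc \<nu> + j)) + f \<nu> = (\<Sum>j<Suc n. f (\<nu> + j))"
    by (subst sum.lessThan_Suc_shift) simp
  also have "\<dots> = (\<Sum>j<n. f (\<nu> + j)) + f \<nu>"
    using assms[of \<nu>] by simp
  finally show ?case using Suc by simp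
qed simp

text \<open>Feller's cyclic lemma. When the periodic walk has nonnegative drift, the cyclic shifts that
  end in a record are as many as the records of any one of them.\<close>

lemma ladder_cyclic:
  assumes n: "n \<ge> 1" and per: "\<And>i. i \<ge> 1 \<Longrightarrow> x (i + n) = x i"
  shows "(\<Sum>\<nu><n. \<Sum>r=1..n. of_bool (ladder (\<lambda>i. x (i + \<nu>)) r n) / real r) = of_bool (partial_sum x n \<ge> 0)"
proof -
  let ?S = "partial_sum x"
  have S: "?S (m + n) = ?S m + ?S n" for m
  proof (induction m)
    case (Suc m)
    then show ?case using per[of "Suc m"] by simp
  qed simp
  \<comment> \<open>A record is at least S_0 = 0, and every shift ends after one period at
    \<open>?S n\<close>. So with negative drift no shift ends in a record.\<close>
  have end_le: "?S n \<ge> 0" if "ladder (\<lambda>i. x (i + \<nu>)) r n" for \<nu> r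
  proof -
    have "partial_sum (\<lambda>i. x (i + \<nu>)) 0 \<le> partial_sum (\<lambda>i. x (i + \<nu>)) n"
      using that unfolding ladder_def record_at_def by blast
    then show ?thesis using S[of \<nu>] by (simp add: partial_sum_shift)
  qed
  show ?thesis
  proof (cases "?S n \<ge> 0")
    case False
    then show ?thesis using end_le by (auto intro!: sum.neutral)
  next
    case True
    \<comment> \<open>\<open>Q\<close> says that the shift by \<nu> ends in a record after one
      period, written on the unshifted walk. As the walk gains the constant \<open>?S n\<close> per
      period, \<open>Q\<close> has period n.\<close>
    define Q where "Q \<nu> \<longleftrightarrow> (\<forall>j\<le>n. ?S (\<nu> + j) \<le> ?S (\<nu> + n))" for \<nu>
    have Qper: "Q (m + n) = Q m" for m
    proof -
      have "?S (m + n + j) = ?S (m + j) + ?S n" for j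
        using S[of "m + j"] by (simp add: ac_simps)
      then show ?thesis by (simp only: Q_def add_le_cancel_right)
    qed
    have rec_n: "record_at (\<lambda>i. x (i + \<nu>)) n \<longleftrightarrow> Q \<nu>" for \<nu>
      by (simp add: record_at_def Q_def partial_sum_shift)
    \<comment> \<open>Once the shift by \<nu> ends in a record, its inner records are exactly the
      rotations that end in a record. Indices beyond one period are folded back at the price of one
      \<open>?S n\<close>.\<close>
    have rec_j: "record_at (\<lambda>i. x (i + \<nu>)) j \<longleftrightarrow> Q (\<nu> + j)" if Q: "Q \<nu>" and j: "1 \<le> j" "j \<le> n" for \<nu> j
    proof
      assume *: "record_at (\<lambda>i. x (i + \<nu>)) j"
      then have *: "?S (\<nu> + i) \<le> ?S (\<nu> + j)" if "i \<le> j" for i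
        using that by (simp add: record_at_def partial_sum_shift)
      show "Q (\<nu> + j)"
        unfolding Q_def
      proof (intro allI impI)
        fix i assume i: "i \<le> n"
        show "?S (\<nu> + j + i) \<le> ?S (\<nu> + j + n)"
        proof (cases "n \<le> j + i")
          case True
          then have "?S (\<nu> + j + i) = ?S (\<nu> + (j + i - n)) + ?S n"
            using S[of "\<nu> + (j + i - n)"] by (simp add: ac_simps)
          also have "\<dots> \<le> ?S (\<nu> + j) + ?S n" using *[of "j + i - n"] i by simp
          finally show ?thesis using S[of "\<nu> + j"] by simp
        next
          case False
          then have "?S (\<nu> + j + i) \<le> ?S (\<nu> + n)"
            using Q[unfolded Q_def, rule_format, of "j + i"] by (simp add: ac_simps)
          also have "\<dots> \<le> ?S (\<nu> + j) + ?S n" using *[of 0] S[of \<nu>] by simp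
          finally show ?thesis using S[of "\<nu> + j"] by simp
        qed
      qed
    next
      assume *: "Q (\<nu> + j)"
      show "record_at (\<lambda>i. x (i + \<nu>)) j"
        unfolding record_at_def
      proof (intro allI impI)
        fix i assume i: "i \<le> j"
        have "?S (\<nu> + j + (n - (j - i))) \<le> ?S (\<nu> + j + n)"
          using *[unfolded Q_def, rule_format, of "n - (j - i)"] by simp
        moreover have "\<nu> + j + (n - (j - i)) = \<nu> + i + n" using i j by simp
        ultimately show "partial_sum (\<lambda>i. x (i + \<nu>)) i \<le> partial_sum (\<lambda>i. x (i + \<nu>)) j"
          using S[of "\<nu> + i"] S[of "\<nu> + j"] by (simp add: partial_sum_shift ac_simps)
      qed
    qed
    define r0 where "r0 = card {j\<in>{..<n}. Q j}"
    have r0: "real r0 = (\<Sum>j<n. of_bool (Q j))"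
      by (simp add: r0_def sum_of_bool_eq Int_def)
    have record_count_r0: "record_count (\<lambda>i. x (i + \<nu>)) n = r0" if Q: "Q \<nu>" for \<nu>
    proof -
      have "record_count (\<lambda>i. x (i + \<nu>)) n = card {j\<in>{1..n}. Q (\<nu> + j)}"
        unfolding record_count_def using rec_j[OF Q] by (intro arg_cong[where f=card]) auto
      then have "real (record_count (\<lambda>i. x (i + \<nu>)) n) = (\<Sum>j=1..n. of_bool (Q (\<nu> + j)))"
        by (simp add: sum_of_bool_eq Int_def)
      also have "\<dots> = (\<Sum>j<n. of_bool (Q (Suc \<nu> + j)))"
        by (rule sum.reindex_bij_witness[of _ Suc "\<lambda>j. j - 1"]) auto
      also have "\<dots> = real r0"
        unfolding r0 by (rule sum_periodic[of "\<lambda>j. of_bool (Q j)"]) (simp add: Qper)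
      finally show ?thesis by simp
    qed
    \<comment> \<open>Rotating to a maximum of S over one period gives a shift that ends in a
      record, so the final quotient r0 / r0 is 1.\<close>
    have "r0 \<ge> 1"
    proof -
      obtain m where m: "m \<in> {1..n}" "\<And>i. i \<in> {1..n} \<Longrightarrow> ?S i \<le> ?S m"
      proof -
        have "Max (?S ` {1..n}) \<in> ?S ` {1..n}" using n by (intro Max_in) auto
        then obtain m where "m \<in> {1..n}" "?S m = Max (?S ` {1..n})" by auto
        then show ?thesis using that[of m] by auto
      qed
      have "Q m"
        unfolding Q_def
      proof (intro allI impI)
        fix j assume j: "j \<le> n"
        show "?S (m + j) \<le> ?S (m + n)"
        proof (cases "m + j \<le> n")
          case True
          then show ?thesis using m(2)[of "m + j"] m(1) S[of m] \<open>?S n \<ge> 0\<close> by simp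
        next
          case False
          then have "?S (m + j) = ?S (m + j - n) + ?S n" using S[of "m + j - n"] by simp
          moreover have "?S (m + j - n) \<le> ?S m"
            by (rule m(2)) (use False j m(1) in auto)
          ultimately show ?thesis using S[of m] by simp
        qed
      qed
      then have "(m mod n) \<in> {j\<in>{..<n}. Q j}"
        using m(1) n Qper[of 0] by (cases "m = n") auto
      then have "card {j\<in>{..<n}. Q j} > 0" by (subst card_gt_0_iff) auto
      then show ?thesis by (simp add: r0_def)
    qed
    moreover have "r0 \<le> n"
      unfolding r0_def by (rule order_trans[OF card_mono[of "{..<n}"]]) auto
    \<comment> \<open>Only r = r0 contributes, so each of the r0 shifts that end in a record adds 1
      / r0.\<close>
    ultimately have "(\<Sum>r=1..n. of_bool (ladder (\<lambda>i. x (i + \<nu>)) r n) / real r) = of_bool (Q \<nu>) / real r0" for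
        \<nu>
      using rec_n[of \<nu>] record_count_r0[of \<nu>]
      by (subst sum.mono_neutral_right[where S = "{r0}"]) (auto simp: ladder_def)
    then have "(\<Sum>\<nu><n. \<Sum>r=1..n. of_bool (ladder (\<lambda>i. x (i + \<nu>)) r n) / real r) = (\<Sum>\<nu><n. of_bool (Q \<nu>) / real
        r0)"
      by simp
    also have "\<dots> = real r0 / real r0" by (simp only: r0 sum_divide_distrib[symmetric])
    finally show ?thesis using True \<open>r0 \<ge> 1\<close> by simp
  qed
qed

section \<open>Renewal structure of the ladder epochs\<close>

lemma partial_sum_cong: "(\<And>i. 1 \<le> i \<Longrightarrow> i \<le> n \<Longrightarrow> x i = y i) \<Longrightarrow> partial_sum x n = partial_sum y n"
  unfolding partial_sum_def by (intro sum.cong) auto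

lemma record_at_cong:
  assumes "\<And>i. 1 \<le> i \<Longrightarrow> i \<le> n \<Longrightarrow> x i = y i"
  shows "record_at x n = record_at y n"
proof -
  have "partial_sum x k = partial_sum y k" if "k \<le> n" for k
    by (rule partial_sum_cong) (use assms that in auto)
  then show ?thesis by (auto simp: record_at_def)
qed

lemma record_count_cong:
  assumes "\<And>i. 1 \<le> i \<Longrightarrow> i \<le> n \<Longrightarrow> x i = y i"
  shows "record_count x n = record_count y n"
proof -
  have "record_at x k = record_at y k" if "k \<le> n" for k
    by (rule record_at_cong) (use assms that in auto)
  then have "{j\<in>{1..n}. record_at x j} = {j\<in>{1..n}. record_at y j}" by auto
  then show ?thesis by (simp add: record_count_def)
qed

lemma ladder_cong:
  assumes "\<And>i. 1 \<le> i \<Longrightarrow> i \<le> n \<Longrightarrow> x i = y i"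
  shows "ladder x k n = ladder y k n"
  using record_at_cong[of n x y] record_count_cong[of n x y] assms by (simp add: ladder_def)

lemma ladder_weight_cong:
  assumes "\<And>i. 1 \<le> i \<Longrightarrow> i \<le> n \<Longrightarrow> x i = y i"
  shows "ladder_weight z x n = ladder_weight z y n"
  unfolding ladder_weight_def
proof (rule prod.cong)
  fix m assume "m \<in> {1..n}"
  then have "record_count x (m - 1) = record_count y (m - 1)"
    by (intro record_count_cong assms) auto
  then show "z (record_count x (m - 1)) = z (record_count y (m - 1))" by simp
qed simp

lemma measurable_partial_sum:
  assumes "\<And>i. 1 \<le> i \<Longrightarrow> i \<le> n \<Longrightarrow> (\<lambda>\<omega>. x \<omega> i) \<in> borel_measurable N"
  shows "(\<lambda>\<omega>. partial_sum (x \<omega>) n) \<in> borel_measurable N"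
  unfolding partial_sum_def by (rule borel_measurable_sum) (use assms in auto)

lemma pred_record_at:
  assumes "\<And>i. 1 \<le> i \<Longrightarrow> i \<le> n \<Longrightarrow> (\<lambda>\<omega>. x \<omega> i) \<in> borel_measurable N"
  shows "Measurable.pred N (\<lambda>\<omega>. record_at (x \<omega>) n)"
proof -
  have [measurable]: "(\<lambda>\<omega>. partial_sum (x \<omega>) k) \<in> borel_measurable N" if "k \<in> {..n}" for k
    using that by (intro measurable_partial_sum assms) auto
  have "record_at (x \<omega>) n \<longleftrightarrow> (\<forall>k\<in>{..n}. partial_sum (x \<omega>) k \<le> partial_sum (x \<omega>) n)" for \<omega>
    by (auto simp: record_at_def)
  then show ?thesis by simp
qed

lemma measurable_record_count:
  assumes "\<And>i. 1 \<le> i \<Longrightarrow> i \<le> n \<Longrightarrow> (\<lambda>\<omega>. x \<omega> i) \<in> borel_measurable N"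
  shows "(\<lambda>\<omega>. record_count (x \<omega>) n) \<in> measurable N (count_space UNIV)"
  using assms
proof (induction n)
  case (Suc n)
  have [measurable]: "(\<lambda>\<omega>. record_count (x \<omega>) n) \<in> measurable N (count_space UNIV)"
    by (rule Suc.IH) (use Suc.prems in auto)
  have [measurable]: "Measurable.pred N (\<lambda>\<omega>. record_at (x \<omega>) (Suc n))"
    by (rule pred_record_at) (use Suc.prems in auto)
  show ?case unfolding record_count_Suc by measurable
qed simp

lemma pred_ladder:
  assumes "\<And>i. 1 \<le> i \<Longrightarrow> i \<le> n \<Longrightarrow> (\<lambda>\<omega>. x \<omega> i) \<in> borel_measurable N"
  shows "Measurable.pred N (\<lambda>\<omega>. ladder (x \<omega>) k n)"
proof -
  note [measurable] = pred_record_at[of n x N, OF assms] measurable_record_count[of n x N, OF assms]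
  show ?thesis unfolding ladder_def by measurable
qed

lemma measurable_ladder_weight:
  assumes "\<And>i. 1 \<le> i \<Longrightarrow> i \<le> n \<Longrightarrow> (\<lambda>\<omega>. x \<omega> i) \<in> borel_measurable N"
  shows "(\<lambda>\<omega>. ladder_weight z (x \<omega>) n) \<in> borel_measurable N"
  unfolding ladder_weight_def
proof (rule borel_measurable_prod)
  fix m assume "m \<in> {1..n}"
  then have [measurable]: "(\<lambda>\<omega>. record_count (x \<omega>) (m - 1)) \<in> measurable N (count_space UNIV)"
    by (intro measurable_record_count assms) auto
  show "(\<lambda>\<omega>. z (record_count (x \<omega>) (m - 1))) \<in> borel_measurable N" by measurable
qed

lemma ladder_weight_bounds:
  assumes "\<And>j. 0 \<le> z j" "\<And>j. z j \<le> 1"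
  shows "0 \<le> ladder_weight z x n" "ladder_weight z x n \<le> 1"
  unfolding ladder_weight_def using assms by (auto intro: prod_nonneg prod_le_1)

lemma ladder_weight_const: "ladder_weight (\<lambda>_. z) x n = z ^ n"
  by (simp add: ladder_weight_def)

section \<open>Ladder probabilities of an i.i.d. walk\<close>

lemma iid_measurable:
  assumes "prob_space M" "iid_sequence M X" "i \<ge> 1"
  shows "X i \<in> borel_measurable M"
  using assms unfolding iid_sequence_def prob_space.indep_vars_def[OF assms(1)] by auto

lemma iid_indep: "prob_space M \<Longrightarrow> iid_sequence M X \<Longrightarrow> prob_space.indep_vars M (\<lambda>_. borel) X {1..}"
  by (simp add: iid_sequence_def)

lemma iid_distr: "iid_sequence M X \<Longrightarrow> i \<ge> 1 \<Longrightarrow> distr M borel (X i) = distr M borel (X 1)"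
  unfolding iid_sequence_def by blast

context prob_space
begin

text \<open>Shifts and cyclic rotations of the steps are both injective reindexings; this is the
  common reason why neither changes the law.\<close>

lemma iid_distr_reindex:
  assumes iid: "iid_sequence M X" and f: "inj_on f I" "f ` I \<subseteq> {1..}"
  shows "distr M (PiM I (\<lambda>_. borel)) (\<lambda>\<omega>. \<lambda>i\<in>I. X (f i) \<omega>) = PiM I (\<lambda>_. distr M borel (X 1))"
proof -
  let ?mu = "distr M borel (X 1)"
  note rv = iid_measurable[OF prob_space_axioms iid]
  interpret mu: prob_space ?mu by (rule prob_space_distr) (rule rv, simp)
  have "distr M (PiM {1..} (\<lambda>_. borel)) (\<lambda>\<omega>. \<lambda>i\<in>{1..}. X i \<omega>) = PiM {1..} (\<lambda>i. distr M borel (X i))"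
    by (rule indep_vars_iff_distr_eq_PiM'[THEN iffD1])
      (auto simp del: One_nat_def intro: rv iid_indep[OF prob_space_axioms iid])
  also have "\<dots> = PiM {1..} (\<lambda>i. ?mu)"
    by (intro PiM_cong iid_distr[OF iid]) auto
  finally have D: "distr M (PiM {1..} (\<lambda>_. borel)) (\<lambda>\<omega>. \<lambda>i\<in>{1..}. X i \<omega>) = PiM {1..} (\<lambda>i. ?mu)" .
  have "PiM I (\<lambda>_. ?mu) = distr (PiM {1..} (\<lambda>i. ?mu)) (PiM I (\<lambda>_. ?mu)) (\<lambda>\<omega>. \<lambda>n\<in>I. \<omega> (f n))"
    by (rule distr_PiM_reindex[symmetric, OF mu.prob_space_axioms f(1)]) (use f in auto)
  also have "\<dots> = distr (PiM {1..} (\<lambda>i. ?mu)) (PiM I (\<lambda>_. borel)) (\<lambda>\<omega>. \<lambda>n\<in>I. \<omega> (f n))"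
    by (intro distr_cong sets_PiM_cong) auto
  also have "\<dots> = distr M (PiM I (\<lambda>_. borel)) ((\<lambda>\<omega>. \<lambda>n\<in>I. \<omega> (f n)) \<circ> (\<lambda>\<omega>. \<lambda>i\<in>{1..}. X i \<omega>))"
    unfolding D[symmetric]
    by (rule distr_distr) (use f rv in \<open>auto intro!: measurable_restrict measurable_component_singleton\<close>)
  also have "\<dots> = distr M (PiM I (\<lambda>_. borel)) (\<lambda>\<omega>. \<lambda>i\<in>I. X (f i) \<omega>)"
    by (rule distr_cong) (use f in \<open>auto simp: fun_eq_iff restrict_def\<close>)
  finally show ?thesis by simp
qed

definition ladder_prob :: "(nat \<Rightarrow> 'a \<Rightarrow> real) \<Rightarrow> nat \<Rightarrow> nat \<Rightarrow> real" where
  "ladder_prob X k n = \<P>(\<omega> in M. ladder (\<lambda>i. X i \<omega>) k n)"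

text \<open>The event looks at n coordinates only, so its probability is read off the product law,
  which is the same for \<open>f\<close> and for the identity.\<close>

lemma prob_ladder_reindex:
  assumes iid: "iid_sequence M X" and f: "inj_on f {1..n}" "f ` {1..n} \<subseteq> {1..}"
  shows "\<P>(\<omega> in M. ladder (\<lambda>i. X (f i) \<omega>) k n) = ladder_prob X k n"
proof -
  note rv = iid_measurable[OF prob_space_axioms iid]
  let ?P = "PiM {1..n} (\<lambda>_. borel :: real measure)"
  let ?A = "{x\<in>space ?P. ladder x k n}"
  have A: "?A \<in> sets ?P"
  proof -
    have "Measurable.pred ?P (\<lambda>x. ladder x k n)"
      by (rule pred_ladder) (auto intro: measurable_component_singleton)
    then show ?thesis by simp
  qed
  have *: "\<P>(\<omega> in M. ladder (\<lambda>i. X (g i) \<omega>) k n) = measure (PiM {1..n} (\<lambda>_. distr M borel (X 1))) ?A"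
    if g: "inj_on g {1..n}" "g ` {1..n} \<subseteq> {1..}" for g
  proof -
    have m: "(\<lambda>\<omega>. \<lambda>i\<in>{1..n}. X (g i) \<omega>) \<in> measurable M ?P"
      using g rv by (auto intro!: measurable_restrict)
    have "measure (PiM {1..n} (\<lambda>_. distr M borel (X 1))) ?A =
       measure (distr M ?P (\<lambda>\<omega>. \<lambda>i\<in>{1..n}. X (g i) \<omega>)) ?A"
      using iid_distr_reindex[OF iid g] by simp
    also have "\<dots> = measure M ((\<lambda>\<omega>. \<lambda>i\<in>{1..n}. X (g i) \<omega>) -` ?A \<inter> space M)"
      by (rule measure_distr[OF m A])
    also have "(\<lambda>\<omega>. \<lambda>i\<in>{1..n}. X (g i) \<omega>) -` ?A \<inter> space M = {\<omega>\<in>space M. ladder (\<lambda>i. X (g i) \<omega>) k n}"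
    proof -
      have "ladder (\<lambda>i\<in>{1..n}. X (g i) \<omega>) k n = ladder (\<lambda>i. X (g i) \<omega>) k n" for \<omega>
        by (rule ladder_cong) auto
      then show ?thesis using measurable_space[OF m] by auto
    qed
    finally show ?thesis ..
  qed
  show ?thesis unfolding ladder_prob_def using *[OF f] *[of "\<lambda>i. i"] by auto
qed

lemma ladder_prob_nonneg: "0 \<le> ladder_prob X k n"
  by (simp add: ladder_prob_def)

lemma expectation_ladder: "expectation (\<lambda>\<omega>. of_bool (ladder (\<lambda>i. X i \<omega>) k n)) = ladder_prob X k n"
  unfolding ladder_prob_def by (rule measure_Collect_eq_integral[symmetric])

lemma integrable_bounded:
  "f \<in> borel_measurable M \<Longrightarrow> (\<And>\<omega>. \<bar>f \<omega>\<bar> \<le> B) \<Longrightarrow> integrable M f" for f :: "'a \<Rightarrow> real"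
  by (rule integrable_const_bound[where B=B]) auto

definition weighted_ladder_prob :: "(nat \<Rightarrow> 'a \<Rightarrow> real) \<Rightarrow> (nat \<Rightarrow> real) \<Rightarrow> nat \<Rightarrow> nat \<Rightarrow> real" where
  "weighted_ladder_prob X z k n = expectation (\<lambda>\<omega>. of_bool (ladder (\<lambda>i. X i \<omega>) k n) * ladder_weight z (\<lambda>i. X
      i \<omega>) n)"

text \<open>Expectation of \<open>ladder_Suc_decomp\<close>. In each summand the first factor
  depends on the steps up to n and the second on those after n, so it factorises, and the restarted
  walk has the law of the original one.\<close>

lemma weighted_ladder_prob_Suc:
  assumes iid: "iid_sequence M X" and z: "\<And>j. 0 \<le> z j" "\<And>j. z j \<le> 1"
  shows "weighted_ladder_prob X z (Suc k) n' = (\<Sum>n<n'. weighted_ladder_prob X z k n * (z k ^ (n' - n) *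
      ladder_prob X 1 (n' - n)))"
proof -
  note rv = iid_measurable[OF prob_space_axioms iid]
  let ?P = "\<lambda>I. PiM I (\<lambda>_. borel :: real measure)"
  have zk: "0 \<le> z k ^ m" "z k ^ m \<le> 1" for m
    using z[of k] by (auto intro: power_le_one)
  let ?g = "\<lambda>n \<omega>. of_bool (ladder (\<lambda>i. X i \<omega>) k n) * ladder_weight z (\<lambda>i. X i \<omega>) n"
  let ?h = "\<lambda>n \<omega>. z k ^ (n' - n) * of_bool (ladder (\<lambda>i. X (i + n) \<omega>) 1 (n' - n))"
  have mg: "?g n \<in> borel_measurable M" for n
    using pred_ladder[of n "\<lambda>\<omega> i. X i \<omega>" M k] measurable_ladder_weight[of n "\<lambda>\<omega> i. X i \<omega>" M z] rv
    by measurable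
  have mh: "?h n \<in> borel_measurable M" for n
    using pred_ladder[of "n' - n" "\<lambda>\<omega> i. X (i + n) \<omega>" M 1] rv
    by measurable
  have bg: "\<bar>?g n \<omega>\<bar> \<le> 1" and bh: "\<bar>?h n \<omega>\<bar> \<le> 1" for n \<omega>
    using ladder_weight_bounds[of z, OF z] zk[of "n' - n"] by (auto simp: of_bool_def)
  have ig: "integrable M (?g n)" and ih: "integrable M (?h n)" for n
    using integrable_bounded[OF mg bg] integrable_bounded[OF mh bh] by auto
  have split: "expectation (\<lambda>\<omega>. ?g n \<omega> * ?h n \<omega>) = expectation (?g n) * expectation (?h n) \<and>
      integrable M (\<lambda>\<omega>. ?g n \<omega> * ?h n \<omega>)" if n: "n < n'" for n
  proof -
    let ?A = "{1..n}" and ?B = "{n+1..n'}"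
    let ?G = "\<lambda>x. of_bool (ladder x k n) * ladder_weight z x n :: real"
    let ?H = "\<lambda>x. z k ^ (n' - n) * of_bool (ladder (\<lambda>i. x (i + n)) 1 (n' - n)) :: real"
    have ind: "indep_var (?P ?A) (\<lambda>\<omega>. restrict (\<lambda>i. X i \<omega>) ?A) (?P ?B) (\<lambda>\<omega>. restrict (\<lambda>i. X i \<omega>) ?B)"
      by (intro indep_var_restrict[OF iid_indep[OF prob_space_axioms iid]]) auto
    have G: "?G \<in> borel_measurable (?P ?A)"
      using pred_ladder[of n "\<lambda>x. x" "?P ?A" k] measurable_ladder_weight[of n "\<lambda>x. x" "?P ?A" z]
      by (measurable; simp)
    have H: "?H \<in> borel_measurable (?P ?B)"
      using pred_ladder[of "n' - n" "\<lambda>x i. x (i + n)" "?P ?B" 1]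
      by (measurable; simp)
    have "indep_var borel (?G \<circ> (\<lambda>\<omega>. restrict (\<lambda>i. X i \<omega>) ?A)) borel (?H \<circ> (\<lambda>\<omega>. restrict (\<lambda>i. X i \<omega>) ?B))"
      by (rule indep_var_compose[OF ind G H])
    moreover have "?G \<circ> (\<lambda>\<omega>. restrict (\<lambda>i. X i \<omega>) ?A) = ?g n"
    proof
      fix \<omega>
      have "ladder (restrict (\<lambda>i. X i \<omega>) ?A) k n = ladder (\<lambda>i. X i \<omega>) k n"
        by (rule ladder_cong) auto
      moreover have "ladder_weight z (restrict (\<lambda>i. X i \<omega>) ?A) n = ladder_weight z (\<lambda>i. X i \<omega>) n"
        by (rule ladder_weight_cong) auto
      ultimately show "(?G \<circ> (\<lambda>\<omega>. restrict (\<lambda>i. X i \<omega>) ?A)) \<omega> = ?g n \<omega>"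
        by simp
    qed
    moreover have "?H \<circ> (\<lambda>\<omega>. restrict (\<lambda>i. X i \<omega>) ?B) = ?h n"
    proof
      fix \<omega>
      have "ladder (\<lambda>i. restrict (\<lambda>i. X i \<omega>) ?B (i + n)) 1 (n' - n) = ladder (\<lambda>i. X (i + n) \<omega>) 1 (n' - n)"
        by (rule ladder_cong) auto
      then show "(?H \<circ> (\<lambda>\<omega>. restrict (\<lambda>i. X i \<omega>) ?B)) \<omega> = ?h n \<omega>"
        by (simp only: o_def)
    qed
    ultimately have ind': "indep_var borel (?g n) borel (?h n)" by (simp only:)
    show ?thesis
      using indep_var_lebesgue_integral[OF ind' ig ih] indep_var_integrable[OF ind' ig ih] by simp
  qed
  have eh: "expectation (?h n) = z k ^ (n' - n) * ladder_prob X 1 (n' - n)" for n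
  proof -
    have "\<P>(\<omega> in M. ladder (\<lambda>i. X (i + n) \<omega>) 1 (n' - n)) =
        expectation (\<lambda>\<omega>. of_bool (ladder (\<lambda>i. X (i + n) \<omega>) 1 (n' - n)))"
      by (rule measure_Collect_eq_integral)
    then show ?thesis
      using prob_ladder_reindex[OF iid, of "\<lambda>i. i + n" "n' - n" 1] by auto
  qed
  have "weighted_ladder_prob X z (Suc k) n' = expectation (\<lambda>\<omega>. \<Sum>n<n'. ?g n \<omega> * ?h n \<omega>)"
    unfolding weighted_ladder_prob_def by (rule Bochner_Integration.integral_cong) (auto simp only:
        ladder_Suc_decomp)
  also have "\<dots> = (\<Sum>n<n'. expectation (?g n) * expectation (?h n))"
    using split by (subst Bochner_Integration.integral_sum) auto
  finally show ?thesis by (simp only: eh weighted_ladder_prob_def)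
qed

lemma sum_of_bool_ladder_le: "(\<Sum>n<N. of_bool (ladder x k n)) \<le> (1::real)"
proof (cases "\<exists>n<N. ladder x k n")
  case True
  then obtain n where n: "n < N" "ladder x k n" by blast
  have "(\<Sum>n<N. of_bool (ladder x k n)) = (\<Sum>m\<in>{n}. of_bool (ladder x k m) :: real)"
    by (rule sum.mono_neutral_right) (use n in \<open>auto dest: ladder_unique[OF n(2)]\<close>)
  also have "\<dots> \<le> 1" by (simp del: sum_of_bool_eq)
  finally show ?thesis .
next
  case False
  then show ?thesis by (simp add: sum.neutral)
qed

lemma ladder_prob_sum_le:
  assumes iid: "iid_sequence M X"
  shows "(\<Sum>n<N. ladder_prob X k n) \<le> 1"
proof -
  have m: "Measurable.pred M (\<lambda>\<omega>. ladder (\<lambda>i. X i \<omega>) k n)" for n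
    by (rule pred_ladder) (auto intro: iid_measurable[OF prob_space_axioms iid])
  have i: "integrable M (\<lambda>\<omega>. of_bool (ladder (\<lambda>i. X i \<omega>) k n) :: real)" for n
    using m by (intro integrable_bounded[where B=1]) auto
  have "(\<Sum>n<N. ladder_prob X k n) = expectation (\<lambda>\<omega>. \<Sum>n<N. of_bool (ladder (\<lambda>i. X i \<omega>) k n))"
    by (subst Bochner_Integration.integral_sum) (use i expectation_ladder in auto)
  also have "\<dots> \<le> expectation (\<lambda>_. 1)"
    by (intro integral_mono sum_of_bool_ladder_le Bochner_Integration.integrable_sum i) auto
  finally show ?thesis by (simp add: prob_space)
qed

lemma ladder_prob_summable: "iid_sequence M X \<Longrightarrow> summable (ladder_prob X k)"
  using ladder_prob_sum_le[of X k] by (intro bounded_imp_summable[of _ 1]) (auto simp: ladder_prob_nonneg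
      lessThan_Suc_atMost[symmetric] simp del: sum.lessThan_Suc)

section \<open>Generating functions of the ladder epochs\<close>

definition ladder_gf :: "(nat \<Rightarrow> 'a \<Rightarrow> real) \<Rightarrow> real \<Rightarrow> real" where
  "ladder_gf X z = (\<Sum>n. z ^ n * ladder_prob X 1 n)"

lemma ladder_gf_summable:
  assumes iid: "iid_sequence M X" and "0 \<le> z" "z \<le> 1"
  shows "summable (\<lambda>n. z ^ n * ladder_prob X 1 n)"
proof (rule summable_comparison_test'[OF ladder_prob_summable[OF iid, of 1]])
  show "norm (z ^ n * ladder_prob X 1 n) \<le> ladder_prob X 1 n" for n
    using assms power_le_one[of z n] ladder_prob_nonneg[of X 1 n] by (simp add: mult_left_le_one_le)
qed

lemma ladder_prob_1_0: "ladder_prob X 1 0 = 0"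
  by (simp add: ladder_prob_def ladder_at_0)

lemma weighted_ladder_prob_0: "weighted_ladder_prob X z 0 n = of_bool (n = 0)"
  by (cases "n = 0") (simp_all add: weighted_ladder_prob_def ladder_0 prob_space)

lemma weighted_ladder_prob_nonneg:
  assumes z: "\<And>j. 0 \<le> z j" "\<And>j. z j \<le> 1"
  shows "0 \<le> weighted_ladder_prob X z k n"
  unfolding weighted_ladder_prob_def using ladder_weight_bounds[of z, OF z] by (intro
      Bochner_Integration.integral_nonneg) simp

text \<open>The convolution in \<open>weighted_ladder_prob_Suc\<close> becomes a product of
  generating functions, in which the block after record j contributes the argument z j.\<close>

lemma weighted_ladder_prob_sums:
  assumes iid: "iid_sequence M X" and z: "\<And>j. 0 \<le> z j" "\<And>j. z j \<le> 1"
  shows "weighted_ladder_prob X z k sums (\<Prod>j<k. ladder_gf X (z j))"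
proof (induction k)
  case 0
  show ?case using sums_If_finite_set[of "{0::nat}" "\<lambda>_. 1::real"] by (simp add: weighted_ladder_prob_0
      of_bool_def)
next
  case (Suc k)
  let ?b = "\<lambda>n. z k ^ n * ladder_prob X 1 n"
  have "(\<lambda>n. \<Sum>i\<le>n. weighted_ladder_prob X z k i * ?b (n - i)) sums (suminf (weighted_ladder_prob X z k) *
      suminf ?b)"
    by (rule Cauchy_product_sums)
      (use Suc weighted_ladder_prob_nonneg[of z, OF z] ladder_prob_nonneg z ladder_gf_summable[OF iid z] in
          \<open>auto dest: sums_summable\<close>)
  \<comment> \<open>The Cauchy product includes i = n, the renewal sum does not; the extra term has
    the factor \<open>ladder_prob X 1 0\<close>, which is 0.\<close>
  moreover have "(\<Sum>i\<le>n. weighted_ladder_prob X z k i * ?b (n - i)) = weighted_ladder_prob X z (Suc k) n" for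
      n
    by (simp add: weighted_ladder_prob_Suc[OF iid z] atMost_Suc lessThan_Suc_atMost[symmetric]
        ladder_prob_1_0[unfolded One_nat_def])
  ultimately show ?case using Suc by (simp add: sums_iff ladder_gf_def)
qed


text \<open>Expectation of \<open>ladder_cyclic\<close> for the periodic continuation of the first n
  steps. Rotations preserve the law, so all n shifts contribute the same ladder
  probabilities.\<close>

lemma ladder_prob_cyclic:
  assumes iid: "iid_sequence M X" and n: "n \<ge> 1"
  shows "real n * (\<Sum>r=1..n. ladder_prob X r n / real r) = \<P>(\<omega> in M. partial_sum (\<lambda>i. X i \<omega>) n \<ge> 0)"
proof -
  note rv = iid_measurable[OF prob_space_axioms iid]
  \<comment> \<open>Rotation of the index set {1..n}; subtracting and adding 1 keeps the indices
    1-based.\<close>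
  define f where "f \<nu> i = (i + \<nu> - 1) mod n + 1" for \<nu> i :: nat
  have f1: "f \<nu> i \<ge> 1" for \<nu> i by (simp add: f_def)
  have inj: "inj_on (f \<nu>) {1..n}" for \<nu>
  proof (rule inj_onI)
    fix i j assume ij: "i \<in> {1..n}" "j \<in> {1..n}" "f \<nu> i = f \<nu> j"
    have *: "i' = j'" if "i' \<in> {1..n}" "j' \<in> {1..n}" "f \<nu> i' = f \<nu> j'" "i' \<le> j'" for i' j'
    proof -
      have "(j' + \<nu> - 1) mod n = (i' + \<nu> - 1) mod n" using that by (simp add: f_def)
      then have "n dvd (j' + \<nu> - 1) - (i' + \<nu> - 1)"
        using that by (metis mod_eq_dvd_iff_nat diff_le_mono add_le_mono1)
      moreover have "(j' + \<nu> - 1) - (i' + \<nu> - 1) < n" using that by auto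
      ultimately show ?thesis using that by (auto dest: dvd_imp_le)
    qed
    show "i = j" using *[of i j] *[of j i] ij by (cases "i \<le> j") auto
  qed
  define x where "x \<omega> i = X (f 0 i) \<omega>" for \<omega> i
  have xs: "x \<omega> (i + \<nu>) = X (f \<nu> i) \<omega>" for \<omega> i \<nu>
    by (simp add: x_def f_def)
  have per: "x \<omega> (i + n) = x \<omega> i" if "i \<ge> 1" for \<omega> i
  proof -
    have "(i + n - 1) mod n = (i - 1 + n) mod n" using that by simp
    also have "\<dots> = (i - 1) mod n" by simp
    finally show ?thesis by (simp add: x_def f_def)
  qed
  have meas: "Measurable.pred M (\<lambda>\<omega>. ladder (\<lambda>i. x \<omega> (i + \<nu>)) r n)" for \<nu> r
    unfolding xs using rv f1 by (intro pred_ladder) auto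
  have int: "integrable M (\<lambda>\<omega>. of_bool (ladder (\<lambda>i. x \<omega> (i + \<nu>)) r n) :: real)" for \<nu> r
    using meas by (intro integrable_bounded[where B=1]) auto
  have e: "expectation (\<lambda>\<omega>. of_bool (ladder (\<lambda>i. x \<omega> (i + \<nu>)) r n)) = ladder_prob X r n" for \<nu> r
  proof -
    have "expectation (\<lambda>\<omega>. of_bool (ladder (\<lambda>i. x \<omega> (i + \<nu>)) r n)) =
        \<P>(\<omega> in M. ladder (\<lambda>i. x \<omega> (i + \<nu>)) r n)"
      by (rule measure_Collect_eq_integral[symmetric])
    also have "\<dots> = ladder_prob X r n"
      unfolding xs by (rule prob_ladder_reindex[OF iid inj]) (use f1 in auto)
    finally show ?thesis .
  qed
  have "\<P>(\<omega> in M. partial_sum (\<lambda>i. X i \<omega>) n \<ge> 0) = \<P>(\<omega> in M. partial_sum (x \<omega>) n \<ge> 0)"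
  proof -
    have "partial_sum (x \<omega>) n = partial_sum (\<lambda>i. X i \<omega>) n" for \<omega>
      by (rule partial_sum_cong) (auto simp: x_def f_def Suc_le_eq)
    then show ?thesis by (simp only:)
  qed
  also have "\<dots> = expectation (\<lambda>\<omega>. of_bool (partial_sum (x \<omega>) n \<ge> 0))"
    by (rule measure_Collect_eq_integral)
  also have "\<dots> = expectation (\<lambda>\<omega>. \<Sum>\<nu><n. \<Sum>r=1..n. of_bool (ladder (\<lambda>i. x \<omega> (i + \<nu>)) r n) / real r)"
    by (intro Bochner_Integration.integral_cong refl ladder_cyclic[symmetric] n per)
  also have "\<dots> = (\<Sum>\<nu><n. \<Sum>r=1..n. ladder_prob X r n / real r)"
    by (simp add: Bochner_Integration.integral_sum int e del: sum_of_bool_eq)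
  finally show ?thesis by simp
qed

lemma ladder_prob_gt: "k > n \<Longrightarrow> ladder_prob X k n = 0"
proof -
  assume "k > n"
  have "record_count x n \<le> n" for x
    unfolding record_count_def by (rule order_trans[OF card_mono[of "{1..n}"]]) auto
  then have "\<not> ladder x k n" for x using \<open>k > n\<close> by (metis ladder_def leD)
  then show ?thesis by (simp add: ladder_prob_def)
qed

lemma ladder_prob_gen_sums:
  assumes iid: "iid_sequence M X" and z: "0 \<le> z" "z \<le> 1"
  shows "(\<lambda>n. ladder_prob X k n * z ^ n) sums (ladder_gf X z ^ k)"
proof -
  have "weighted_ladder_prob X (\<lambda>_. z) k = (\<lambda>n. ladder_prob X k n * z ^ n)"
    by (rule ext) (simp add: weighted_ladder_prob_def ladder_weight_const expectation_ladder)
  then show ?thesis using weighted_ladder_prob_sums[OF iid, of "\<lambda>_. z" k] z by simp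
qed

lemma ladder_gf_nonneg: 
  assumes iid: "iid_sequence M X" and z: "0 \<le> z" "z \<le> 1"
  shows "0 \<le> ladder_gf X z"
  unfolding ladder_gf_def using ladder_prob_nonneg z by (intro suminf_nonneg ladder_gf_summable[OF iid])
      auto

text \<open>The first record after index 0 comes at some n \<ge> 1, and its law has mass at most 1.
  For z < 1 this keeps 1 - \<open>ladder_gf X z\<close> positive, so that its logarithm may be
  taken.\<close>

lemma ladder_gf_le:
  assumes iid: "iid_sequence M X" and z: "0 \<le> z" "z \<le> 1"
  shows "ladder_gf X z \<le> z"
proof -
  have "ladder_gf X z \<le> (\<Sum>n. z * ladder_prob X 1 n)"
    unfolding ladder_gf_def
  proof (rule suminf_le)
    show "z ^ n * ladder_prob X 1 n \<le> z * ladder_prob X 1 n" for n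
      using ladder_prob_1_0[of X] ladder_prob_nonneg[of X 1 n] z power_decreasing[of 1 n z]
      by (cases n) (auto intro!: mult_right_mono)
  qed (use ladder_gf_summable[OF iid z] ladder_prob_summable[OF iid] in \<open>auto intro: summable_mult\<close>)
  also have "\<dots> = z * (\<Sum>n. ladder_prob X 1 n)" by (rule suminf_mult) (rule ladder_prob_summable[OF iid])
  also have "\<dots> \<le> z * 1"
    using z ladder_prob_sum_le[OF iid] by (intro mult_left_mono suminf_le_const ladder_prob_summable[OF
        iid]) auto
  finally show ?thesis by simp
qed

lemma ladder_gf_mono:
  assumes iid: "iid_sequence M X" and z: "0 \<le> z" "z \<le> w" "w \<le> 1"
  shows "ladder_gf X z \<le> ladder_gf X w"
  unfolding ladder_gf_def using z ladder_prob_nonneg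
  by (intro suminf_le ladder_gf_summable[OF iid] mult_right_mono power_mono) auto

end

section \<open>Sparre Andersen's identity and the recurrence of records\<close>

lemma suminf_swap_nonneg:
  fixes f :: "nat \<Rightarrow> nat \<Rightarrow> real"
  assumes nn: "\<And>i j. 0 \<le> f i j" and r: "\<And>i. f i sums g i" and g: "g sums s"
    and c: "\<And>j. (\<lambda>i. f i j) sums h j"
  shows "h sums s"
proof -
  have lim: "0 \<le> x" if "b sums x" "\<And>i. 0 \<le> b i" for b :: "nat \<Rightarrow> real" and x
    using suminf_nonneg[of b] that by (simp add: sums_iff)
  have gn: "0 \<le> g i" for i by (rule lim[OF r nn])
  have hn: "0 \<le> h i" for i by (rule lim[OF c nn])
  have sn: "0 \<le> s" by (rule lim[OF g gn])
  \<comment> \<open>Tonelli's theorem for a double series, one sum being read as an integral against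
    counting measure.\<close>
  have "(\<Sum>j. ennreal (h j)) = (\<Sum>j. \<Sum>i. ennreal (f i j))"
    by (intro suminf_cong suminf_ennreal_eq[symmetric] c nn)
  also have "\<dots> = (\<integral>\<^sup>+j. (\<Sum>i. ennreal (f i j)) \<partial>count_space UNIV)"
    by (rule nn_integral_count_space_nat[symmetric])
  also have "\<dots> = (\<Sum>i. \<integral>\<^sup>+j. ennreal (f i j) \<partial>count_space UNIV)"
    by (rule nn_integral_suminf) simp
  also have "\<dots> = (\<Sum>i. ennreal (g i))"
    unfolding nn_integral_count_space_nat by (intro suminf_cong suminf_ennreal_eq r nn)
  also have "\<dots> = ennreal s"
    by (intro suminf_ennreal_eq g gn)
  finally have *: "(\<Sum>j. ennreal (h j)) = ennreal s" .
  then have "summable h" using hn by (intro summable_suminf_not_top) auto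
  then have "ennreal (suminf h) = ennreal s" using * suminf_ennreal2[of h, OF hn] by simp
  moreover have "0 \<le> suminf h" by (rule suminf_nonneg[OF \<open>summable h\<close> hn])
  ultimately have "suminf h = s" using sn by simp
  then show ?thesis using \<open>summable h\<close> by (simp add: sums_iff)
qed

context prob_space
begin

definition nonneg_prob :: "(nat \<Rightarrow> 'a \<Rightarrow> real) \<Rightarrow> nat \<Rightarrow> real" where
  "nonneg_prob X n = \<P>(\<omega> in M. partial_sum (\<lambda>i. X i \<omega>) n \<ge> 0)"

text \<open>Expand - ln (1 - f) into the terms f ^ r / r, where f ^ r generates the index of record
  r. Exchanging the sums leaves for each n the sum over r of P(record r at n) / r, which the cyclic
  lemma evaluates.\<close>

theorem sparre_andersen:
  assumes iid: "iid_sequence M X" and z: "0 \<le> z" "z < 1"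
  shows "(\<lambda>n. z ^ n * nonneg_prob X n / real n) sums (- ln (1 - ladder_gf X z))"
proof (rule suminf_swap_nonneg)
  let ?f = "\<lambda>r n. ladder_prob X r n * z ^ n / real r"
  have f: "0 \<le> ladder_gf X z" "ladder_gf X z < 1"
    using ladder_gf_nonneg[OF iid, of z] ladder_gf_le[OF iid, of z] z by auto
  show "0 \<le> ?f i j" for i j using ladder_prob_nonneg z by simp
  show "?f r sums (ladder_gf X z ^ r / real r)" for r
    using sums_divide[OF ladder_prob_gen_sums[OF iid, of z r]] z by simp
  show "(\<lambda>r. ladder_gf X z ^ r / real r) sums (- ln (1 - ladder_gf X z))"
    using sums_minus[OF ln_series'[of "- ladder_gf X z"]] f by simp
  \<comment> \<open>Division by 0 yields 0, so the terms with n = 0 or r = 0 drop out of all the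
    series.\<close>
  show "(\<lambda>r. ?f r n) sums (z ^ n * nonneg_prob X n / real n)" for n
  proof (cases "n = 0")
    case True
    have "?f r n = 0" for r
      using ladder_prob_gt[of n r X] True by (cases "r = 0") auto
    then show ?thesis using True by (simp only: sums_zero) simp
  next
    case False
    have "(\<lambda>r. ?f r n) sums (\<Sum>r=1..n. ?f r n)"
    proof (rule sums_finite)
      show "?f r n = 0" if "r \<notin> {1..n}" for r
        using ladder_prob_gt[of n r X] that by (cases "r = 0") auto
    qed simp
    also have "(\<Sum>r=1..n. ?f r n) = z ^ n * (\<Sum>r=1..n. ladder_prob X r n / real r)"
      by (simp add: sum_distrib_left mult.commute)
    also have "\<dots> = z ^ n * nonneg_prob X n / real n"
      using ladder_prob_cyclic[OF iid, of n] False by (simp add: nonneg_prob_def field_simps)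
    finally show ?thesis .
  qed
qed

text \<open>Records never stop: otherwise - ln (1 - f) would stay bounded up to z = 1, and by Sparre
  Andersen the series of P(S_n \<ge> 0) / n would converge, although its terms are eventually above
  \<rho> / (2 n).\<close>

lemma ladder_gf_1:
  assumes iid: "iid_sequence M X" and lim: "nonneg_prob X \<longlonglongrightarrow> \<rho>" and \<rho>: "\<rho> > 0"
  shows "ladder_gf X 1 = 1"
proof (rule ccontr)
  assume "ladder_gf X 1 \<noteq> 1"
  then have lt: "ladder_gf X 1 < 1" using ladder_gf_le[OF iid, of 1] by simp
  define K where "K = - ln (1 - ladder_gf X 1)"
  have part: "(\<Sum>n<N. z ^ n * (nonneg_prob X n / real n)) \<le> K" if z: "0 \<le> z" "z < 1" for z N
  proof -
    have S: "(\<lambda>n. z ^ n * (nonneg_prob X n / real n)) sums (- ln (1 - ladder_gf X z))"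
      using sparre_andersen[OF iid z] by simp
    have "(\<Sum>n<N. z ^ n * (nonneg_prob X n / real n)) \<le> - ln (1 - ladder_gf X z)"
      unfolding sums_unique[OF S]
      by (rule sum_le_suminf) (use S z in \<open>auto simp: sums_iff nonneg_prob_def\<close>)
    also have "\<dots> \<le> K"
      using ladder_gf_mono[OF iid z(1), of 1] z lt by (simp add: K_def)
    finally show ?thesis .
  qed
  \<comment> \<open>The bound survives the limit z to 1 because each partial sum is continuous in
    z.\<close>
  have part1: "(\<Sum>n<N. nonneg_prob X n / real n) \<le> K" for N
  proof (rule tendsto_upperbound)
    show "((\<lambda>z. \<Sum>n<N. z ^ n * (nonneg_prob X n / real n)) \<longlongrightarrow> (\<Sum>n<N. nonneg_prob X n / real n)) (at_left 1)"
      by (rule tendsto_eq_intros | simp)+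
    show "\<forall>\<^sub>F z in at_left 1. (\<Sum>n<N. z ^ n * (nonneg_prob X n / real n)) \<le> K"
      using eventually_at_left_real[of 0 "1::real"] part by (auto elim!: eventually_mono)
  qed simp
  have "summable (\<lambda>n. nonneg_prob X n / real n)"
    using part1 by (intro bounded_imp_summable[of _ K]) (auto simp: nonneg_prob_def
        lessThan_Suc_atMost[symmetric] simp del: sum.lessThan_Suc)
  moreover obtain N where N: "\<And>n. n \<ge> N \<Longrightarrow> nonneg_prob X n > \<rho> / 2"
    using order_tendstoD(1)[OF lim, of "\<rho> / 2"] \<rho> by (auto simp: eventually_sequentially)
  ultimately have "summable (\<lambda>n. \<rho> / 2 * (1 / real n))"
  proof (rule_tac summable_comparison_test')
    fix n assume "N \<le> n"
    then show "norm (\<rho> / 2 * (1 / real n)) \<le> nonneg_prob X n / real n"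
      using N[of n] \<rho> by (auto simp: divide_simps)
  qed
  then have "summable (\<lambda>n. 1 / real n)" using \<rho> by (subst (asm) summable_cmult_iff) auto
  then have "summable (\<lambda>n. inverse (real n))" by (simp add: inverse_eq_divide)
  then show False using not_summable_harmonic[where 'a=real] by (simp add: inverse_eq_divide)
qed

text \<open>By \<open>ladder_gf_1\<close> the law of the index of record k has mass 1 ^ k =
  1.\<close>

lemma AE_ladder:
  assumes iid: "iid_sequence M X" and lim: "nonneg_prob X \<longlonglongrightarrow> \<rho>" and \<rho>: "\<rho> > 0"
  shows "AE \<omega> in M. \<forall>k. \<exists>n. ladder (\<lambda>i. X i \<omega>) k n"
  unfolding AE_all_countable
proof
  fix k
  let ?A = "\<lambda>n. {\<omega>\<in>space M. ladder (\<lambda>i. X i \<omega>) k n}"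
  have m: "?A n \<in> sets M" for n
  proof -
    have "Measurable.pred M (\<lambda>\<omega>. ladder (\<lambda>i. X i \<omega>) k n)"
      by (rule pred_ladder) (auto intro: iid_measurable[OF prob_space_axioms iid])
    then show ?thesis by simp
  qed
  have "ladder_prob X k sums 1"
    using ladder_prob_gen_sums[OF iid, of 1 k] by (simp add: ladder_gf_1[OF assms])
  moreover have "(\<lambda>n. prob (?A n)) = ladder_prob X k" by (rule ext) (simp add: ladder_prob_def)
  ultimately have "(\<lambda>n. prob (?A n)) sums 1" by simp
  moreover have "(\<lambda>n. prob (?A n)) sums prob (\<Union>n. ?A n)"
  proof (rule finite_measure_UNION)
    show "range ?A \<subseteq> events" using m by blast
    show "disjoint_family ?A" unfolding disjoint_family_on_def using ladder_unique by blast
  qed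
  ultimately have "prob (\<Union>n. ?A n) = 1" by (rule sums_unique2[symmetric])
  then have "AE \<omega> in M. \<omega> \<in> (\<Union>n. ?A n)"
    using m by (intro AE_prob_1)
  then show "AE \<omega> in M. \<exists>n. ladder (\<lambda>i. X i \<omega>) k n" by (rule AE_mp) auto
qed

end

section \<open>Ladder epochs and the counting process in continuous time\<close>

definition ladder_epoch :: "(nat \<Rightarrow> real) \<Rightarrow> nat \<Rightarrow> nat" where
  "ladder_epoch x k = (LEAST n. ladder x k n)"

lemma ladder_ladder_epoch: "\<exists>n. ladder x k n \<Longrightarrow> ladder x k (ladder_epoch x k)"
  unfolding ladder_epoch_def by (rule LeastI_ex)

lemma ladder_epoch_eq: "ladder x k n \<Longrightarrow> ladder_epoch x k = n"
  using ladder_unique[of x k "ladder_epoch x k" n] ladder_ladder_epoch[of x k] by blast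

lemma ladder_epoch_0 [simp]: "ladder_epoch x 0 = 0"
  by (rule ladder_epoch_eq) (simp add: ladder_0)

text \<open>Duality of epochs and counts; the same inversion later turns record times into record
  numbers.\<close>

lemma ladder_epoch_le_iff:
  assumes "\<exists>n. ladder x k n"
  shows "ladder_epoch x k \<le> N \<longleftrightarrow> k \<le> record_count x N"
  using ladder_ladder_epoch[OF assms] record_count_mono[of "ladder_epoch x k" N x] record_count_less[of N
      "ladder_epoch x k" x]
  unfolding ladder_def by (metis leD leI)

lemma ladder_epoch_less:
  assumes "\<And>k. \<exists>n. ladder x k n"
  shows "ladder_epoch x k < ladder_epoch x (Suc k)"
proof -
  obtain n where n: "n < ladder_epoch x (Suc k)" "ladder x k n"
    using ladder_SucE[OF ladder_ladder_epoch[OF assms]] by blast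
  then show ?thesis using ladder_epoch_eq[OF n(2)] by simp
qed

text \<open>Step m is made after \<open>record_count x (m - 1)\<close> records, so a weight
  depending on that count is constant between consecutive epochs.\<close>

lemma sum_over_blocks:
  assumes ex: "\<And>k. \<exists>n. ladder x k n"
  shows "(\<Sum>m=1..ladder_epoch x K. a (record_count x (m - 1)) * y m) =
     (\<Sum>j<K. a j * (partial_sum y (ladder_epoch x (Suc j)) - partial_sum y (ladder_epoch x j)))"
proof (induction K)
  case (Suc K)
  let ?s = "ladder_epoch x K" and ?t = "ladder_epoch x (Suc K)"
  have lt: "?s < ?t" by (rule ladder_epoch_less[OF ex])
  have n: "record_count x (m - 1) = K" if "m \<in> {?s+1..?t}" for m
  proof -
    have "?s \<le> m - 1" "m - 1 < ?t" using that by auto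
    then show ?thesis
      using record_count_mono[of ?s "m - 1" x] record_count_less[of "m - 1" ?t x]
        ladder_ladder_epoch[OF ex, of K] ladder_ladder_epoch[OF ex, of "Suc K"] unfolding ladder_def by
            linarith
  qed
  have split: "(\<Sum>m=1..?t. f m) = (\<Sum>m=1..?s. f m) + (\<Sum>m=?s+1..?t. f m)" for f :: "nat \<Rightarrow> real"
    using lt sum.ub_add_nat[of 1 ?s f "?t - ?s"] by simp
  have "(\<Sum>m=?s+1..?t. a (record_count x (m - 1)) * y m) = (\<Sum>m=?s+1..?t. a K * y m)"
    by (rule sum.cong) (use n in auto)
  also have "\<dots> = a K * (partial_sum y ?t - partial_sum y ?s)"
    using split[of y] by (simp add: partial_sum_def sum_distrib_left)
  finally show ?case using Suc split[of "\<lambda>m. a (record_count x (m - 1)) * y m"] by simp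
qed simp

lemma weak_record_iff: "weak_record X n \<omega> \<longleftrightarrow> record_at (\<lambda>i. X i \<omega>) n"
proof -
  have "weak_record X n \<omega> \<longleftrightarrow>
      partial_sum (\<lambda>i. X i \<omega>) n = Max ((\<lambda>k. partial_sum (\<lambda>i. X i \<omega>) k) ` {0..n})"
    by (simp add: weak_record_def walk_def partial_sum_def)
  also have "\<dots> \<longleftrightarrow> record_at (\<lambda>i. X i \<omega>) n"
  proof
    assume *: "partial_sum (\<lambda>i. X i \<omega>) n = Max ((\<lambda>k. partial_sum (\<lambda>i. X i \<omega>) k) ` {0..n})"
    show "record_at (\<lambda>i. X i \<omega>) n"
      unfolding record_at_def by (subst *) (auto intro!: Max_ge)
  next
    assume "record_at (\<lambda>i. X i \<omega>) n"
    then show "partial_sum (\<lambda>i. X i \<omega>) n = Max ((\<lambda>k. partial_sum (\<lambda>i. X i \<omega>) k) ` {0..n})"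
      by (intro Max_eqI[symmetric]) (auto simp: record_at_def)
  qed
  finally show ?thesis .
qed

lemma partial_sum_strict:
  assumes "\<And>i. i \<ge> 1 \<Longrightarrow> y i > 0" and "m < n"
  shows "partial_sum y m < partial_sum y n"
  using \<open>m < n\<close>
proof (induction n rule: less_Suc_induct)
  case (1 i)
  then show ?case using assms(1)[of "Suc i"] by simp
qed auto

lemma partial_sum_mono:
  assumes "\<And>i. i \<ge> 1 \<Longrightarrow> y i > 0" and "m \<le> n"
  shows "partial_sum y m \<le> partial_sum y n"
  using partial_sum_strict[of y m n] assms by (cases "m = n") (auto intro: less_imp_le)

lemma le_renewal_count_iff:
  assumes pos: "\<And>i. i \<ge> 1 \<Longrightarrow> Y i \<omega> > 0" and unb: "\<And>c. \<exists>n. partial_sum (\<lambda>i. Y i \<omega>) n > c"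
    and t: "t \<ge> 0"
  shows "n \<le> renewal_count Y t \<omega> \<longleftrightarrow> partial_sum (\<lambda>i. Y i \<omega>) n \<le> t"
proof -
  let ?y = "\<lambda>i. Y i \<omega>"
  let ?A = "{k. partial_sum ?y k \<le> t}"
  have N: "renewal_count Y t \<omega> = Max ?A"
    by (simp add: renewal_count_def partial_sum_def)
  obtain m where m: "partial_sum ?y m > t" using unb by blast
  have "?A \<subseteq> {..m}"
  proof
    fix k assume k: "k \<in> ?A"
    show "k \<in> {..m}"
    proof (rule ccontr)
      assume "k \<notin> {..m}"
      then have "partial_sum ?y m \<le> partial_sum ?y k" by (intro partial_sum_mono pos) auto
      then show False using m k by simp
    qed
  qed
  then have fin: "finite ?A" by (rule finite_subset) simp
  have "0 \<in> ?A" using t by simp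
  then have "Max ?A \<in> ?A" using Max_in[OF fin] by blast
  then have "partial_sum ?y n \<le> t" if "n \<le> Max ?A"
    using partial_sum_mono[of ?y n "Max ?A", OF pos that] by simp
  moreover have "n \<le> Max ?A" if "partial_sum ?y n \<le> t"
    using fin that by (intro Max_ge) auto
  ultimately show ?thesis unfolding N by blast
qed

text \<open>\<open>Suc\<close> accounts for the record at index 0. By time t exactly the steps n
  whose waiting times up to n add up to at most t have been made, so it only matters whether the
  epoch of record k is among them.\<close>

lemma Suc_le_ctrw_records_iff:
  assumes pos: "\<And>i. i \<ge> 1 \<Longrightarrow> Y i \<omega> > 0" and unb: "\<And>c. \<exists>n. partial_sum (\<lambda>i. Y i \<omega>) n > c"
    and ladder: "\<And>k. \<exists>n. ladder (\<lambda>i. X i \<omega>) k n" and t: "t \<ge> 0"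
  shows "Suc k \<le> ctrw_records X Y t \<omega> \<longleftrightarrow> partial_sum (\<lambda>i. Y i \<omega>) (ladder_epoch (\<lambda>i. X i \<omega>) k) \<le> t"
proof -
  let ?x = "\<lambda>i. X i \<omega>" and ?N = "renewal_count Y t \<omega>"
  have "{n \<in> {0..?N}. weak_record X n \<omega>} = insert 0 {n\<in>{1..?N}. record_at ?x n}"
    by (auto simp: weak_record_iff Suc_le_eq)
  then have "ctrw_records X Y t \<omega> = Suc (record_count ?x ?N)"
    by (simp add: ctrw_records_def record_count_def)
  then show ?thesis
    using ladder_epoch_le_iff[OF ladder, of k ?N] le_renewal_count_iff[of Y \<omega> t "ladder_epoch ?x k", OF pos
        unb t] by simp
qed

section \<open>Laplace transforms of the record times\<close>

context prob_space
begin

text \<open>Waiting times are positive only almost surely; the absolute value makes the integrand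
  bounded everywhere.\<close>

definition wait_laplace :: "(nat \<Rightarrow> 'a \<Rightarrow> real) \<Rightarrow> real \<Rightarrow> real" where
  "wait_laplace Y s = expectation (\<lambda>\<omega>. exp (- s * \<bar>Y 1 \<omega>\<bar>))"

lemma wait_laplace_bounds: 
  assumes "iid_sequence M Y" "s \<ge> 0"
  shows "0 \<le> wait_laplace Y s" "wait_laplace Y s \<le> 1"
proof -
  note [measurable] = iid_measurable[OF prob_space_axioms assms(1), of 1, simplified]
  have "expectation (\<lambda>\<omega>. exp (- s * \<bar>Y 1 \<omega>\<bar>)) \<le> expectation (\<lambda>_. 1)"
    using assms(2) by (intro integral_mono integrable_bounded[where B=1]) auto
  then show "wait_laplace Y s \<le> 1" by (simp add: wait_laplace_def prob_space)
  show "0 \<le> wait_laplace Y s" unfolding wait_laplace_def by (rule Bochner_Integration.integral_nonneg) simp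
qed

lemma expectation_exp_weighted:
  assumes iid: "iid_sequence M Y" and c: "\<And>m. c m \<ge> 0"
  shows "expectation (\<lambda>\<omega>. exp (- (\<Sum>m=1..n. c m * \<bar>Y m \<omega>\<bar>))) = (\<Prod>m=1..n. wait_laplace Y (c m))"
proof -
  note rv = iid_measurable[OF prob_space_axioms iid]
  have "indep_vars (\<lambda>_. borel) Y {1..n}"
    by (rule indep_vars_subset[OF iid_indep[OF prob_space_axioms iid]]) auto
  then have ind: "indep_vars (\<lambda>_. borel) (\<lambda>m \<omega>. exp (- c m * \<bar>Y m \<omega>\<bar>)) {1..n}"
    by (rule indep_vars_compose2) auto
  have int: "integrable M (\<lambda>\<omega>. exp (- c m * \<bar>Y m \<omega>\<bar>))" if "m \<in> {1..n}" for m
    using c[of m] rv[of m] that by (intro integrable_bounded[where B=1]) auto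
  have "expectation (\<lambda>\<omega>. exp (- (\<Sum>m=1..n. c m * \<bar>Y m \<omega>\<bar>))) =
      expectation (\<lambda>\<omega>. \<Prod>m=1..n. exp (- c m * \<bar>Y m \<omega>\<bar>))"
    by (simp add: exp_sum[symmetric] sum_negf)
  also have "\<dots> = (\<Prod>m=1..n. expectation (\<lambda>\<omega>. exp (- c m * \<bar>Y m \<omega>\<bar>)))"
    by (rule indep_vars_lebesgue_integral[OF _ ind int]) auto
  also have "\<dots> = (\<Prod>m=1..n. wait_laplace Y (c m))"
  proof (rule prod.cong)
    fix m assume "m \<in> {1..n}"
    then have m: "m \<ge> 1" by simp
    have "expectation (\<lambda>\<omega>. exp (- c m * \<bar>Y m \<omega>\<bar>)) = (\<integral>y. exp (- c m * \<bar>y\<bar>) \<partial>distr M borel (Y m))"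
      using rv[OF m] by (subst integral_distr) auto
    also have "\<dots> = (\<integral>y. exp (- c m * \<bar>y\<bar>) \<partial>distr M borel (Y 1))"
      by (simp only: iid_distr[OF iid m])
    also have "\<dots> = wait_laplace Y (c m)"
      unfolding wait_laplace_def using rv[of 1] by (subst integral_distr) auto
    finally show "expectation (\<lambda>\<omega>. exp (- c m * \<bar>Y m \<omega>\<bar>)) = wait_laplace Y (c m)" .
  qed simp
  finally show ?thesis .
qed

text \<open>Integrate over the waiting times first, the walk being fixed: independence turns every
  waiting time into its Laplace transform, and these factors are the step weights of
  \<open>ladder_weight\<close>.\<close>

lemma expectation_ladder_exp:
  assumes iidX: "iid_sequence M X" and iidY: "iid_sequence M Y" and ind: "independent_sequences M X Y"
    and a: "\<And>j. a j \<ge> 0"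
  shows "expectation (\<lambda>\<omega>. of_bool (ladder (\<lambda>i. X i \<omega>) k n) *
            exp (- (\<Sum>m=1..n. a (record_count (\<lambda>i. X i \<omega>) (m - 1)) * \<bar>Y m \<omega>\<bar>))) =
         weighted_ladder_prob X (\<lambda>j. wait_laplace Y (a j)) k n"
proof -
  let ?P = "PiM {1..} (\<lambda>_. borel) :: (nat \<Rightarrow> real) measure"
  let ?X = "\<lambda>\<omega>. \<lambda>i\<in>{1..}. X i \<omega>" and ?Y = "\<lambda>\<omega>. \<lambda>i\<in>{1..}. Y i \<omega>"
  let ?F = "\<lambda>x y. of_bool (ladder x k n) * exp (- (\<Sum>m=1..n. a (record_count x (m - 1)) * \<bar>y m\<bar>)) :: real"
  have rvX: "?X \<in> measurable M ?P" and rvY: "?Y \<in> measurable M ?P"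
    and D: "distr M ?P ?X \<Otimes>\<^sub>M distr M ?P ?Y = distr M (?P \<Otimes>\<^sub>M ?P) (\<lambda>\<omega>. (?X \<omega>, ?Y \<omega>))"
    using ind unfolding independent_sequences_def indep_var_distribution_eq by auto
  interpret PX: prob_space "distr M ?P ?X" by (rule prob_space_distr[OF rvX])
  interpret PY: prob_space "distr M ?P ?Y" by (rule prob_space_distr[OF rvY])
  interpret PXY: pair_prob_space "distr M ?P ?X" "distr M ?P ?Y" ..
  have F[measurable]: "case_prod ?F \<in> borel_measurable (?P \<Otimes>\<^sub>M ?P)"
  proof -
    have c: "(\<lambda>p. fst p i) \<in> borel_measurable (?P \<Otimes>\<^sub>M ?P)" "(\<lambda>p. snd p i) \<in> borel_measurable (?P \<Otimes>\<^sub>M ?P)"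
      if "i \<ge> 1" for i
      using that by (auto intro!: measurable_compose[OF measurable_fst] measurable_compose[OF
          measurable_snd]
        measurable_component_singleton)
    have [measurable]: "Measurable.pred (?P \<Otimes>\<^sub>M ?P) (\<lambda>p. ladder (fst p) k n)"
      by (rule pred_ladder) (use c in auto)
    have "(\<lambda>p. \<Sum>m=1..n. a (record_count (fst p) (m - 1)) * \<bar>snd p m\<bar>) \<in> borel_measurable (?P \<Otimes>\<^sub>M ?P)"
    proof (rule borel_measurable_sum)
      fix m assume m: "m \<in> {1..n}"
      have [measurable]: "(\<lambda>p. record_count (fst p) (m - 1)) \<in> measurable (?P \<Otimes>\<^sub>M ?P) (count_space UNIV)"
        by (rule measurable_record_count) (use c in auto)
      have [measurable]: "(\<lambda>p. snd p m) \<in> borel_measurable (?P \<Otimes>\<^sub>M ?P)" using c m by auto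
      show "(\<lambda>p. a (record_count (fst p) (m - 1)) * \<bar>snd p m\<bar>) \<in> borel_measurable (?P \<Otimes>\<^sub>M ?P)" by measurable
    qed
    then have "(\<lambda>p. ?F (fst p) (snd p)) \<in> borel_measurable (?P \<Otimes>\<^sub>M ?P)" by measurable
    then show ?thesis by (simp add: case_prod_beta')
  qed
  have bd: "\<bar>?F x y\<bar> \<le> 1" for x y
    using a by (auto simp: of_bool_def intro!: sum_nonneg)
  have F': "case_prod ?F \<in> borel_measurable (distr M ?P ?X \<Otimes>\<^sub>M distr M ?P ?Y)"
    using F by simp
  have int: "integrable (distr M ?P ?X \<Otimes>\<^sub>M distr M ?P ?Y) (case_prod ?F)"
    using bd by (intro PXY.P.integrable_const_bound[where B=1] F') auto
  \<comment> \<open>Restriction to {1..} changes only index 0, which none of the functionals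
    reads.\<close>
  have congF: "?F (?X \<omega>) (?Y \<omega>') = ?F (\<lambda>i. X i \<omega>) (\<lambda>i. Y i \<omega>')" for \<omega> \<omega>'
  proof -
    have "ladder (?X \<omega>) k n = ladder (\<lambda>i. X i \<omega>) k n" by (rule ladder_cong) auto
    moreover have "record_count (?X \<omega>) m = record_count (\<lambda>i. X i \<omega>) m" for m by (rule record_count_cong)
        auto
    moreover have "(\<Sum>m=1..n. c m * \<bar>?Y \<omega>' m\<bar>) = (\<Sum>m=1..n. c m * \<bar>Y m \<omega>'\<bar>)" for c
      by (rule sum.cong) auto
    ultimately show ?thesis by simp
  qed
  have "expectation (\<lambda>\<omega>. ?F (\<lambda>i. X i \<omega>) (\<lambda>i. Y i \<omega>)) = expectation (\<lambda>\<omega>. case_prod ?F (?X \<omega>, ?Y \<omega>))"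
    unfolding prod.case congF ..
  also have "\<dots> = integral\<^sup>L (distr M (?P \<Otimes>\<^sub>M ?P) (\<lambda>\<omega>. (?X \<omega>, ?Y \<omega>))) (case_prod ?F)"
    by (rule integral_distr[symmetric]) (use rvX rvY F in measurable)
  also have "\<dots> = integral\<^sup>L (distr M ?P ?X \<Otimes>\<^sub>M distr M ?P ?Y) (case_prod ?F)"
    by (simp only: D)
  also have "\<dots> = (\<integral>x. \<integral>y. ?F x y \<partial>distr M ?P ?Y \<partial>distr M ?P ?X)"
    using PXY.integral_fst'[OF int] by simp
  also have "\<dots> = (\<integral>x. of_bool (ladder x k n) * ladder_weight (\<lambda>j. wait_laplace Y (a j)) x n \<partial>distr M ?P ?X)"
  proof (rule Bochner_Integration.integral_cong)
    fix x assume x: "x \<in> space (distr M ?P ?X)"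
    have Fx: "?F x \<in> borel_measurable ?P"
      using measurable_Pair2[OF F, of x] x by simp
    have "(\<integral>y. ?F x y \<partial>distr M ?P ?Y) = expectation (\<lambda>\<omega>. ?F x (?Y \<omega>))"
      by (rule integral_distr[OF rvY Fx])
    also have "\<dots> = expectation (\<lambda>\<omega>. of_bool (ladder x k n) *
        exp (- (\<Sum>m=1..n. a (record_count x (m - 1)) * \<bar>Y m \<omega>\<bar>)))"
      by (intro Bochner_Integration.integral_cong refl arg_cong2[where f="(*)"]
        arg_cong[where f=exp] arg_cong[where f=uminus] sum.cong) auto
    also have "\<dots> = of_bool (ladder x k n) * ladder_weight (\<lambda>j. wait_laplace Y (a j)) x n"
      using expectation_exp_weighted[OF iidY, of "\<lambda>m. a (record_count x (m - 1))" n] a by (simp add: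
          ladder_weight_def)
    finally show "(\<integral>y. ?F x y \<partial>distr M ?P ?Y) = of_bool (ladder x k n) * ladder_weight (\<lambda>j. wait_laplace Y
        (a j)) x n" .
  qed simp
  also have "\<dots> = expectation (\<lambda>\<omega>. of_bool (ladder (?X \<omega>) k n) * ladder_weight (\<lambda>j. wait_laplace Y (a j)) (?X
      \<omega>) n)"
  proof (rule integral_distr[OF rvX])
    have c: "(\<lambda>p. p i) \<in> borel_measurable ?P" if "i \<ge> 1" for i
      using that by (intro measurable_component_singleton) auto
    show "(\<lambda>x. of_bool (ladder x k n) * ladder_weight (\<lambda>j. wait_laplace Y (a j)) x n) \<in> borel_measurable ?P"
      using pred_ladder[of n "\<lambda>x. x" ?P k] measurable_ladder_weight[of n "\<lambda>x. x" ?P "\<lambda>j. wait_laplace Y (a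
          j)"] c
      by measurable
  qed
  also have "\<dots> = weighted_ladder_prob X (\<lambda>j. wait_laplace Y (a j)) k n"
  proof -
    have "ladder (?X \<omega>) k n = ladder (\<lambda>i. X i \<omega>) k n" for \<omega> by (rule ladder_cong) auto
    moreover have "ladder_weight z (?X \<omega>) n = ladder_weight z (\<lambda>i. X i \<omega>) n" for z \<omega> by (rule
        ladder_weight_cong) auto
    ultimately show ?thesis unfolding weighted_ladder_prob_def by (simp only:)
  qed
  finally show ?thesis .
qed

text \<open>Absolute values as in \<open>wait_laplace\<close>, so that the Laplace transforms match
  exactly; almost surely they change nothing.\<close>

definition record_time :: "(nat \<Rightarrow> 'a \<Rightarrow> real) \<Rightarrow> (nat \<Rightarrow> 'a \<Rightarrow> real) \<Rightarrow> nat \<Rightarrow> 'a \<Rightarrow> real" where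
  "record_time X Y k \<omega> = partial_sum (\<lambda>i. \<bar>Y i \<omega>\<bar>) (ladder_epoch (\<lambda>i. X i \<omega>) k)"

lemma record_time_measurable:
  assumes iidX: "iid_sequence M X" and iidY: "iid_sequence M Y"
  shows "record_time X Y k \<in> borel_measurable M"
proof -
  have [measurable]: "Measurable.pred M (\<lambda>\<omega>. ladder (\<lambda>i. X i \<omega>) k n)" for n
    by (rule pred_ladder) (auto intro: iid_measurable[OF prob_space_axioms iidX])
  have [measurable]: "(\<lambda>\<omega>. partial_sum (\<lambda>i. \<bar>Y i \<omega>\<bar>) n) \<in> borel_measurable M" for n
    by (intro measurable_partial_sum borel_measurable_abs iid_measurable[OF prob_space_axioms iidY])
  \<comment> \<open>The index of record k is unique if it exists, so \<open>LEAST\<close> is merely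
    a measurable way to name it.\<close>
  show ?thesis unfolding record_time_def ladder_epoch_def by measurable
qed

text \<open>The durations between records are i.i.d., expressed by the product form of their joint
  Laplace transform. Splitting according to the index n of record K makes
  \<open>expectation_ladder_exp\<close> applicable.\<close>

theorem expectation_exp_blocks:
  assumes iidX: "iid_sequence M X" and iidY: "iid_sequence M Y" and ind: "independent_sequences M X Y"
    and ladder: "AE \<omega> in M. \<forall>k. \<exists>n. ladder (\<lambda>i. X i \<omega>) k n"
    and a: "\<And>j. a j \<ge> 0"
  shows "expectation (\<lambda>\<omega>. exp (- (\<Sum>j<K. a j * (record_time X Y (Suc j) \<omega> - record_time X Y j \<omega>)))) =
     (\<Prod>j<K. ladder_gf X (wait_laplace Y (a j)))"
proof -
  let ?F = "\<lambda>n \<omega>. of_bool (ladder (\<lambda>i. X i \<omega>) K n) *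
     exp (- (\<Sum>m=1..n. a (record_count (\<lambda>i. X i \<omega>) (m - 1)) * \<bar>Y m \<omega>\<bar>)) :: real"
  have F: "?F n \<in> borel_measurable M" for n
  proof -
    have [measurable]: "Measurable.pred M (\<lambda>\<omega>. ladder (\<lambda>i. X i \<omega>) K n)"
      by (rule pred_ladder) (auto intro: iid_measurable[OF prob_space_axioms iidX])
    have [measurable]: "(\<lambda>\<omega>. \<Sum>m=1..n. a (record_count (\<lambda>i. X i \<omega>) (m - 1)) * \<bar>Y m \<omega>\<bar>) \<in> borel_measurable M"
    proof (rule borel_measurable_sum)
      fix m assume m: "m \<in> {1..n}"
      have [measurable]: "(\<lambda>\<omega>. record_count (\<lambda>i. X i \<omega>) (m - 1)) \<in> measurable M (count_space UNIV)"
        by (rule measurable_record_count) (auto intro: iid_measurable[OF prob_space_axioms iidX])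
      have [measurable]: "Y m \<in> borel_measurable M" using iid_measurable[OF prob_space_axioms iidY] m by
          auto
      show "(\<lambda>\<omega>. a (record_count (\<lambda>i. X i \<omega>) (m - 1)) * \<bar>Y m \<omega>\<bar>) \<in> borel_measurable M" by measurable
    qed
    show ?thesis by measurable
  qed
  have nn: "0 \<le> ?F n \<omega>" for n \<omega> by simp
  have bd: "\<bar>?F n \<omega>\<bar> \<le> 1" for n \<omega>
    using a by (auto simp: of_bool_def intro!: sum_nonneg)
  have int: "integrable M (?F n)" for n using bd by (rule integrable_bounded[OF F])
  \<comment> \<open>Only n equal to the K-th ladder epoch contributes, and there
    \<open>sum_over_blocks\<close> rewrites the exponent.\<close>
  have S: "(\<lambda>n. ?F n \<omega>) sums exp (- (\<Sum>j<K. a j * (record_time X Y (Suc j) \<omega> - record_time X Y j \<omega>)))"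
    if "\<forall>k. \<exists>n. ladder (\<lambda>i. X i \<omega>) k n" for \<omega>
  proof -
    let ?t = "ladder_epoch (\<lambda>i. X i \<omega>) K"
    have "(\<lambda>n. ?F n \<omega>) sums (\<Sum>n\<in>{?t}. ?F n \<omega>)"
      by (rule sums_finite) (auto dest: ladder_epoch_eq)
    moreover have "?F ?t \<omega> = exp (- (\<Sum>j<K. a j * (record_time X Y (Suc j) \<omega> - record_time X Y j \<omega>)))"
      using ladder_ladder_epoch[of "\<lambda>i. X i \<omega>" K] that
        sum_over_blocks[of "\<lambda>i. X i \<omega>" a "\<lambda>m. \<bar>Y m \<omega>\<bar>" K]
      unfolding record_time_def by (simp add: of_bool_def)
    moreover have "sum f {m} = f m" for f :: "nat \<Rightarrow> real" and m by simp
    ultimately show ?thesis by (simp only:)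
  qed
  have ae: "AE \<omega> in M. (\<lambda>n. ?F n \<omega>) sums exp (- (\<Sum>j<K. a j * (record_time X Y (Suc j) \<omega> - record_time X Y j
      \<omega>)))"
    using ladder by eventually_elim (rule S)
  have wqs: "(\<lambda>n. expectation (?F n)) sums (\<Prod>j<K. ladder_gf X (wait_laplace Y (a j)))"
  proof -
    have "(\<lambda>n. expectation (?F n)) = weighted_ladder_prob X (\<lambda>j. wait_laplace Y (a j)) K"
      by (rule ext) (rule expectation_ladder_exp[OF iidX iidY ind a])
    then show ?thesis
      using weighted_ladder_prob_sums[OF iidX, of "\<lambda>j. wait_laplace Y (a j)" K] wait_laplace_bounds[OF iidY
          a] by (simp only:)
  qed
  have "expectation (\<lambda>\<omega>. exp (- (\<Sum>j<K. a j * (record_time X Y (Suc j) \<omega> - record_time X Y j \<omega>)))) =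
      expectation (\<lambda>\<omega>. \<Sum>n. ?F n \<omega>)"
  proof (rule integral_cong_AE)
    show "(\<lambda>\<omega>. exp (- (\<Sum>j<K. a j * (record_time X Y (Suc j) \<omega> - record_time X Y j \<omega>)))) \<in> borel_measurable
        M"
      using record_time_measurable[OF iidX iidY] by measurable
    show "(\<lambda>\<omega>. \<Sum>n. ?F n \<omega>) \<in> borel_measurable M" using F by (rule borel_measurable_suminf)
    show "AE \<omega> in M. exp (- (\<Sum>j<K. a j * (record_time X Y (Suc j) \<omega> - record_time X Y j \<omega>))) = (\<Sum>n. ?F n \<omega>)"
      using ae by (rule AE_mp) (auto simp: sums_iff)
  qed
  also have "\<dots> = (\<Sum>n. expectation (?F n))"
  proof (rule integral_suminf[OF int])
    show "AE \<omega> in M. summable (\<lambda>n. norm (?F n \<omega>))"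
      using ae by (rule AE_mp) (auto simp: sums_iff)
    show "summable (\<lambda>n. expectation (\<lambda>\<omega>. norm (?F n \<omega>)))"
      using wqs by (simp add: sums_iff)
  qed
  also have "\<dots> = (\<Prod>j<K. ladder_gf X (wait_laplace Y (a j)))" using wqs by (simp add: sums_iff)
  finally show ?thesis .
qed

end

section \<open>Regular variation\<close>

context prob_space
begin

text \<open>Tonelli applied to 1 - exp (- s v) = integral of exp (- u) over 0 \<le> u < s v. In this
  form s enters only through the tail at u / s, ready for a ratio limit.\<close>

lemma laplace_tail_integral:
  fixes V :: "'a \<Rightarrow> real"
  assumes V[measurable]: "V \<in> borel_measurable M" and V0: "\<And>\<omega>. V \<omega> \<ge> 0" and s: "s > 0"
  shows "integrable lborel (\<lambda>u. indicator {0..} u * (exp (- u) * \<P>(\<omega> in M. V \<omega> > u / s)))" (is "integrable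
      lborel ?f")
    and "1 - expectation (\<lambda>\<omega>. exp (- s * V \<omega>)) =
      (\<integral>u. indicator {0..} u * (exp (- u) * \<P>(\<omega> in M. V \<omega> > u / s)) \<partial>lborel)"
proof -
  have int: "integrable M (\<lambda>\<omega>. exp (- s * V \<omega>))"
    using s V0 by (intro integrable_bounded[where B=1]) auto
  have E: "1 - expectation (\<lambda>\<omega>. exp (- s * V \<omega>)) = expectation (\<lambda>\<omega>. 1 - exp (- s * V \<omega>))"
    using int by (simp add: prob_space)
  have le: "exp (- s * V \<omega>) \<le> 1" for \<omega> using s V0[of \<omega>] by simp
  have inner: "(\<integral>\<^sup>+u. ennreal (exp (- u)) * indicator {0..s * v} u \<partial>lborel) = ennreal (1 - exp (- s * v))"
    if "v \<ge> 0" for v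
  proof -
    have "((\<lambda>u. - exp (- u)) has_real_derivative exp (- x)) (at x)" for x :: real
      by (auto intro!: derivative_eq_intros)
    then have "(\<integral>\<^sup>+u. ennreal (exp (- u)) * indicator {0..s * v} u \<partial>lborel) =
        ennreal (- exp (- (s * v)) - (- exp (- 0)))"
      using s that by (intro nn_integral_FTC_Icc) auto
    then show ?thesis by simp
  qed
  \<comment> \<open>The strict inequality matches the tail event \<open>V \<omega> > u / s\<close>;
    it differs from the closed interval at the one point u = s v.\<close>
  have inner': "(\<integral>\<^sup>+u. ennreal (exp (- u)) * indicator {u. 0 \<le> u \<and> u / s < v} u \<partial>lborel) = ennreal (1 - exp
      (- s * v))"
    if "v \<ge> 0" for v
    unfolding inner[OF that, symmetric]
  proof (rule nn_integral_cong_AE)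
    show "AE u in lborel. ennreal (exp (- u)) * indicator {u. 0 \<le> u \<and> u / s < v} u =
        ennreal (exp (- u)) * indicator {0..s * v} u"
      using AE_lborel_singleton[of "s * v"]
    proof eventually_elim
      case (elim u)
      then have "u / s < v \<longleftrightarrow> u \<le> s * v" using s by (auto simp: field_simps)
      then show ?case by (auto simp: indicator_def)
    qed
  qed
  have "ennreal (expectation (\<lambda>\<omega>. 1 - exp (- s * V \<omega>))) = (\<integral>\<^sup>+\<omega>. ennreal (1 - exp (- s * V \<omega>)) \<partial>M)"
    using int le by (intro nn_integral_eq_integral[symmetric]) auto
  also have "\<dots> = (\<integral>\<^sup>+\<omega>. (\<integral>\<^sup>+u. ennreal (exp (- u)) * indicator {u. 0 \<le> u \<and> u / s < V \<omega>} u \<partial>lborel) \<partial>M)"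
    by (simp only: inner'[OF V0])
  also have "\<dots> = (\<integral>\<^sup>+u. (\<integral>\<^sup>+\<omega>. ennreal (exp (- u)) * indicator {u. 0 \<le> u \<and> u / s < V \<omega>} u \<partial>M) \<partial>lborel)"
  proof (rule pair_sigma_finite.Fubini')
    show "pair_sigma_finite lborel M" by (intro pair_sigma_finite.intro) unfold_locales
    show "(\<lambda>(u, \<omega>). ennreal (exp (- u)) * indicator {u. 0 \<le> u \<and> u / s < V \<omega>} u) \<in> borel_measurable (lborel
        \<Otimes>\<^sub>M M)"
      unfolding indicator_def by measurable
  qed
  also have "\<dots> = (\<integral>\<^sup>+u. ennreal (?f u) \<partial>lborel)"
  proof (rule nn_integral_cong)
    fix u :: real
    have "(\<integral>\<^sup>+\<omega>. ennreal (exp (- u)) * indicator {u. 0 \<le> u \<and> u / s < V \<omega>} u \<partial>M) =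
       (\<integral>\<^sup>+\<omega>. (ennreal (exp (- u)) * indicator {0..} u) * indicator {\<omega>\<in>space M. V \<omega> > u / s} \<omega> \<partial>M)"
      by (rule nn_integral_cong) (auto simp: indicator_def)
    also have "\<dots> = (ennreal (exp (- u)) * indicator {0..} u) * emeasure M {\<omega>\<in>space M. V \<omega> > u / s}"
      by (rule nn_integral_cmult_indicator) measurable
    also have "\<dots> = ennreal (?f u)"
      by (auto simp: emeasure_eq_measure ennreal_mult indicator_def)
    finally show "(\<integral>\<^sup>+\<omega>. ennreal (exp (- u)) * indicator {u. 0 \<le> u \<and> u / s < V \<omega>} u \<partial>M) = ennreal (?f u)" .
  qed
  finally have *: "(\<integral>\<^sup>+u. ennreal (?f u) \<partial>lborel) = ennreal (expectation (\<lambda>\<omega>. 1 - exp (- s * V \<omega>)))" ..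
  have m: "?f \<in> borel_measurable lborel"
  proof -
    \<comment> \<open>Measurability of the tail comes from monotonicity; the sign turns a decreasing
      function into an increasing one.\<close>
    have "mono (\<lambda>u. - measure M {\<omega>\<in>space M. u / s < V \<omega>})"
    proof (rule monoI)
      fix u v :: real assume "u \<le> v"
      then have "u / s \<le> v / s" using s by (simp add: divide_right_mono)
      then show "- measure M {\<omega>\<in>space M. u / s < V \<omega>} \<le> - measure M {\<omega>\<in>space M. v / s < V \<omega>}"
        by (auto intro!: finite_measure_mono)
    qed
    then have "(\<lambda>u. - (- measure M {\<omega>\<in>space M. u / s < V \<omega>})) \<in> borel_measurable borel"
      by (intro borel_measurable_uminus borel_measurable_mono)
    then have [measurable]: "(\<lambda>u. measure M {\<omega>\<in>space M. u / s < V \<omega>}) \<in> borel_measurable borel"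
      by simp
    show ?thesis by measurable
  qed
  have nn: "0 \<le> expectation (\<lambda>\<omega>. 1 - exp (- s * V \<omega>))"
    using le by (intro Bochner_Integration.integral_nonneg) auto
  have "integrable lborel ?f \<and> integral\<^sup>L lborel ?f = expectation (\<lambda>\<omega>. 1 - exp (- s * V \<omega>))"
    using * m nn by (subst (asm) nn_integral_eq_integrable) (auto simp: indicator_def)
  then show "integrable lborel ?f"
    and "1 - expectation (\<lambda>\<omega>. exp (- s * V \<omega>)) = integral\<^sup>L lborel ?f"
    using E by auto
qed

end

text \<open>Far out H (2 x) > q * H x with q > 1/2, so x * H x grows at least by the factor 2 q > 1
  at each doubling. Applied to tails of index \<alpha> < 1, it expresses that the mean is
  infinite.\<close>

lemma doubling_unbounded:
  fixes H :: "real \<Rightarrow> real"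
  assumes mono: "\<And>x y. x \<le> y \<Longrightarrow> H y \<le> H x"
    and ratio: "((\<lambda>x. H (2 * x) / H x) \<longlongrightarrow> r) at_top" and r: "r > 1/2"
    and pos: "\<forall>\<^sub>F x in at_top. H x > 0"
  shows "filterlim (\<lambda>x. x * H x) at_top at_top"
proof -
  obtain q where q: "1/2 < q" "q < r" using dense[OF r] by blast
  have "\<forall>\<^sub>F x in at_top. H (2 * x) / H x > q \<and> H x > 0 \<and> x > 0"
    using order_tendstoD(1)[OF ratio q(2)] pos eventually_gt_at_top[of 0]
    by eventually_elim auto
  then obtain A where A: "\<And>x. x \<ge> A \<Longrightarrow> H (2 * x) / H x > q \<and> H x > 0 \<and> x > 0"
    unfolding eventually_at_top_linorder by blast
  have A0: "A > 0" using A[of A] by simp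
  define g where "g x = x * H x" for x
  \<comment> \<open>A lower bound for x * H x on [A, 2 A] by monotonicity of H; repeated halving
    carries it to all x \<ge> A.\<close>
  define b where "b = A * H (2 * A)"
  have b: "b > 0" using A[of "2 * A"] A0 by (simp add: b_def)
  have dbl: "g x \<ge> (2 * q) * g (x / 2)" if "x / 2 \<ge> A" for x
  proof -
    have "q < H x / H (x / 2)" "0 < H (x / 2)" using A[OF that] by auto
    then have "H x \<ge> q * H (x / 2)" by (simp add: pos_less_divide_eq)
    then show ?thesis using A[OF that] by (simp add: g_def)
  qed
  have low: "x \<ge> A \<Longrightarrow> x \<le> 2 ^ n * (2 * A) \<Longrightarrow> g x \<ge> b" for n x
  proof (induction n arbitrary: x)
    case 0
    then show ?case
      using mono[of x "2 * A"] A[of "2 * A"] A0 unfolding g_def b_def by (intro mult_mono) auto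
  next
    case (Suc n)
    show ?case
    proof (cases "x / 2 \<ge> A")
      case True
      then have *: "g (x / 2) \<ge> b" using Suc by (intro Suc.IH) auto
      then have "1 * g (x / 2) \<le> (2 * q) * g (x / 2)" using q b by (intro mult_right_mono) auto
      then show ?thesis using dbl[OF True] * by linarith
    next
      case False
      then show ?thesis using Suc.prems by (intro Suc.IH) (auto intro: order_trans[of _ "2 * A"] simp: A0)
    qed
  qed
  have low': "g x \<ge> b" if "x \<ge> A" for x
  proof -
    obtain n where "x / (2 * A) < 2 ^ n" using real_arch_pow[of 2] by auto
    then show ?thesis using low[OF that, of n] A0 by (simp add: field_simps)
  qed
  have grow: "x \<ge> 2 ^ k * A \<Longrightarrow> g x \<ge> (2 * q) ^ k * b" for k x
  proof (induction k arbitrary: x)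
    case 0
    then show ?case using low' by simp
  next
    case (Suc k)
    have x2: "x / 2 \<ge> 2 ^ k * A" using Suc.prems by simp
    moreover have "2 ^ k * A \<ge> 1 * A" using A0 by (intro mult_right_mono) auto
    ultimately have "g x \<ge> (2 * q) * g (x / 2)" by (intro dbl) simp
    moreover have "(2 * q) * g (x / 2) \<ge> (2 * q) * ((2 * q) ^ k * b)"
      using Suc.IH[OF x2] q by (intro mult_left_mono) auto
    ultimately show ?case by (simp add: mult.assoc)
  qed
  show ?thesis
    unfolding filterlim_at_top
  proof
    fix Z :: real
    obtain k where "Z / b < (2 * q) ^ k" using real_arch_pow[of "2 * q"] q by auto
    then have "Z \<le> (2 * q) ^ k * b" using b by (simp add: field_simps)
    then have "Z \<le> g x" if "x \<ge> 2 ^ k * A" for x using grow[OF that] by linarith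
    then show "\<forall>\<^sub>F x in at_top. Z \<le> x * H x"
      unfolding eventually_at_top_linorder g_def by blast
  qed
qed

context prob_space
begin

context
  fixes V :: "'a \<Rightarrow> real" and \<alpha> :: real and H I :: "real \<Rightarrow> real"
  assumes V[measurable]: "V \<in> borel_measurable M" and V0: "\<And>\<omega>. V \<omega> \<ge> 0"
  defines "H \<equiv> \<lambda>x. \<P>(\<omega> in M. V \<omega> > x)"
  defines "I \<equiv> \<lambda>s. 1 - expectation (\<lambda>\<omega>. exp (- s * V \<omega>))"
  assumes ratio: "\<And>c. c > 0 \<Longrightarrow> ((\<lambda>x. H (c * x) / H x) \<longlongrightarrow> c powr (- \<alpha>)) at_top"
    and pos: "\<forall>\<^sub>F x in at_top. H x > 0" and \<alpha>: "0 < \<alpha>" "\<alpha> < 1"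
begin

text \<open>On V > 1 / s the integrand 1 - exp (- s V) is at least 1 - exp (-1).\<close>

lemma laplace_defect_lower: 
  assumes s: "s > 0"
  shows "(1 - exp (-1)) * H (1 / s) \<le> I s"
proof -
  have int: "integrable M (\<lambda>\<omega>. exp (- s * V \<omega>))"
    using s V0 by (intro integrable_bounded[where B=1]) auto
  have "(1 - exp (-1)) * H (1 / s) = expectation (\<lambda>\<omega>. (1 - exp (-1)) * indicator {\<omega>\<in>space M. V \<omega> > 1 / s}
      \<omega>)"
  proof -
    have "{\<omega>\<in>space M. V \<omega> > 1 / s} \<inter> space M = {\<omega>\<in>space M. V \<omega> > 1 / s}" by auto
    then show ?thesis by (simp add: H_def)
  qed
  also have "\<dots> \<le> expectation (\<lambda>\<omega>. 1 - exp (- s * V \<omega>))"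
  proof (rule integral_mono)
    show "(1 - exp (-1)) * indicator {\<omega>\<in>space M. V \<omega> > 1 / s} \<omega> \<le> 1 - exp (- s * V \<omega>)" for \<omega>
    proof (cases "V \<omega> > 1 / s")
      case True
      then have "s * V \<omega> \<ge> 1" using s by (simp add: field_simps)
      then show ?thesis by (simp add: indicator_def)
    next
      case False
      then show ?thesis using s V0[of \<omega>] by (simp add: indicator_def)
    qed
  next
    have "{\<omega>\<in>space M. V \<omega> > 1 / s} \<in> sets M" by measurable
    then show "integrable M (\<lambda>\<omega>. (1 - exp (-1)) * indicator {\<omega>\<in>space M. V \<omega> > 1 / s} \<omega> :: real)"
      by (intro integrable_mult_right integrable_real_indicator) (auto simp: less_top[symmetric])
  qed (use int in auto)
  also have "\<dots> = I s" using int by (simp add: I_def prob_space)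
  finally show ?thesis .
qed

text \<open>\<open>laplace_defect_lower\<close> bounds s / I s by a constant over x * H x with x = 1
  / s, and 2 powr (- \<alpha>) > 1/2 lets \<open>doubling_unbounded\<close> apply. Errors of order s
  are therefore negligible against the defect.\<close>

lemma argument_over_laplace_defect: "((\<lambda>s. s / I s) \<longlongrightarrow> 0) (at_right 0)"
proof -
  have "(2::real) powr (- 1) = 1/2" by (simp add: powr_minus_divide)
  moreover have "2 powr (- 1) < (2::real) powr (- \<alpha>)" using \<alpha> by (intro powr_less_mono) auto
  ultimately have r: "1/2 < (2::real) powr (- \<alpha>)" by linarith
  have "filterlim (\<lambda>x. x * H x) at_top at_top"
    by (rule doubling_unbounded[OF _ ratio r pos]) (auto simp: H_def intro!: finite_measure_mono)
  then have "((\<lambda>x. 1 / (1 - exp (-1)) * inverse (x * H x)) \<longlongrightarrow> 1 / (1 - exp (-1)) * 0) at_top"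
    by (intro tendsto_mult tendsto_const tendsto_inverse_0_at_top)
  then have "((\<lambda>s. 1 / (1 - exp (-1)) * inverse (inverse s * H (inverse s))) \<longlongrightarrow> 0) (at_right 0)"
    using filterlim_compose[OF _ filterlim_inverse_at_top_right] by fastforce
  moreover have "\<forall>\<^sub>F s in at_right 0. norm (s / I s) \<le> 1 / (1 - exp (-1)) * inverse (inverse s * H (inverse
      s))"
  proof -
    have "\<forall>\<^sub>F s in at_right 0. H (inverse s) > 0"
      using pos filterlim_inverse_at_top_right unfolding filterlim_iff by blast
    then show ?thesis using eventually_at_right_less
    proof eventually_elim
      case (elim s)
      have e: "1 - exp (-1) > (0::real)" by simp
      have "0 < (1 - exp (-1)) * H (1 / s)" using elim e by (simp add: inverse_eq_divide)
      then have "s / I s \<le> s / ((1 - exp (-1)) * H (1 / s))" and "0 < I s"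
        using laplace_defect_lower[of s] elim by (auto intro!: divide_left_mono mult_pos_pos)
      then show ?case using elim by (simp add: divide_inverse)
    qed
  qed
  ultimately show ?thesis by (rule Lim_null_comparison[rotated])
qed

lemma laplace_defect_pos: "\<forall>\<^sub>F s in at_right 0. I s > 0"
proof -
  have "\<forall>\<^sub>F s in at_right 0. H (inverse s) > 0"
    using pos filterlim_inverse_at_top_right unfolding filterlim_iff by blast
  then show ?thesis using eventually_at_right_less
  proof eventually_elim
    case (elim s)
    have e: "1 - exp (-1) > (0::real)" by simp
    have "0 < (1 - exp (-1)) * H (1 / s)" using elim e by (simp add: inverse_eq_divide)
    then show ?case using laplace_defect_lower[of s] elim by linarith
  qed
qed

text \<open>In \<open>I s = \<integral> exp (- u) * H (u / s) du\<close> the range \<open>u < A * s\<close> contributes at most \<open>A * s\<close>,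
  which is negligible because the tail has infinite mean; on the rest \<open>H\<close> may be replaced using
  its ratio limit.\<close>

lemma laplace_defect_regularly_varying:
  assumes c: "c > 0"
  shows "((\<lambda>s. I (c * s) / I s) \<longlongrightarrow> c powr \<alpha>) (at_right 0)"
proof -
  let ?C = "c powr \<alpha>"
  have H1: "0 \<le> H x" "H x \<le> 1" for x by (auto simp: H_def)
  have bound: "\<exists>A>0. \<forall>s>0. \<bar>I (c * s) - ?C * I s\<bar> \<le> e * I s + (1 + ?C) * (A * s)" if e: "e > 0" for e
  proof -
    \<comment> \<open>Passing from s to c * s replaces the argument x = u / s of H by x / c, and (1
      / c) powr (- \<alpha>) = c powr \<alpha>.\<close>
    have "((\<lambda>x. H (1 / c * x) / H x) \<longlongrightarrow> ?C) at_top"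
      using ratio[of "1 / c"] c by (simp add: powr_divide powr_minus_divide)
    then have "\<forall>\<^sub>F x in at_top. dist (H (1 / c * x) / H x) ?C < e" using e by (rule tendstoD)
    then have "\<forall>\<^sub>F x in at_top. \<bar>H (1 / c * x) - ?C * H x\<bar> \<le> e * H x \<and> x > 0"
      using pos eventually_gt_at_top[of 0]
    proof eventually_elim
      case (elim x)
      have "H (1 / c * x) - ?C * H x = (H (1 / c * x) / H x - ?C) * H x"
        using elim by (simp add: left_diff_distrib)
      then have "\<bar>H (1 / c * x) - ?C * H x\<bar> = \<bar>H (1 / c * x) / H x - ?C\<bar> * H x"
        using elim by (simp only: abs_mult abs_of_pos)
      also have "\<dots> \<le> e * H x" using elim by (intro mult_right_mono) (auto simp: dist_real_def)
      finally show ?case using elim by simp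
    qed
    then obtain A where A: "\<And>x. x \<ge> A \<Longrightarrow> \<bar>H (1 / c * x) - ?C * H x\<bar> \<le> e * H x \<and> x > 0"
      unfolding eventually_at_top_linorder by blast
    have A0: "A > 0" using A[of A] by simp
    have "\<bar>I (c * s) - ?C * I s\<bar> \<le> e * I s + (1 + ?C) * (A * s)" if s: "s > 0" for s
    proof -
      let ?g = "\<lambda>u. indicator {0..} u * (exp (- u) * H (u / (c * s)))"
      let ?f = "\<lambda>u. indicator {0..} u * (exp (- u) * H (u / s))"
      have cs: "c * s > 0" using c s by simp
      note Ig = laplace_tail_integral[OF V V0 cs, folded H_def I_def]
      note If = laplace_tail_integral[OF V V0 s, folded H_def I_def]
      have e1: "I (c * s) - ?C * I s = (\<integral>u. ?g u - ?C * ?f u \<partial>lborel)"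
        using Ig If by (simp add: I_def H_def)
      have e2: "\<bar>\<integral>u. ?g u - ?C * ?f u \<partial>lborel\<bar> \<le> (\<integral>u. e * ?f u + (1 + ?C) * indicator {0..A * s} u \<partial>lborel)"
      proof (rule integral_abs_bound_integral)
        show "integrable lborel (\<lambda>u. ?g u - ?C * ?f u)" using Ig(1) If(1) by (simp add: H_def)
        show "integrable lborel (\<lambda>u. e * ?f u + (1 + ?C) * indicator {0..A * s} u)"
        proof (intro Bochner_Integration.integrable_add integrable_mult_right integrable_real_indicator)
          show "integrable lborel (\<lambda>u. indicator {0..} u * (exp (- u) * H (u / s)))"
            using If(1) by (simp add: H_def)
          show "emeasure lborel {0..A * s} < \<infinity>" using A0 s by (subst emeasure_lborel_Icc) auto
        qed auto
        fix u :: real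
        show "\<bar>?g u - ?C * ?f u\<bar> \<le> e * ?f u + (1 + ?C) * indicator {0..A * s} u"
        proof (cases "u \<ge> 0")
          case u: True
          have eq: "?g u - ?C * ?f u = exp (- u) * (H (1 / c * (u / s)) - ?C * H (u / s))"
            using u by (simp add: algebra_simps)
          show ?thesis
          proof (cases "u / s \<ge> A")
            case True
            then have "\<bar>?g u - ?C * ?f u\<bar> \<le> exp (- u) * (e * H (u / s))"
              unfolding eq abs_mult using A[OF True] by (intro mult_mono) auto
            moreover have "e * ?f u = exp (- u) * (e * H (u / s))" using u by simp
            moreover have "0 \<le> (1 + ?C) * indicator {0..A * s} u" by simp
            ultimately show ?thesis by linarith
          next
            case False
            then have "u \<le> A * s" using s by (simp add: field_simps)
            moreover have "\<bar>?g u - ?C * ?f u\<bar> \<le> 1 * (1 + ?C)"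
              unfolding eq abs_mult
            proof (rule mult_mono)
              have "\<bar>H (1 / c * (u / s)) - ?C * H (u / s)\<bar> \<le> \<bar>H (1 / c * (u / s))\<bar> + \<bar>?C * H (u / s)\<bar>"
                by (rule abs_triangle_ineq4)
              also have "\<dots> = H (1 / c * (u / s)) + ?C * H (u / s)"
                using H1(1) by (simp add: abs_mult)
              also have "\<dots> \<le> 1 + ?C"
                using H1(2)[of "1 / c * (u / s)"] mult_left_le[OF H1(2)[of "u / s"], of ?C]
                by (intro add_mono) auto
              finally show "\<bar>H (1 / c * (u / s)) - ?C * H (u / s)\<bar> \<le> 1 + ?C" .
            qed (use u in auto)
            moreover have "0 \<le> e * ?f u" using e H1(1)[of "u / s"] by simp
            ultimately have "\<bar>?g u - ?C * ?f u\<bar> \<le> e * ?f u + (1 + ?C) * 1" by linarith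
            moreover have "indicator {0..A * s} u = (1::real)"
              using u \<open>u \<le> A * s\<close> by simp
            ultimately show ?thesis by (simp only:)
          qed
        qed (use e A0 in \<open>auto simp: indicator_def\<close>)
      qed
      have e3: "(\<integral>u. e * ?f u + (1 + ?C) * indicator {0..A * s} u \<partial>lborel) = (\<integral>u. e * ?f u \<partial>lborel) + (\<integral>u.
          (1 + ?C) * indicator {0..A * s} u \<partial>lborel)"
      proof (rule Bochner_Integration.integral_add)
        show "integrable lborel (\<lambda>u. e * ?f u)"
          by (rule integrable_mult_right) (unfold H_def, rule If(1))
        show "integrable lborel (\<lambda>u. (1 + ?C) * indicator {0..A * s} u)"
          using A0 s by (intro integrable_mult_right integrable_real_indicator) auto
      qed
      have e4: "(\<integral>u. e * ?f u \<partial>lborel) = e * (\<integral>u. ?f u \<partial>lborel)"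
        by (rule integral_mult_right_zero)
      have e5: "(\<integral>u. (1 + ?C) * indicator {0..A * s} u \<partial>lborel) = (1 + ?C) * (\<integral>u. indicator {0..A * s} u
          \<partial>lborel)"
        by (rule integral_mult_right_zero)
      have e6: "(\<integral>u. ?f u \<partial>lborel) = I s"
        unfolding I_def H_def by (rule If(2)[symmetric])
      have e7: "(\<integral>u. indicator {0..A * s} u \<partial>lborel) = A * s"
        using A0 s by simp
      show ?thesis using e2 unfolding e1 e3 e4 e5 e6 e7 .
    qed
    then show ?thesis using A0 by blast
  qed
  show ?thesis
  proof (rule tendstoI)
    fix e :: real assume e: "e > 0"
    obtain A where A: "A > 0" "\<And>s. s > 0 \<Longrightarrow> \<bar>I (c * s) - ?C * I s\<bar> \<le> e / 2 * I s + (1 + ?C) * (A * s)"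
      using bound[of "e / 2"] e by auto
    have "((\<lambda>s. (1 + ?C) * A * (s / I s)) \<longlongrightarrow> (1 + ?C) * A * 0) (at_right 0)"
      by (intro tendsto_mult tendsto_const argument_over_laplace_defect)
    then have "\<forall>\<^sub>F s in at_right 0. (1 + ?C) * A * (s / I s) < e / 2"
      using e by (intro order_tendstoD(2)) auto
    then show "\<forall>\<^sub>F s in at_right 0. dist (I (c * s) / I s) ?C < e"
      using laplace_defect_pos eventually_at_right_less
    proof eventually_elim
      case (elim s)
      have "\<bar>I (c * s) / I s - ?C\<bar> = \<bar>I (c * s) - ?C * I s\<bar> / I s"
        using elim by (simp add: abs_div_pos diff_divide_distrib)
      also have "\<dots> \<le> (e / 2 * I s + (1 + ?C) * (A * s)) / I s"
        using A(2)[of s] elim by (intro divide_right_mono) auto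
      also have "\<dots> = e / 2 + (1 + ?C) * A * (s / I s)" using elim by (simp add: field_simps)
      also have "\<dots> < e" using elim by linarith
      finally show ?case by (simp add: dist_real_def)
    qed
  qed
qed

text \<open>Splitting at V = A bounds the defect by s * A + H A; A is chosen first, then s.\<close>

lemma laplace_defect_tendsto_0: "(I \<longlongrightarrow> 0) (at_right 0)"
proof (rule tendstoI)
  fix e :: real assume e: "e > 0"
  have int: "integrable M (\<lambda>\<omega>. exp (- s * V \<omega>))" if "s > 0" for s
    using that V0 by (intro integrable_bounded[where B=1]) auto
  interpret D: real_distribution "distr M borel V" by (rule real_distribution_distr) measurable
  have "((\<lambda>x. 1 - cdf (distr M borel V) x) \<longlongrightarrow> 1 - 1) at_top"
    by (intro tendsto_diff tendsto_const D.cdf_lim_at_top_prob)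
  moreover have "1 - cdf (distr M borel V) x = H x" for x
  proof -
    have "cdf (distr M borel V) x = prob {\<omega>\<in>space M. V \<omega> \<le> x}"
      by (subst cdf_def, subst measure_distr) (auto intro!: arg_cong[where f=prob])
    moreover have "{\<omega>\<in>space M. V \<omega> \<le> x} = space M - {\<omega>\<in>space M. V \<omega> > x}" by auto
    ultimately show ?thesis by (simp add: H_def prob_compl)
  qed
  ultimately have "(H \<longlongrightarrow> 0) at_top" by simp
  then have "\<forall>\<^sub>F x in at_top. H x < e / 2 \<and> x > 0"
    using e eventually_gt_at_top[of "0::real"] by (intro eventually_conj order_tendstoD(2)) auto
  then obtain A where A: "H A < e / 2" "A > 0" unfolding eventually_at_top_linorder by blast
  have "\<forall>\<^sub>F s in at_right 0. s < e / (2 * A) \<and> 0 < s"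
    using A e by (intro eventually_conj eventually_at_right_less eventually_at_rightI[of 0 "e / (2 * A)"])
        auto
  then show "\<forall>\<^sub>F s in at_right 0. dist (I s) 0 < e"
  proof eventually_elim
    case (elim s)
    have "{\<omega>\<in>space M. V \<omega> > A} \<in> sets M" by measurable
    then have ii: "integrable M (indicator {\<omega>\<in>space M. V \<omega> > A} :: 'a \<Rightarrow> real)"
      by (intro integrable_real_indicator) (auto simp: less_top[symmetric])
    have "I s = expectation (\<lambda>\<omega>. 1 - exp (- s * V \<omega>))" using int[of s] elim by (simp add: I_def prob_space)
    also have "\<dots> \<le> expectation (\<lambda>\<omega>. s * A + indicator {\<omega>\<in>space M. V \<omega> > A} \<omega>)"
    proof (rule integral_mono)
      fix \<omega> assume "\<omega> \<in> space M"
      show "1 - exp (- s * V \<omega>) \<le> s * A + indicator {\<omega>\<in>space M. V \<omega> > A} \<omega>"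
      proof (cases "V \<omega> > A")
        case True
        have "0 \<le> s * A" using elim A by auto
        moreover have "0 < exp (- s * V \<omega>)" by (rule exp_gt_zero)
        moreover have "indicator {\<omega>\<in>space M. V \<omega> > A} \<omega> = (1::real)"
          using True \<open>\<omega> \<in> space M\<close> by simp
        ultimately show ?thesis by linarith
      next
        case False
        have "1 - exp (- s * V \<omega>) \<le> s * V \<omega>" using exp_ge_add_one_self[of "- s * V \<omega>"] by simp
        also have "\<dots> \<le> s * A" using False elim by (intro mult_left_mono) auto
        finally show ?thesis by (simp add: indicator_def)
      qed
    qed (use int elim ii in auto)
    also have "\<dots> = s * A + H A"
    proof -
      have "{\<omega>\<in>space M. V \<omega> > A} \<inter> space M = {\<omega>\<in>space M. V \<omega> > A}" by auto
      then show ?thesis using ii by (simp add: H_def prob_space)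
    qed
    also have "\<dots> < e" using elim A by (simp add: field_simps)
    finally have "I s < e" .
    moreover have "0 \<le> I s"
    proof -
      have "0 \<le> (1 - exp (-1)) * H (1 / s)" by (simp add: H_def)
      then show ?thesis using laplace_defect_lower[of s] elim by linarith
    qed
    ultimately show ?case by simp
  qed
qed

end

end

text \<open>P is compared with \<rho> times the logarithmic series. Each diverges at 1, but the
  differences between z and w stay bounded: the numbers z ^ n - w ^ n share one sign, so their
  absolute values divided by n sum to |ln ((1 - w) / (1 - z))|. This controls the terms with p n
  close to \<rho>; the finitely many others vanish because z and w both tend to 1.\<close>

lemma log_series_transfer:
  fixes p :: "nat \<Rightarrow> real" and z w :: "'i \<Rightarrow> real"
  assumes p: "p \<longlonglongrightarrow> \<rho>" "\<And>n. \<bar>p n\<bar> \<le> 1"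
    and zw: "\<forall>\<^sub>F s in F. 0 \<le> z s \<and> z s < 1" "\<forall>\<^sub>F s in F. 0 \<le> w s \<and> w s < 1"
    and lim: "(z \<longlongrightarrow> 1) F" "(w \<longlongrightarrow> 1) F"
    and ratio: "((\<lambda>s. (1 - w s) / (1 - z s)) \<longlongrightarrow> r) F" and r: "r > 0"
    and P: "\<And>x. 0 \<le> x \<Longrightarrow> x < 1 \<Longrightarrow> (\<lambda>n. x ^ n * p n / real n) sums P x"
  shows "((\<lambda>s. P (z s) - P (w s)) \<longlongrightarrow> \<rho> * ln r) F"
proof -
  define R where "R s = ln ((1 - w s) / (1 - z s))" for s
  have R: "(R \<longlongrightarrow> ln r) F" unfolding R_def using ratio r by (intro tendsto_ln) auto
  have key: "\<bar>(P (z s) - P (w s)) - \<rho> * R s\<bar> \<le> (\<Sum>n<N. \<bar>z s ^ n - w s ^ n\<bar> * (1 + \<bar>\<rho>\<bar>)) + e * \<bar>R s\<bar>"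
    if N: "\<And>n. n \<ge> N \<Longrightarrow> \<bar>p n - \<rho>\<bar> \<le> e" and e: "e > 0"
      and z: "0 \<le> z s" "z s < 1" and w: "0 \<le> w s" "w s < 1" for N e s
  proof -
    have L: "(\<lambda>n. x ^ n / real n) sums (- ln (1 - x))" if "0 \<le> x" "x < 1" for x
      using sums_minus[OF ln_series'[of "- x"]] that by simp
    define d where "d n = (z s ^ n - w s ^ n) / real n" for n
    have d: "d sums R s"
    proof -
      have "R s = - ln (1 - z s) - - ln (1 - w s)"
        unfolding R_def using z w by (subst ln_div) auto
      then show ?thesis using sums_diff[OF L[OF z] L[OF w]] unfolding d_def by (simp add:
          diff_divide_distrib)
    qed
    \<comment> \<open>All \<open>d n\<close> have the sign of z s - w s or vanish, so no
      cancellation is lost by taking absolute values.\<close>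
    have da: "(\<lambda>n. \<bar>d n\<bar>) sums \<bar>R s\<bar>"
    proof (cases "w s \<le> z s")
      case True
      then have nn: "0 \<le> d n" for n using w by (auto simp: d_def intro!: divide_nonneg_nonneg power_mono)
      then have "0 \<le> R s" using d suminf_nonneg[of d] by (simp add: sums_iff)
      then show ?thesis using d nn by simp
    next
      case False
      then have nn: "d n \<le> 0" for n
        using power_mono[of "z s" "w s" n] z by (simp add: d_def divide_nonpos_nonneg)
      have "(\<lambda>n. - d n) sums (- R s)" using d by (rule sums_minus)
      moreover from this have "0 \<le> - R s" using nn suminf_nonneg[of "\<lambda>n. - d n"] by (simp add: sums_iff)
      ultimately show ?thesis using nn by (simp add: abs_of_nonpos)
    qed
    have E: "(\<lambda>n. d n * (p n - \<rho>)) sums ((P (z s) - P (w s)) - \<rho> * R s)"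
    proof -
      have "(\<lambda>n. (z s ^ n * p n / real n - w s ^ n * p n / real n) - \<rho> * d n) sums
          ((P (z s) - P (w s)) - \<rho> * R s)"
        by (intro sums_diff P z w sums_mult d)
      moreover have "(z s ^ n * p n / real n - w s ^ n * p n / real n) - \<rho> * d n = d n * (p n - \<rho>)" for n
        by (simp add: d_def algebra_simps diff_divide_distrib)
      ultimately show ?thesis by simp
    qed
    define b where "b n = (if n < N then \<bar>z s ^ n - w s ^ n\<bar> * (1 + \<bar>\<rho>\<bar>) else 0) + e * \<bar>d n\<bar>" for n
    have "(\<lambda>n. if n < N then \<bar>z s ^ n - w s ^ n\<bar> * (1 + \<bar>\<rho>\<bar>) else 0) sums
        (\<Sum>n<N. \<bar>z s ^ n - w s ^ n\<bar> * (1 + \<bar>\<rho>\<bar>))"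
      using sums_If_finite_set[of "{..<N}" "\<lambda>n. \<bar>z s ^ n - w s ^ n\<bar> * (1 + \<bar>\<rho>\<bar>)"] by simp
    then have b: "b sums ((\<Sum>n<N. \<bar>z s ^ n - w s ^ n\<bar> * (1 + \<bar>\<rho>\<bar>)) + e * \<bar>R s\<bar>)"
      unfolding b_def by (intro sums_add sums_mult da)
    have db: "\<bar>d n * (p n - \<rho>)\<bar> \<le> b n" for n
    proof (cases "n < N")
      case True
      have "\<bar>d n\<bar> \<le> \<bar>z s ^ n - w s ^ n\<bar>"
        by (cases "n = 0") (auto simp: d_def abs_divide divide_le_eq mult_le_cancel_left1 not_less)
      moreover have "\<bar>p n - \<rho>\<bar> \<le> 1 + \<bar>\<rho>\<bar>" using p(2)[of n] by linarith
      ultimately have "\<bar>d n\<bar> * \<bar>p n - \<rho>\<bar> \<le> \<bar>z s ^ n - w s ^ n\<bar> * (1 + \<bar>\<rho>\<bar>)"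
        by (intro mult_mono) auto
      then show ?thesis using True e by (simp add: b_def abs_mult add_increasing2)
    next
      case False
      then have "\<bar>d n\<bar> * \<bar>p n - \<rho>\<bar> \<le> \<bar>d n\<bar> * e" by (intro mult_left_mono N) auto
      then show ?thesis using False by (simp add: b_def abs_mult mult.commute)
    qed
    have "\<bar>suminf (\<lambda>n. d n * (p n - \<rho>))\<bar> \<le> suminf b"
      using db b norm_suminf_le[of "\<lambda>n. d n * (p n - \<rho>)" b] by (simp add: sums_iff)
    then show ?thesis using E b by (simp add: sums_iff)
  qed
  have "((\<lambda>s. (P (z s) - P (w s)) - \<rho> * R s) \<longlongrightarrow> 0) F"
  proof (rule tendstoI)
    fix e :: real assume e: "e > 0"
    \<comment> \<open>Chosen so that e' * (|ln r| + 1) is half of the allowed error.\<close>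
    define e' where "e' = e / (2 * (\<bar>ln r\<bar> + 1))"
    have e': "e' > 0" using e by (simp add: e'_def add_nonneg_pos)
    obtain N where N: "\<And>n. n \<ge> N \<Longrightarrow> \<bar>p n - \<rho>\<bar> \<le> e'"
      using tendstoD[OF p(1) e'] unfolding eventually_sequentially dist_real_def by (meson less_imp_le)
    have "((\<lambda>s. (\<Sum>n<N. \<bar>z s ^ n - w s ^ n\<bar> * (1 + \<bar>\<rho>\<bar>))) \<longlongrightarrow> (\<Sum>n<N. \<bar>1 ^ n - 1 ^ n\<bar> * (1 + \<bar>\<rho>\<bar>))) F"
      by (intro tendsto_intros lim)
    then have 1: "\<forall>\<^sub>F s in F. (\<Sum>n<N. \<bar>z s ^ n - w s ^ n\<bar> * (1 + \<bar>\<rho>\<bar>)) < e / 2"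
      using e by (intro order_tendstoD(2)) auto
    have "((\<lambda>s. \<bar>R s\<bar>) \<longlongrightarrow> \<bar>ln r\<bar>) F" using R by (rule tendsto_rabs)
    then have 2: "\<forall>\<^sub>F s in F. \<bar>R s\<bar> < \<bar>ln r\<bar> + 1" by (intro order_tendstoD(2)) auto
    show "\<forall>\<^sub>F s in F. dist ((P (z s) - P (w s)) - \<rho> * R s) 0 < e"
      using 1 2 zw
    proof eventually_elim
      case (elim s)
      have "\<bar>(P (z s) - P (w s)) - \<rho> * R s\<bar> \<le> (\<Sum>n<N. \<bar>z s ^ n - w s ^ n\<bar> * (1 + \<bar>\<rho>\<bar>)) + e' * \<bar>R s\<bar>"
        by (rule key[OF N e']) (use elim in auto)
      also have "e' * \<bar>R s\<bar> \<le> e' * (\<bar>ln r\<bar> + 1)" using elim e' by (intro mult_left_mono) auto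
      also have "\<dots> = e / 2" unfolding e'_def by (simp add: field_simps add_nonneg_eq_0_iff) 
      finally show ?case using elim by (simp add: dist_real_def)
    qed
  qed
  moreover have "((\<lambda>s. \<rho> * R s) \<longlongrightarrow> \<rho> * ln r) F" by (intro tendsto_intros R)
  ultimately have "((\<lambda>s. ((P (z s) - P (w s)) - \<rho> * R s) + \<rho> * R s) \<longlongrightarrow> 0 + \<rho> * ln r) F"
    by (rule tendsto_add)
  then show ?thesis by simp
qed

text \<open>The Gamma factor cancels in the ratio, slow variation removes L, and the power remains.
  Positivity: K is nonnegative and eventually has the same zeros as a positive function.\<close>

lemma regularly_varying_tail:
  fixes K L :: "real \<Rightarrow> real"
  assumes L: "slowly_varying L" and \<alpha>: "\<alpha> < 1"
    and asymp: "K \<sim>[at_top] (\<lambda>x. 1 / Gamma (1 - \<alpha>) * x powr (- \<alpha>) * L x)"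
    and K0: "\<And>x. K x \<ge> 0"
  shows "\<And>c. c > 0 \<Longrightarrow> ((\<lambda>x. K (c * x) / K x) \<longlongrightarrow> c powr (- \<alpha>)) at_top"
    and "\<forall>\<^sub>F x in at_top. K x > 0"
proof -
  let ?g = "\<lambda>x. 1 / Gamma (1 - \<alpha>) * x powr (- \<alpha>) * L x"
  have G: "Gamma (1 - \<alpha>) > 0" using \<alpha> by (intro Gamma_real_pos) simp
  obtain A where A: "\<And>x. x \<ge> A \<Longrightarrow> L x > 0"
    and Lr: "\<And>c. c > 0 \<Longrightarrow> ((\<lambda>x. L (c * x) / L x) \<longlongrightarrow> 1) at_top"
    using L unfolding slowly_varying_def by blast
  have g: "\<forall>\<^sub>F x in at_top. ?g x > 0"
    using eventually_ge_at_top[of A] eventually_gt_at_top[of 0]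
    by eventually_elim (use A G in auto)
  show "\<forall>\<^sub>F x in at_top. K x > 0"
    using asymp_equiv_eventually_zeros[OF asymp] g
  proof eventually_elim
    case (elim x)
    then show ?case using K0[of x] by (metis less_eq_real_def less_irrefl)
  qed
  fix c :: real assume c: "c > 0"
  have cx: "filterlim (\<lambda>x. c * x) at_top at_top"
    using c by (rule filterlim_tendsto_pos_mult_at_top[OF tendsto_const _ filterlim_ident])
  have Kc: "(\<lambda>x. K (c * x)) \<sim>[at_top] (\<lambda>x. ?g (c * x))"
    by (rule asymp_equiv_compose'[OF asymp cx])
  have "(\<lambda>x. K (c * x) / K x) \<sim>[at_top] (\<lambda>x. ?g (c * x) / ?g x)"
    by (rule asymp_equiv_divide[OF Kc asymp])
  moreover have "((\<lambda>x. ?g (c * x) / ?g x) \<longlongrightarrow> c powr (- \<alpha>)) at_top"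
  proof (rule Lim_transform_eventually)
    show "((\<lambda>x. c powr (- \<alpha>) * (L (c * x) / L x)) \<longlongrightarrow> c powr (- \<alpha>)) at_top"
      using tendsto_mult[OF tendsto_const Lr[OF c], of "c powr (- \<alpha>)"] by simp
    show "\<forall>\<^sub>F x in at_top. c powr (- \<alpha>) * (L (c * x) / L x) = ?g (c * x) / ?g x"
      using eventually_gt_at_top[of 0]
    proof eventually_elim
      case (elim x)
      have "x powr (- \<alpha>) \<noteq> 0" using elim by simp
      then show ?case using G elim c by (simp add: powr_mult)
    qed
  qed
  ultimately show "((\<lambda>x. K (c * x) / K x) \<longlongrightarrow> c powr (- \<alpha>)) at_top"
    using tendsto_asymp_equiv_cong by blast
qed

section \<open>Regular variation for the time between records\<close>

context prob_space
begin

lemma tail_eq: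
  assumes Y[measurable]: "V \<in> borel_measurable M" and pos: "AE \<omega> in M. V \<omega> > (0::real)" and x: "x \<ge> 0"
  shows "\<P>(\<omega> in M. \<bar>V \<omega>\<bar> > x) = 1 - cdf (distr M borel V) x"
proof -
  have "cdf (distr M borel V) x = prob {\<omega>\<in>space M. V \<omega> \<le> x}"
    by (subst cdf_def, subst measure_distr) (auto intro!: arg_cong[where f=prob])
  moreover have "{\<omega>\<in>space M. V \<omega> \<le> x} = space M - {\<omega>\<in>space M. V \<omega> > x}" by auto
  ultimately have "1 - cdf (distr M borel V) x = \<P>(\<omega> in M. V \<omega> > x)"
    by (simp add: prob_compl)
  also have "\<dots> = \<P>(\<omega> in M. \<bar>V \<omega>\<bar> > x)"
    by (rule finite_measure_eq_AE) (use pos in \<open>auto elim!: eventually_mono\<close>)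
  finally show ?thesis ..
qed

text \<open>One minus the Laplace transform of the time between two successive records.\<close>

definition psi :: "(nat \<Rightarrow> 'a \<Rightarrow> real) \<Rightarrow> (nat \<Rightarrow> 'a \<Rightarrow> real) \<Rightarrow> real \<Rightarrow> real" where
  "psi X Y s = 1 - ladder_gf X (wait_laplace Y s)"

end

locale heavy_tailed_ctrw = prob_space M for M :: "'a measure" +
  fixes X Y :: "nat \<Rightarrow> 'a \<Rightarrow> real" and \<alpha> \<rho> :: real and L :: "real \<Rightarrow> real"
  assumes iidX: "iid_sequence M X" and iidY: "iid_sequence M Y"
    and posY: "\<forall>i\<ge>1. AE \<omega> in M. Y i \<omega> > 0"
    and ind: "independent_sequences M X Y"
    and nonneg_prob: "nonneg_prob X \<longlonglongrightarrow> \<rho>" and \<rho>: "\<rho> > 0"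
    and \<alpha>: "0 < \<alpha>" "\<alpha> < 1" and L: "slowly_varying L"
    and tail: "(\<lambda>x. 1 - cdf (distr M borel (Y 1)) x) \<sim>[at_top]
           (\<lambda>x. 1 / Gamma (1 - \<alpha>) * x powr (- \<alpha>) * L x)"
begin

lemma tail_facts:
  shows "\<And>c. c > 0 \<Longrightarrow> ((\<lambda>x. \<P>(\<omega> in M. \<bar>Y 1 \<omega>\<bar> > c * x) / \<P>(\<omega> in M. \<bar>Y 1 \<omega>\<bar> > x)) \<longlongrightarrow> c powr (- \<alpha>)) at_top"
    and "\<forall>\<^sub>F x in at_top. \<P>(\<omega> in M. \<bar>Y 1 \<omega>\<bar> > x) > 0"
proof -
  have "Y 1 \<in> borel_measurable M" by (rule iid_measurable[OF prob_space_axioms iidY]) simp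
  from tail_eq[OF this posY[rule_format, OF order_refl]]
  have "\<forall>\<^sub>F x in at_top. 1 - cdf (distr M borel (Y 1)) x = \<P>(\<omega> in M. \<bar>Y 1 \<omega>\<bar> > x)"
    by (intro eventually_mono[OF eventually_ge_at_top[of 0]]) (simp only:)
  then have "(\<lambda>x. \<P>(\<omega> in M. \<bar>Y 1 \<omega>\<bar> > x)) \<sim>[at_top] (\<lambda>x. 1 / Gamma (1 - \<alpha>) * x powr (- \<alpha>) * L x)"
    using tail by (subst (asm) asymp_equiv_cong) auto
  from regularly_varying_tail[OF L \<alpha>(2) this]
  show "\<And>c. c > 0 \<Longrightarrow> ((\<lambda>x. \<P>(\<omega> in M. \<bar>Y 1 \<omega>\<bar> > c * x) / \<P>(\<omega> in M. \<bar>Y 1 \<omega>\<bar> > x)) \<longlongrightarrow> c powr (- \<alpha>)) at_top"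
    and "\<forall>\<^sub>F x in at_top. \<P>(\<omega> in M. \<bar>Y 1 \<omega>\<bar> > x) > 0" by auto
qed

lemma abs_wait_measurable: "(\<lambda>\<omega>. \<bar>Y 1 \<omega>\<bar>) \<in> borel_measurable M"
  by (intro borel_measurable_abs iid_measurable[OF prob_space_axioms iidY]) simp

text \<open>The tail is positive arbitrarily far out, hence at 1 / s by monotonicity, and
  \<open>laplace_defect_lower\<close> makes the defect positive.\<close>

lemma wait_laplace_less_1:
  assumes s: "s > 0"
  shows "wait_laplace Y s < 1"
proof -
  obtain x where x: "x \<ge> 1 / s" "\<P>(\<omega> in M. \<bar>Y 1 \<omega>\<bar> > x) > 0"
    using eventually_conj[OF tail_facts(2) eventually_ge_at_top[of "1 / s"]]
    by (metis (mono_tags, lifting) eventually_at_top_linorder order_refl)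
  have "\<P>(\<omega> in M. \<bar>Y 1 \<omega>\<bar> > x) \<le> \<P>(\<omega> in M. \<bar>Y 1 \<omega>\<bar> > 1 / s)"
    using x(1) abs_wait_measurable by (intro finite_measure_mono) auto
  then have "0 < (1 - exp (-1)) * \<P>(\<omega> in M. \<bar>Y 1 \<omega>\<bar> > 1 / s)"
    using x(2) by (intro mult_pos_pos) auto
  also have "\<dots> \<le> 1 - wait_laplace Y s"
    unfolding wait_laplace_def by (rule laplace_defect_lower[OF abs_wait_measurable _ tail_facts \<alpha> s]) auto
  finally show ?thesis by simp
qed

lemma psi_bounds:
  assumes s: "s > 0"
  shows "0 < psi X Y s" "psi X Y s \<le> 1"
  using wait_laplace_less_1[OF s] wait_laplace_bounds[OF iidY, of s] s ladder_gf_le[OF iidX, of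
      "wait_laplace Y s"]
    ladder_gf_nonneg[OF iidX, of "wait_laplace Y s"] by (auto simp: psi_def)

lemma wait_laplace_tendsto_1: "(wait_laplace Y \<longlongrightarrow> 1) (at_right 0)"
proof -
  have "((\<lambda>s. 1 - wait_laplace Y s) \<longlongrightarrow> 0) (at_right 0)"
    unfolding wait_laplace_def by (rule laplace_defect_tendsto_0[OF abs_wait_measurable _ tail_facts \<alpha>])
        auto
  then have "((\<lambda>s. 1 - (1 - wait_laplace Y s)) \<longlongrightarrow> 1 - 0) (at_right 0)"
    by (intro tendsto_diff tendsto_const)
  then show ?thesis by simp
qed

text \<open>Since \<open>psi X Y s\<close> is exp (- P (\<open>wait_laplace Y s\<close>)), the ratio
  is the exponential of a difference of two values of P, and \<open>log_series_transfer\<close>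
  gives this difference the limit \<rho> * ln (c powr \<alpha>).\<close>

theorem psi_regularly_varying:
  assumes c: "c > 0"
  shows "((\<lambda>s. psi X Y (c * s) / psi X Y s) \<longlongrightarrow> c powr (\<alpha> * \<rho>)) (at_right 0)"
proof -
  define P where "P x = - ln (1 - ladder_gf X x)" for x
  have cs: "filterlim (\<lambda>s. c * s) (at_right 0) (at_right 0)"
    using c by (auto simp: filterlim_at intro!: tendsto_eq_intros eventually_mono[OF
        eventually_at_right_less])
  have in01: "\<forall>\<^sub>F s in at_right 0. 0 \<le> wait_laplace Y s \<and> wait_laplace Y s < 1"
    using eventually_at_right_less
    by eventually_elim (use wait_laplace_less_1 wait_laplace_bounds[OF iidY] in auto)
  have "((\<lambda>s. P (wait_laplace Y s) - P (wait_laplace Y (c * s))) \<longlongrightarrow> \<rho> * ln (c powr \<alpha>)) (at_right 0)"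
  proof (rule log_series_transfer[where p = "nonneg_prob X" and P = P and z = "wait_laplace Y" and w = "\<lambda>s.
      wait_laplace Y (c * s)"])
    show "nonneg_prob X \<longlonglongrightarrow> \<rho>" by (rule nonneg_prob)
    show "\<bar>nonneg_prob X n\<bar> \<le> 1" for n by (simp add: nonneg_prob_def)
    show "\<forall>\<^sub>F s in at_right 0. 0 \<le> wait_laplace Y s \<and> wait_laplace Y s < 1" by (rule in01)
    show "\<forall>\<^sub>F s in at_right 0. 0 \<le> wait_laplace Y (c * s) \<and> wait_laplace Y (c * s) < 1"
      using in01 cs unfolding filterlim_iff by blast
    show "(wait_laplace Y \<longlongrightarrow> 1) (at_right 0)" by (rule wait_laplace_tendsto_1)
    show "((\<lambda>s. wait_laplace Y (c * s)) \<longlongrightarrow> 1) (at_right 0)" by (rule filterlim_compose[OF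
        wait_laplace_tendsto_1 cs])
    show "((\<lambda>s. (1 - wait_laplace Y (c * s)) / (1 - wait_laplace Y s)) \<longlongrightarrow> c powr \<alpha>) (at_right 0)"
      unfolding wait_laplace_def by (rule laplace_defect_regularly_varying[OF abs_wait_measurable _
          tail_facts \<alpha> c]) auto
    show "c powr \<alpha> > 0" using c by simp
    show "(\<lambda>n. x ^ n * nonneg_prob X n / real n) sums P x" if "0 \<le> x" "x < 1" for x
      unfolding P_def by (rule sparre_andersen[OF iidX that])
  qed
  then have "((\<lambda>s. exp (P (wait_laplace Y s) - P (wait_laplace Y (c * s)))) \<longlongrightarrow> exp (\<rho> * ln (c powr \<alpha>)))
      (at_right 0)"
    by (rule tendsto_exp)
  moreover have "exp (\<rho> * ln (c powr \<alpha>)) = c powr (\<alpha> * \<rho>)"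
    using c by (simp add: powr_def ac_simps)
  moreover have "\<forall>\<^sub>F s in at_right 0. exp (P (wait_laplace Y s) - P (wait_laplace Y (c * s))) = psi X Y (c *
      s) / psi X Y s"
    using eventually_at_right_less
  proof eventually_elim
    case (elim s)
    have *: "exp (P (wait_laplace Y t)) = 1 / psi X Y t" if "t > 0" for t
      using psi_bounds(1)[OF that] by (simp add: P_def psi_def exp_minus inverse_eq_divide)
    show ?case using *[of s] *[of "c * s"] elim c by (simp add: exp_diff)
  qed
  ultimately show ?thesis by (auto intro: Lim_transform_eventually)
qed

end

section \<open>Stable subordinators and their inverses\<close>

text \<open>Each clause has a counterpart for the inverse: strict increase gives continuity,
  unboundedness finiteness, and right continuity at 0 with d 0 = 0 positivity at positive
  times.\<close>

definition subordinator_path :: "(real \<Rightarrow> real) \<Rightarrow> bool" where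
  "subordinator_path d \<longleftrightarrow> d 0 = 0 \<and> strict_mono_on {0..} d \<and> (\<forall>v\<ge>0. continuous (at_right v) d) \<and> (\<forall>c. \<exists>v\<ge>0. d
      v > c)"

definition path_inverse :: "(real \<Rightarrow> real) \<Rightarrow> real \<Rightarrow> real" where
  "path_inverse d t = Inf {v. 0 \<le> v \<and> d v > t}"

lemma inverse_process_path_inverse: "inverse_process D t \<omega> = path_inverse (\<lambda>v. D v \<omega>) t"
  by (simp add: inverse_process_def path_inverse_def)

lemma subordinator_path_id: "subordinator_path (\<lambda>v. v)"
  unfolding subordinator_path_def
proof (intro conjI allI impI)
  show "\<exists>v\<ge>0. v > c" for c :: real by (intro exI[of _ "\<bar>c\<bar> + 1"]) auto
qed (auto simp: strict_mono_on_def)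

section \<open>The inverse of a regular path\<close>

context
  fixes d :: "real \<Rightarrow> real"
  assumes d: "subordinator_path d"
begin

lemma subordinator_path_less: "0 \<le> v \<Longrightarrow> v < w \<Longrightarrow> d v < d w"
  using d unfolding subordinator_path_def strict_mono_on_def by auto

lemma subordinator_path_le: "0 \<le> v \<Longrightarrow> v \<le> w \<Longrightarrow> d v \<le> d w"
  using subordinator_path_less[of v w] by (cases "v = w") (auto intro: less_imp_le)

lemma subordinator_path_nonneg: "0 \<le> v \<Longrightarrow> 0 \<le> d v"
  using subordinator_path_le[of 0 v] d by (simp add: subordinator_path_def)

lemma path_inverse_nonempty: "{v. 0 \<le> v \<and> d v > t} \<noteq> {}"
  using d by (auto simp: subordinator_path_def)

lemma path_inverse_bdd: "bdd_below {v. 0 \<le> v \<and> d v > t}"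
  by (rule bdd_belowI[of _ 0]) auto

lemma path_inverse_ge: "0 \<le> v \<Longrightarrow> d v \<le> t \<Longrightarrow> v \<le> path_inverse d t"
  unfolding path_inverse_def
proof (rule cInf_greatest[OF path_inverse_nonempty])
  fix w assume v: "0 \<le> v" "d v \<le> t" and w: "w \<in> {v. 0 \<le> v \<and> d v > t}"
  show "v \<le> w" using subordinator_path_le[of w v] v w by (cases "v \<le> w") auto
qed

lemma path_inverse_le: "0 \<le> v \<Longrightarrow> d v > t \<Longrightarrow> path_inverse d t \<le> v"
  unfolding path_inverse_def by (rule cInf_lower[OF _ path_inverse_bdd]) auto

lemma path_inverse_nonneg: "0 \<le> path_inverse d t"
  unfolding path_inverse_def by (rule cInf_greatest[OF path_inverse_nonempty]) auto

lemma path_inverse_lessD: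
  assumes "path_inverse d t < a"
  shows "\<exists>w. 0 \<le> w \<and> w < a \<and> d w > t"
  using assms cInf_less_iff[OF path_inverse_nonempty path_inverse_bdd] unfolding path_inverse_def by auto

lemma path_inverse_eq: "0 \<le> v \<Longrightarrow> path_inverse d (d v) = v"
proof (rule antisym)
  assume v: "0 \<le> v"
  show "path_inverse d (d v) \<le> v"
  proof (rule field_le_epsilon)
    fix e :: real assume "e > 0"
    then show "path_inverse d (d v) \<le> v + e" using v by (intro path_inverse_le subordinator_path_less) auto
  qed
qed (rule path_inverse_ge, auto)

lemma path_inverse_0: "path_inverse d 0 = 0"
  using path_inverse_eq[of 0] d by (simp add: subordinator_path_def)

lemma path_inverse_mono: "s \<le> t \<Longrightarrow> path_inverse d s \<le> path_inverse d t"
  unfolding path_inverse_def by (rule cInf_superset_mono[OF path_inverse_nonempty path_inverse_bdd]) auto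

lemma path_inverse_pos:
  assumes "t > 0"
  shows "path_inverse d t > 0"
proof -
  have "(d \<longlongrightarrow> d 0) (at_right 0)" using d by (auto simp: subordinator_path_def continuous_within)
  then have "\<forall>\<^sub>F v in at_right 0. d v < t"
    using assms d by (intro order_tendstoD(2)) (auto simp: subordinator_path_def)
  then have "\<forall>\<^sub>F v in at_right 0. d v < t \<and> 0 < v"
    using eventually_at_right_less by (rule eventually_conj)
  then obtain v where "d v < t" "0 < v"
    using eventually_happens'[of "at_right (0::real)"] by (auto simp: trivial_limit_at_right_real)
  then show ?thesis using path_inverse_ge[of v t] by simp
qed

text \<open>A jump of the inverse would be a flat stretch of d, which strict increase excludes;
  jumps of d only produce flat stretches of the inverse.\<close>

lemma path_inverse_continuous: "continuous_on {0..} (path_inverse d)"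
  unfolding continuous_on_iff
proof (intro ballI allI impI)
  fix t e :: real assume t: "t \<in> {0..}" and e: "e > 0"
  define v where "v = path_inverse d t"
  have v0: "v \<ge> 0" unfolding v_def by (rule path_inverse_nonneg)
  obtain w where w: "0 \<le> w" "w < v + e" "d w > t"
    using path_inverse_lessD[of t "v + e"] e by (auto simp: v_def)
  have up: "path_inverse d t' < v + e" if "t' < d w" for t'
    using path_inverse_le[OF w(1) that] w(2) by simp
  obtain \<eta> where \<eta>: "\<eta> > 0" "\<And>t'. t' \<ge> 0 \<Longrightarrow> t - t' < \<eta> \<Longrightarrow> path_inverse d t' > v - e"
  proof (cases "v - e < 0")
    case True
    then show ?thesis using that[of 1] path_inverse_nonneg by (meson less_le_trans zero_less_one)
  next
    case False
    \<comment> \<open>At v - e / 3 the path has not passed t, so at v - e / 2 it is strictly below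
      t; the remaining gap serves as \<eta>.\<close>
    have "\<not> d (v - e / 3) > t"
      using path_inverse_le[of "v - e / 3" t] False e by (auto simp: v_def)
    moreover have "d (v - e / 2) < d (v - e / 3)"
      using False e by (intro subordinator_path_less) auto
    ultimately have "t - d (v - e / 2) > 0" by simp
    moreover have "path_inverse d t' > v - e" if "t - t' < t - d (v - e / 2)" for t'
      using path_inverse_ge[of "v - e / 2" t'] that False e by simp
    ultimately show ?thesis using that[of "t - d (v - e / 2)"] by blast
  qed
  show "\<exists>h>0. \<forall>t'\<in>{0..}. dist t' t < h \<longrightarrow> dist (path_inverse d t') (path_inverse d t) < e"
  proof (intro exI[of _ "min \<eta> (d w - t)"] conjI ballI impI)
    show "0 < min \<eta> (d w - t)" using \<eta>(1) w(3) by simp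
    fix t' assume t': "t' \<in> {0..}" "dist t' t < min \<eta> (d w - t)"
    then have "path_inverse d t' < v + e" "v - e < path_inverse d t'"
      using up[of t'] \<eta>(2)[of t'] by (auto simp: dist_real_def)
    then show "dist (path_inverse d t') (path_inverse d t) < e" by (auto simp: dist_real_def v_def)
  qed
qed

end

text \<open>Strictness and unboundedness are asked for along countable sets only, so that almost
  sure statements can be combined; monotonicity interpolates between rationals.\<close>

lemma gpathI_rat:
  assumes "d 0 = 0" "mono_on {0..} d" "\<forall>v\<ge>0. continuous (at_right v) d"
    and rat: "\<And>p q. p \<in> \<rat> \<Longrightarrow> q \<in> \<rat> \<Longrightarrow> 0 \<le> p \<Longrightarrow> p < q \<Longrightarrow> d p < d q"
    and unb: "\<And>k::nat. \<exists>n::nat. d (real n) > real k"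
  shows "subordinator_path d"
  unfolding subordinator_path_def
proof (intro conjI allI)
  show "strict_mono_on {0..} d"
    unfolding strict_mono_on_def
  proof (intro allI impI)
    fix v w :: real assume vw: "v \<in> {0..} \<and> w \<in> {0..} \<and> v < w"
    obtain p where p: "p \<in> \<rat>" "v < p" "p < w" using Rats_dense_in_real vw by blast
    obtain q where q: "q \<in> \<rat>" "p < q" "q < w" using Rats_dense_in_real p by blast
    have "d v \<le> d p" "d q \<le> d w"
      using assms(2) vw p q by (auto intro!: mono_onD[OF assms(2)])
    moreover have "d p < d q" using rat p q vw by auto
    ultimately show "d v < d w" by linarith
  qed
  show "\<exists>v\<ge>0. d v > c" for c
  proof -
    obtain k :: nat where "c < real k" using reals_Archimedean2 by blast
    then show ?thesis using unb[of k] by (metis less_trans of_nat_0_le_iff)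
  qed
qed (use assms in auto)

section \<open>Path regularity and Laplace transforms of a stable subordinator\<close>

context
  fixes N :: "'b measure" and \<beta> :: real and D :: "real \<Rightarrow> 'b \<Rightarrow> real"
  assumes S: "stable_subordinator N \<beta> D"
begin

interpretation N: prob_space N
  using S by (simp add: stable_subordinator_def subordinator_def)

lemma stable_measurable: "v \<ge> 0 \<Longrightarrow> D v \<in> borel_measurable N"
  using S by (auto simp: stable_subordinator_def subordinator_def)

lemma stable_laplace: "v \<ge> 0 \<Longrightarrow> s \<ge> 0 \<Longrightarrow> (\<integral>\<omega>. exp (- s * D v \<omega>) \<partial>N) = exp (- v * s powr \<beta>)"
  using S by (auto simp: stable_subordinator_def)

lemma stable_beta: "0 < \<beta>" "\<beta> < 1"
  using S by (auto simp: stable_subordinator_def)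

lemma stable_paths: "AE \<omega> in N. D 0 \<omega> = 0 \<and> mono_on {0..} (\<lambda>v. D v \<omega>) \<and>
    (\<forall>v\<ge>0. continuous (at_right v) (\<lambda>v. D v \<omega>))"
  using S by (auto simp: stable_subordinator_def subordinator_def)

lemma stable_incr: "v \<ge> 0 \<Longrightarrow> h \<ge> 0 \<Longrightarrow>
    distr N borel (\<lambda>\<omega>. D (v + h) \<omega> - D v \<omega>) = distr N borel (D h)"
  using S by (auto simp: stable_subordinator_def subordinator_def)

lemma stable_indep:
  fixes v :: "nat \<Rightarrow> real"
  assumes "0 \<le> v 0" "mono v"
  shows "N.indep_vars (\<lambda>_. borel) (\<lambda>i \<omega>. D (v (Suc i)) \<omega> - D (v i) \<omega>) {..<n}"
proof -
  have "\<forall>(v :: nat \<Rightarrow> real) n. 0 \<le> v 0 \<longrightarrow> mono v \<longrightarrow>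
        N.indep_vars (\<lambda>_. borel) (\<lambda>i \<omega>. D (v (Suc i)) \<omega> - D (v i) \<omega>) {..<n}"
    using S unfolding stable_subordinator_def subordinator_def by (elim conjE)
  from this[rule_format, OF assms] show ?thesis .
qed

lemma stable_nonneg:
  assumes v: "v \<ge> 0"
  shows "AE \<omega> in N. 0 \<le> D v \<omega>"
  using stable_paths
proof eventually_elim
  case (elim \<omega>)
  then show ?case using v mono_onD[of "{0..}" "\<lambda>v. D v \<omega>" 0 v] by auto
qed

lemma stable_exp_integrable:
  assumes v: "v \<ge> 0" "s \<ge> 0"
  shows "integrable N (\<lambda>\<omega>. exp (- s * D v \<omega>))"
proof (rule N.integrable_const_bound[where B=1])
  show "AE \<omega> in N. norm (exp (- s * D v \<omega>)) \<le> 1"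
    using stable_nonneg[OF v(1)] by eventually_elim (use v in auto)
  show "(\<lambda>\<omega>. exp (- s * D v \<omega>)) \<in> borel_measurable N" using stable_measurable[OF v(1)] by measurable
qed

text \<open>Chernoff's bound for the lower tail. With c = 0 and s to infinity it gives positivity,
  with s = 1 and v to infinity unboundedness.\<close>

lemma stable_markov:
  assumes v: "v \<ge> 0" and s: "s \<ge> 0"
  shows "N.prob {\<omega>\<in>space N. D v \<omega> \<le> c} \<le> exp (s * c - v * s powr \<beta>)"
proof -
  note [measurable] = stable_measurable[OF v]
  have "N.prob {\<omega>\<in>space N. D v \<omega> \<le> c} \<le> N.prob {\<omega>\<in>space N. exp (- s * D v \<omega>) \<ge> exp (- s * c)}"
    using s by (intro N.finite_measure_mono) (auto intro: mult_left_mono)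
  also have "\<dots> \<le> (\<integral>\<omega>. exp (- s * D v \<omega>) \<partial>N) / exp (- s * c)"
    by (rule integral_Markov_inequality_measure[where A = "space N"])
      (use stable_exp_integrable[OF v s] in auto)
  also have "\<dots> = exp (s * c - v * s powr \<beta>)"
    using stable_laplace[OF v s] by (simp add: exp_diff exp_minus divide_inverse)
  finally show ?thesis .
qed

lemma stable_pos:
  assumes h: "h > 0"
  shows "AE \<omega> in N. D h \<omega> > 0"
proof -
  have [measurable]: "D h \<in> borel_measurable N" using stable_measurable h by simp
  have "N.prob {\<omega>\<in>space N. D h \<omega> \<le> 0} \<le> 0"
  proof (rule tendsto_lowerbound)
    have "filterlim (\<lambda>s. s powr \<beta>) at_top at_top"
      unfolding filterlim_at_top
    proof
      fix Z :: real
      have "Z \<le> s powr \<beta>" if "s \<ge> (max Z 1) powr (1 / \<beta>)" for s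
      proof -
        have "Z \<le> ((max Z 1) powr (1 / \<beta>)) powr \<beta>" using stable_beta by (simp add: powr_powr)
        also have "\<dots> \<le> s powr \<beta>" using that stable_beta by (intro powr_mono2) auto
        finally show ?thesis .
      qed
      then show "\<forall>\<^sub>F s in at_top. Z \<le> s powr \<beta>" unfolding eventually_at_top_linorder by blast
    qed
    then have "filterlim (\<lambda>s. h * s powr \<beta>) at_top at_top"
      using h by (intro filterlim_tendsto_pos_mult_at_top[OF tendsto_const])
    then show "((\<lambda>s. exp (- (h * s powr \<beta>))) \<longlongrightarrow> 0) at_top"
      by (intro filterlim_compose[OF exp_at_bot]) (simp add: filterlim_uminus_at_top[symmetric])
    show "\<forall>\<^sub>F s in at_top. N.prob {\<omega>\<in>space N. D h \<omega> \<le> 0} \<le> exp (- (h * s powr \<beta>))"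
      using eventually_ge_at_top[of 0]
    proof eventually_elim
      case (elim s)
      then show ?case using stable_markov[of h s 0] h by simp
    qed
  qed simp
  then have "N.prob {\<omega>\<in>space N. D h \<omega> \<le> 0} = 0" by (simp add: measure_le_0_iff)
  then have "AE \<omega> in N. \<not> D h \<omega> \<le> 0"
    by (subst (asm) N.prob_eq_0) auto
  then show ?thesis by (rule AE_mp) auto
qed

lemma stable_strict:
  assumes "0 \<le> p" "p < q"
  shows "AE \<omega> in N. D p \<omega> < D q \<omega>"
proof -
  have [measurable]: "D p \<in> borel_measurable N" "D q \<in> borel_measurable N" "D (q - p) \<in> borel_measurable N"
    using stable_measurable assms by auto
  have D0: "AE x in distr N borel (D (q - p)). x > 0"
    using stable_pos[of "q - p"] assms by (subst AE_distr_iff) auto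
  have eq: "distr N borel (\<lambda>\<omega>. D q \<omega> - D p \<omega>) = distr N borel (D (q - p))"
    using stable_incr[of p "q - p"] assms by simp
  have "AE x in distr N borel (\<lambda>\<omega>. D q \<omega> - D p \<omega>). x > 0"
    unfolding eq by (rule D0)
  then show ?thesis by (subst (asm) AE_distr_iff) auto
qed

lemma stable_unbounded: "AE \<omega> in N. \<forall>k::nat. \<exists>n::nat. D (real n) \<omega> > real k"
  unfolding AE_all_countable
proof
  fix k :: nat
  have [measurable]: "D (real n) \<in> borel_measurable N" for n :: nat using stable_measurable by simp
  have "N.prob {\<omega>\<in>space N. \<forall>n::nat. D (real n) \<omega> \<le> real k} \<le> 0"
  proof (rule LIMSEQ_le_const)
    have "((\<lambda>n. exp (real k) * exp (- real n)) \<longlongrightarrow> exp (real k) * 0) sequentially"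
      by (intro tendsto_mult tendsto_const filterlim_compose[OF exp_at_bot])
        (auto simp: filterlim_uminus_at_top[symmetric] filterlim_real_sequentially)
    then show "(\<lambda>n. exp (real k - real n)) \<longlonglongrightarrow> 0"
      by (simp add: exp_diff exp_minus divide_inverse)
    show "\<exists>n0. \<forall>n\<ge>n0. N.prob {\<omega>\<in>space N. \<forall>n::nat. D (real n) \<omega> \<le> real k} \<le> exp (real k - real n)"
    proof (intro exI allI impI)
      fix n :: nat
      have "N.prob {\<omega>\<in>space N. \<forall>n::nat. D (real n) \<omega> \<le> real k} \<le> N.prob {\<omega>\<in>space N. D (real n) \<omega> \<le> real k}"
        by (intro N.finite_measure_mono) auto
      also have "\<dots> \<le> exp (real k - real n)" using stable_markov[of "real n" 1 "real k"] by simp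
      finally show "N.prob {\<omega>\<in>space N. \<forall>n::nat. D (real n) \<omega> \<le> real k} \<le> exp (real k - real n)" .
    qed
  qed
  then have "N.prob {\<omega>\<in>space N. \<forall>n::nat. D (real n) \<omega> \<le> real k} = 0" by (simp add: measure_le_0_iff)
  then have "AE \<omega> in N. \<not> (\<forall>n::nat. D (real n) \<omega> \<le> real k)"
    by (subst (asm) N.prob_eq_0) auto
  then show "AE \<omega> in N. \<exists>n::nat. D (real n) \<omega> > real k"
    by (rule AE_mp) (auto simp: not_le)
qed

lemma AE_subordinator_path: "AE \<omega> in N. subordinator_path (\<lambda>v. D v \<omega>)"
proof -
  have "AE \<omega> in N. \<forall>p\<in>\<rat>. \<forall>q\<in>\<rat>. 0 \<le> p \<longrightarrow> p < q \<longrightarrow> D p \<omega> < D q \<omega>"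
  proof (intro AE_ball_countable[THEN iffD2] ballI countable_rat)
    fix p q :: real
    show "AE \<omega> in N. 0 \<le> p \<longrightarrow> p < q \<longrightarrow> D p \<omega> < D q \<omega>"
      using stable_strict[of p q] by (cases "0 \<le> p \<and> p < q") auto
  qed
  then show ?thesis
    using stable_paths stable_unbounded
    by eventually_elim (rule gpathI_rat, auto)
qed

text \<open>Mixed Laplace transforms on an equidistant grid: the limits that the corresponding
  transforms of the scaled record times must have.\<close>

lemma stable_moments:
  assumes \<delta>: "\<delta> \<ge> 0" and a: "\<And>i. a i \<ge> 0"
  shows "(\<integral>\<omega>. exp (- (\<Sum>i<n. a i * (D (\<delta> * real (Suc i)) \<omega> - D (\<delta> * real i) \<omega>))) \<partial>N) =
     (\<Prod>i<n. exp (- \<delta> * a i powr \<beta>))"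
proof -
  let ?X = "\<lambda>i \<omega>. D (\<delta> * real (Suc i)) \<omega> - D (\<delta> * real i) \<omega>"
  have [measurable]: "D (\<delta> * real i) \<in> borel_measurable N" for i :: nat using stable_measurable \<delta> by simp
  have "N.indep_vars (\<lambda>_. borel) ?X {..<n}"
  proof -
    have "mono (\<lambda>i::nat. \<delta> * real i)" using \<delta> by (intro monoI mult_left_mono) auto
    moreover have "0 \<le> \<delta> * real 0" by simp
    ultimately show ?thesis by (rule stable_indep[rotated])
  qed
  then have ind: "N.indep_vars (\<lambda>_. borel) (\<lambda>i \<omega>. exp (- a i * ?X i \<omega>)) {..<n}"
    by (rule N.indep_vars_compose2) auto
  have D1: "distr N borel (?X i) = distr N borel (D \<delta>)" for i
    using stable_incr[of "\<delta> * real i" \<delta>] \<delta> by (simp add: algebra_simps)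
  have [measurable]: "D \<delta> \<in> borel_measurable N" using stable_measurable \<delta> by simp
  have int: "integrable N (\<lambda>\<omega>. exp (- a i * ?X i \<omega>))" for i
  proof (rule N.integrable_const_bound[where B=1])
    show "AE \<omega> in N. norm (exp (- a i * ?X i \<omega>)) \<le> 1"
      using stable_paths
    proof eventually_elim
      case (elim \<omega>)
      then have "D (\<delta> * real i) \<omega> \<le> D (\<delta> * real (Suc i)) \<omega>"
        using \<delta> by (auto intro!: mono_onD[of "{0..}" "\<lambda>v. D v \<omega>"] mult_left_mono)
      then show ?case using a[of i] by simp
    qed
  qed measurable
  have "(\<integral>\<omega>. exp (- (\<Sum>i<n. a i * ?X i \<omega>)) \<partial>N) = (\<integral>\<omega>. (\<Prod>i<n. exp (- a i * ?X i \<omega>)) \<partial>N)"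
    by (simp add: exp_sum[symmetric] sum_negf)
  also have "\<dots> = (\<Prod>i<n. (\<integral>\<omega>. exp (- a i * ?X i \<omega>) \<partial>N))"
    by (rule N.indep_vars_lebesgue_integral[OF _ ind int]) auto
  also have "\<dots> = (\<Prod>i<n. exp (- \<delta> * a i powr \<beta>))"
  proof (rule prod.cong)
    fix i
    have "(\<integral>\<omega>. exp (- a i * ?X i \<omega>) \<partial>N) = (\<integral>x. exp (- a i * x) \<partial>distr N borel (?X i))"
      by (rule integral_distr[symmetric]) measurable
    also have "\<dots> = (\<integral>\<omega>. exp (- a i * D \<delta> \<omega>) \<partial>N)"
      unfolding D1 by (subst integral_distr) auto
    also have "\<dots> = exp (- \<delta> * a i powr \<beta>)" using stable_laplace[OF \<delta> a] .
    finally show "(\<integral>\<omega>. exp (- a i * ?X i \<omega>) \<partial>N) = exp (- \<delta> * a i powr \<beta>)" .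
  qed simp
  finally show ?thesis .
qed

text \<open>\<open>D\<close> is replaced by the identity path on a null set, so that every path is regular.\<close>

lemma regular_version:
  obtains D' where "\<And>\<omega>. subordinator_path (\<lambda>v. D' v \<omega>)" "\<And>v. v \<ge> 0 \<Longrightarrow> D' v \<in> borel_measurable N"
    "AE \<omega> in N. \<forall>v. D' v \<omega> = D v \<omega>"
    "\<And>a \<delta> n. \<delta> \<ge> 0 \<Longrightarrow> (\<And>i. a i \<ge> 0) \<Longrightarrow>
       (\<integral>\<omega>. exp (- (\<Sum>i<n. a i * (D' (\<delta> * real (Suc i)) \<omega> - D' (\<delta> * real i) \<omega>))) \<partial>N) =
       (\<Prod>i<n. exp (- \<delta> * a i powr \<beta>))"
proof -
  obtain A where A: "{\<omega>\<in>space N. \<not> subordinator_path (\<lambda>v. D v \<omega>)} \<subseteq> A" "emeasure N A = 0" "A \<in> sets N"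
    using AE_subordinator_path by (rule AE_E)
  define D' where "D' v \<omega> = (if \<omega> \<in> space N - A then D v \<omega> else v)" for v \<omega>
  have ae: "AE \<omega> in N. \<omega> \<in> space N - A"
    using A(2,3) by (auto intro!: AE_I[of _ _ A])
  have 1: "subordinator_path (\<lambda>v. D' v \<omega>)" for \<omega>
    using A(1) subordinator_path_id by (cases "\<omega> \<in> space N - A") (auto simp: D'_def)
  have 2: "D' v \<in> borel_measurable N" if "v \<ge> 0" for v
    unfolding D'_def using stable_measurable[OF that] A(3) by measurable
  have 3: "AE \<omega> in N. \<forall>v. D' v \<omega> = D v \<omega>"
    using ae by (rule AE_mp) (auto simp: D'_def)
  have 4: "(\<integral>\<omega>. exp (- (\<Sum>i<n. a i * (D' (\<delta> * real (Suc i)) \<omega> - D' (\<delta> * real i) \<omega>))) \<partial>N) =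
       (\<Prod>i<n. exp (- \<delta> * a i powr \<beta>))" if \<delta>: "\<delta> \<ge> 0" and a: "\<And>i. a i \<ge> 0" for a \<delta> n
  proof -
    have [measurable]: "D (\<delta> * real i) \<in> borel_measurable N" "D' (\<delta> * real i) \<in> borel_measurable N" for i ::
        nat
      using stable_measurable 2 \<delta> by simp_all
    show ?thesis
      unfolding stable_moments[OF \<delta> a, symmetric]
    proof (rule integral_cong_AE)
      show "AE \<omega> in N. exp (- (\<Sum>i<n. a i * (D' (\<delta> * real (Suc i)) \<omega> - D' (\<delta> * real i) \<omega>))) =
        exp (- (\<Sum>i<n. a i * (D (\<delta> * real (Suc i)) \<omega> - D (\<delta> * real i) \<omega>)))"
        using 3 by eventually_elim simp
    qed measurable
  qed
  show ?thesis by (rule that[OF 1 2 3 4])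
qed

end

section \<open>Convergence of joint laws from mixed moments\<close>

lemma abs_integral_le:
  fixes f g :: "'a \<Rightarrow> real"
  assumes "integrable M f" "integrable M g" "\<And>x. x \<in> space M \<Longrightarrow> \<bar>f x\<bar> \<le> g x"
  shows "\<bar>\<integral>x. f x \<partial>M\<bar> \<le> (\<integral>x. g x \<partial>M)"
proof -
  have "\<bar>\<integral>x. f x \<partial>M\<bar> \<le> (\<integral>x. \<bar>f x\<bar> \<partial>M)" by (rule integral_abs_bound)
  also have "\<dots> \<le> (\<integral>x. g x \<partial>M)" using assms by (intro integral_mono) auto
  finally show ?thesis .
qed

text \<open>Take logarithms: for 0 \<le> x \<le> 1/2, ln (1 - x) lies between - x - 2 x^2 and - x,
  and the quadratic error n * x^2 vanishes because n * x has a limit and x tends to 0.\<close>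

lemma power_one_minus_tendsto_exp:
  fixes x :: "'i \<Rightarrow> real" and n :: "'i \<Rightarrow> nat"
  assumes x: "(x \<longlongrightarrow> 0) F" and nn: "\<forall>\<^sub>F l in F. 0 \<le> x l" and nx: "((\<lambda>l. real (n l) * x l) \<longlongrightarrow> c) F"
  shows "((\<lambda>l. (1 - x l) ^ n l) \<longlongrightarrow> exp (- c)) F"
proof -
  have small: "\<forall>\<^sub>F l in F. x l < 1/2" using x by (rule order_tendstoD) simp
  have "((\<lambda>l. real (n l) * ln (1 - x l)) \<longlongrightarrow> - c) F"
  proof (rule tendsto_sandwich)
    have "((\<lambda>l. - (real (n l) * x l) - 2 * (real (n l) * x l) * x l) \<longlongrightarrow> - c - 2 * c * 0) F"
      by (intro tendsto_intros nx x)
    then show "((\<lambda>l. - (real (n l) * x l) - 2 * (real (n l) * x l) * x l) \<longlongrightarrow> - c) F" by simp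
    show "((\<lambda>l. - (real (n l) * x l)) \<longlongrightarrow> - c) F" by (intro tendsto_intros nx)
    show "\<forall>\<^sub>F l in F. - (real (n l) * x l) - 2 * (real (n l) * x l) * x l \<le> real (n l) * ln (1 - x l)"
      using nn small
    proof eventually_elim
      case (elim l)
      then have "real (n l) * (- x l - 2 * (x l)\<^sup>2) \<le> real (n l) * ln (1 - x l)"
        by (intro mult_left_mono ln_one_minus_pos_lower_bound) auto
      then show ?case by (simp add: algebra_simps power2_eq_square)
    qed
    show "\<forall>\<^sub>F l in F. real (n l) * ln (1 - x l) \<le> - (real (n l) * x l)"
      using nn small
    proof eventually_elim
      case (elim l)
      then have "real (n l) * ln (1 - x l) \<le> real (n l) * (- x l)"
        by (intro mult_left_mono ln_one_minus_pos_upper_bound) auto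
      then show ?case by simp
    qed
  qed
  then have "((\<lambda>l. exp (real (n l) * ln (1 - x l))) \<longlongrightarrow> exp (- c)) F" by (rule tendsto_exp)
  moreover have "\<forall>\<^sub>F l in F. exp (real (n l) * ln (1 - x l)) = (1 - x l) ^ n l"
    using small by eventually_elim (simp add: exp_of_nat_mult)
  ultimately show ?thesis by (rule Lim_transform_eventually)
qed

lemma expectation_weighted_close:
  fixes W g p q :: "'a \<Rightarrow> real"
  assumes "prob_space K" and [measurable]: "W \<in> borel_measurable K" "g \<in> borel_measurable K" "p \<in>
      borel_measurable K"
    and W: "\<And>\<omega>. \<bar>W \<omega>\<bar> \<le> 1" and B: "\<And>\<omega>. \<bar>g \<omega>\<bar> \<le> B" "\<And>\<omega>. \<bar>p \<omega>\<bar> \<le> B"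
    and close: "\<And>\<omega>. \<bar>g \<omega> - p \<omega>\<bar> \<le> q \<omega>" and q: "integrable K q"
  shows "\<bar>(\<integral>\<omega>. W \<omega> * g \<omega> \<partial>K) - (\<integral>\<omega>. W \<omega> * p \<omega> \<partial>K)\<bar> \<le> (\<integral>\<omega>. q \<omega> \<partial>K)"
proof -
  interpret prob_space K by fact
  have mb: "\<bar>W \<omega> * h\<bar> \<le> c" if "\<bar>h\<bar> \<le> c" for \<omega> h c
    using mult_mono[OF W that] by (simp add: abs_mult)
  have i: "integrable K (\<lambda>\<omega>. W \<omega> * g \<omega>)" "integrable K (\<lambda>\<omega>. W \<omega> * p \<omega>)"
    by (rule integrable_bounded[OF _ mb], measurable, rule B)+
  have "\<bar>\<integral>\<omega>. W \<omega> * g \<omega> - W \<omega> * p \<omega> \<partial>K\<bar> \<le> (\<integral>\<omega>. q \<omega> \<partial>K)"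
  proof (rule abs_integral_le)
    show "\<bar>W \<omega> * g \<omega> - W \<omega> * p \<omega>\<bar> \<le> q \<omega>" for \<omega>
      unfolding right_diff_distrib[symmetric] by (rule mb[OF close])
  qed (use i q in auto)
  then show ?thesis using i by simp
qed

text \<open>Method of moments on [0, 1]: Weierstrass replaces g by a polynomial, uniformly up to e /
  3. The factor W carries the coordinates that have been treated already, or is 1.\<close>

lemma continuous_test_tendsto:
  fixes M :: "'a measure" and N :: "'b measure" and F :: "'i filter"
    and W y :: "'i \<Rightarrow> 'a \<Rightarrow> real" and W' y' :: "'b \<Rightarrow> real"
  assumes M: "prob_space M" and N: "prob_space N"
    and m: "\<And>l. W l \<in> borel_measurable M" "\<And>l. y l \<in> borel_measurable M"
      "W' \<in> borel_measurable N" "y' \<in> borel_measurable N"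
    and y01: "\<And>l \<omega>. 0 \<le> y l \<omega> \<and> y l \<omega> \<le> 1" "\<And>\<omega>. 0 \<le> y' \<omega> \<and> y' \<omega> \<le> 1"
    and Wb: "\<And>l \<omega>. \<bar>W l \<omega>\<bar> \<le> 1" "\<And>\<omega>. \<bar>W' \<omega>\<bar> \<le> 1"
    and mom: "\<And>k. ((\<lambda>l. \<integral>\<omega>. W l \<omega> * y l \<omega> ^ k \<partial>M) \<longlongrightarrow> (\<integral>\<omega>. W' \<omega> * y' \<omega> ^ k \<partial>N)) F"
    and g: "continuous_on UNIV (g :: real \<Rightarrow> real)"
  shows "((\<lambda>l. \<integral>\<omega>. W l \<omega> * g (y l \<omega>) \<partial>M) \<longlongrightarrow> (\<integral>\<omega>. W' \<omega> * g (y' \<omega>) \<partial>N)) F"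
proof (rule tendstoI)
  fix e :: real assume e: "e > 0"
  have gm [measurable]: "g \<in> borel_measurable borel" using g by (rule borel_measurable_continuous_onI)
  obtain p where p: "real_polynomial_function p" "\<And>x. x \<in> {0..1} \<Longrightarrow> \<bar>g x - p x\<bar> < e / 3"
    using Stone_Weierstrass_real_polynomial_function[of "{0..1::real}" g "e / 3"] e g
    by (auto intro: continuous_on_subset)
  obtain a n where pa: "p = (\<lambda>x. \<Sum>i\<le>n. a i * x ^ i)"
    using p(1) unfolding real_polynomial_function_iff_sum by blast
  have pm [measurable]: "p \<in> borel_measurable borel" unfolding pa by measurable
  obtain B where B: "\<And>x. x \<in> {0..1} \<Longrightarrow> \<bar>g x\<bar> \<le> B"
    using compact_imp_bounded[OF compact_continuous_image[OF continuous_on_subset[OF g] compact_Icc[of 0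
        1]]]
    unfolding bounded_iff by force
  have close: "\<bar>(\<integral>\<omega>. V \<omega> * g (x \<omega>) \<partial>K) - (\<integral>\<omega>. V \<omega> * p (x \<omega>) \<partial>K)\<bar> \<le> e / 3"
    and poly: "(\<integral>\<omega>. V \<omega> * p (x \<omega>) \<partial>K) = (\<Sum>i\<le>n. a i * (\<integral>\<omega>. V \<omega> * x \<omega> ^ i \<partial>K))"
    if K: "prob_space K" and V: "V \<in> borel_measurable K" "\<And>\<omega>. \<bar>V \<omega>\<bar> \<le> 1"
      and x: "x \<in> borel_measurable K" "\<And>\<omega>. 0 \<le> x \<omega> \<and> x \<omega> \<le> 1"
    for K :: "'c measure" and V x
  proof -
    interpret K: prob_space K by (rule K)
    note [measurable] = V(1) x(1)
    have gp: "\<bar>g (x \<omega>) - p (x \<omega>)\<bar> < e / 3" and gB: "\<bar>g (x \<omega>)\<bar> \<le> B" for \<omega>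
      using p(2)[of "x \<omega>"] B[of "x \<omega>"] x(2) by auto
    have "\<bar>(\<integral>\<omega>. V \<omega> * g (x \<omega>) \<partial>K) - (\<integral>\<omega>. V \<omega> * p (x \<omega>) \<partial>K)\<bar> \<le> (\<integral>\<omega>. e / 3 \<partial>K)"
    proof (rule expectation_weighted_close[OF K V(1) _ _ V(2), where B = "B + e / 3"])
      show "\<bar>g (x \<omega>)\<bar> \<le> B + e / 3" "\<bar>p (x \<omega>)\<bar> \<le> B + e / 3" "\<bar>g (x \<omega>) - p (x \<omega>)\<bar> \<le> e / 3" for \<omega>
        using gp[of \<omega>] gB[of \<omega>] by linarith+
    qed (use e in auto)
    then show "\<bar>(\<integral>\<omega>. V \<omega> * g (x \<omega>) \<partial>K) - (\<integral>\<omega>. V \<omega> * p (x \<omega>) \<partial>K)\<bar> \<le> e / 3" by (simp add: K.prob_space)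
    have ik: "integrable K (\<lambda>\<omega>. V \<omega> * x \<omega> ^ k)" for k
    proof (rule K.integrable_bounded[where B = 1])
      show "\<bar>V \<omega> * x \<omega> ^ k\<bar> \<le> 1" for \<omega>
        using mult_mono[OF V(2)[of \<omega>], of "\<bar>x \<omega> ^ k\<bar>" 1] x(2)[of \<omega>] by (simp add: abs_mult power_le_one)
    qed measurable
    have "(\<integral>\<omega>. V \<omega> * p (x \<omega>) \<partial>K) = (\<integral>\<omega>. (\<Sum>i\<le>n. a i * (V \<omega> * x \<omega> ^ i)) \<partial>K)"
      by (simp add: pa sum_distrib_left ac_simps)
    then show "(\<integral>\<omega>. V \<omega> * p (x \<omega>) \<partial>K) = (\<Sum>i\<le>n. a i * (\<integral>\<omega>. V \<omega> * x \<omega> ^ i \<partial>K))"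
      using ik by (subst (asm) Bochner_Integration.integral_sum) auto
  qed
  have "((\<lambda>l. \<integral>\<omega>. W l \<omega> * p (y l \<omega>) \<partial>M) \<longlongrightarrow> (\<integral>\<omega>. W' \<omega> * p (y' \<omega>) \<partial>N)) F"
    unfolding poly[OF M m(1) Wb(1) m(2) y01(1)] poly[OF N m(3) Wb(2) m(4) y01(2)]
    by (intro tendsto_intros mom)
  then have "\<forall>\<^sub>F l in F. dist (\<integral>\<omega>. W l \<omega> * p (y l \<omega>) \<partial>M) (\<integral>\<omega>. W' \<omega> * p (y' \<omega>) \<partial>N) < e / 3"
    using e by (intro tendstoD) auto
  then show "\<forall>\<^sub>F l in F. dist (\<integral>\<omega>. W l \<omega> * g (y l \<omega>) \<partial>M) (\<integral>\<omega>. W' \<omega> * g (y' \<omega>) \<partial>N) < e"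
  proof eventually_elim
    case (elim l)
    then show ?case using close[OF M m(1)[of l] Wb(1)[of l] m(2)[of l] y01(1)[of l]]
        close[OF N m(3) Wb(2) m(4) y01(2)] unfolding dist_real_def by linarith
  qed
qed

text \<open>The indicator of y \<ge> e is approximated by continuous ramps. The error is at most a
  tent around e, whose mean passes to the limit and is small there because y' has no atom at
  e.\<close>

lemma threshold_test_tendsto:
  fixes M :: "'a measure" and N :: "'b measure" and F :: "'i filter"
    and W y :: "'i \<Rightarrow> 'a \<Rightarrow> real" and W' y' :: "'b \<Rightarrow> real"
  assumes M: "prob_space M" and N: "prob_space N"
    and m [measurable]: "\<And>l. W l \<in> borel_measurable M" "\<And>l. y l \<in> borel_measurable M"
      "W' \<in> borel_measurable N" "y' \<in> borel_measurable N"
    and y01: "\<And>l \<omega>. 0 \<le> y l \<omega> \<and> y l \<omega> \<le> 1" "\<And>\<omega>. 0 \<le> y' \<omega> \<and> y' \<omega> \<le> 1"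
    and Wb: "\<And>l \<omega>. \<bar>W l \<omega>\<bar> \<le> 1" "\<And>\<omega>. \<bar>W' \<omega>\<bar> \<le> 1"
    and mom: "\<And>k. ((\<lambda>l. \<integral>\<omega>. W l \<omega> * y l \<omega> ^ k \<partial>M) \<longlongrightarrow> (\<integral>\<omega>. W' \<omega> * y' \<omega> ^ k \<partial>N)) F"
    and mom1: "\<And>k. ((\<lambda>l. \<integral>\<omega>. y l \<omega> ^ k \<partial>M) \<longlongrightarrow> (\<integral>\<omega>. y' \<omega> ^ k \<partial>N)) F"
    and atom: "measure N {\<omega>\<in>space N. y' \<omega> = e} = 0"
  shows "((\<lambda>l. \<integral>\<omega>. W l \<omega> * of_bool (y l \<omega> \<ge> e) \<partial>M) \<longlongrightarrow> (\<integral>\<omega>. W' \<omega> * of_bool (y' \<omega> \<ge> e) \<partial>N)) F"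
proof -
  interpret M: prob_space M by (rule M)
  interpret N: prob_space N by (rule N)
  \<comment> \<open>A ramp that reaches 1 at e with slope k + 1, and a tent at e of the same slope
    that dominates its distance from the indicator.\<close>
  define g where "g k x = min 1 (max 0 (1 + (x - e) * real (Suc k)))" for k x
  define q where "q k x = max 0 (1 - \<bar>x - e\<bar> * real (Suc k))" for k x
  have gc: "continuous_on UNIV (g k)" and qc: "continuous_on UNIV (q k)" for k
    unfolding g_def q_def by (intro continuous_intros)+
  have [measurable]: "g k \<in> borel_measurable borel" "q k \<in> borel_measurable borel" for k
    using gc qc by (auto intro: borel_measurable_continuous_onI)
  have gq: "\<bar>of_bool (x \<ge> e) - g k x\<bar> \<le> q k x" for k x
  proof (cases "x \<ge> e")
    case True
    then have "(x - e) * real (Suc k) \<ge> 0" by simp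
    then show ?thesis using True by (simp add: g_def q_def)
  next
    case False
    then have "\<bar>x - e\<bar> * real (Suc k) = - ((x - e) * real (Suc k))"
      by (subst abs_of_neg) (auto simp: algebra_simps)
    moreover have "(x - e) * real (Suc k) \<le> 0" using False by (intro mult_nonpos_nonneg) auto
    ultimately show ?thesis using False by (simp add: g_def q_def)
  qed
  have g1: "\<bar>g k x\<bar> \<le> 1" and q1: "\<bar>q k x\<bar> \<le> 1" for k x
    by (auto simp: g_def q_def)
  have qN: "(\<lambda>k. \<integral>\<omega>. q k (y' \<omega>) \<partial>N) \<longlonglongrightarrow> (\<integral>\<omega>. of_bool (y' \<omega> = e) \<partial>N)"
  proof (rule integral_dominated_convergence[where w = "\<lambda>_. 1"])
    show "AE \<omega> in N. (\<lambda>k. q k (y' \<omega>)) \<longlonglongrightarrow> of_bool (y' \<omega> = e)"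
    proof (rule AE_I2)
      fix \<omega>
      show "(\<lambda>k. q k (y' \<omega>)) \<longlonglongrightarrow> of_bool (y' \<omega> = e)"
      proof (cases "y' \<omega> = e")
        case False
        then have c: "\<bar>y' \<omega> - e\<bar> > 0" by simp
        obtain K :: nat where K: "1 / \<bar>y' \<omega> - e\<bar> < real K" using reals_Archimedean2 by blast
        have "q k (y' \<omega>) = 0" if "k \<ge> K" for k
        proof -
          have "1 / \<bar>y' \<omega> - e\<bar> \<le> real (Suc k)" using K that by simp
          then have "1 \<le> \<bar>y' \<omega> - e\<bar> * real (Suc k)" using c by (simp add: field_simps)
          then show ?thesis by (simp add: q_def)
        qed
        then have "\<forall>\<^sub>F k in sequentially. q k (y' \<omega>) = 0" unfolding eventually_sequentially by blast
        then show ?thesis using False by (simp add: tendsto_eventually)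
      qed (simp add: q_def)
    qed
  qed (use q1 in auto)
  moreover have "(\<integral>\<omega>. of_bool (y' \<omega> = e) \<partial>N) = (0::real)"
  proof -
    have "(\<integral>\<omega>. of_bool (y' \<omega> = e) \<partial>N) = N.prob {\<omega>\<in>space N. y' \<omega> = e}"
      by (rule measure_Collect_eq_integral[symmetric])
    then show ?thesis using atom by simp
  qed
  ultimately have qN: "(\<lambda>k. \<integral>\<omega>. q k (y' \<omega>) \<partial>N) \<longlonglongrightarrow> 0" by simp
  have close: "\<bar>(\<integral>\<omega>. U \<omega> * of_bool (x \<omega> \<ge> e) \<partial>K) - (\<integral>\<omega>. U \<omega> * g k (x \<omega>) \<partial>K)\<bar> \<le> (\<integral>\<omega>. q k (x \<omega>) \<partial>K)"
    if K: "prob_space K" and U: "U \<in> borel_measurable K" "\<And>\<omega>. \<bar>U \<omega>\<bar> \<le> 1" and x [measurable]: "x \<in>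
        borel_measurable K"
    for K :: "'c measure" and U x k
  proof (rule expectation_weighted_close[OF K U(1) _ _ U(2), where B = 1])
    show "integrable K (\<lambda>\<omega>. q k (x \<omega>))"
      using q1 by (intro prob_space.integrable_bounded[OF K, where B = 1]) auto
  qed (use gq g1 in auto)
  show ?thesis
  proof (rule tendstoI)
    fix \<epsilon> :: real assume \<epsilon>: "\<epsilon> > 0"
    obtain k where k: "(\<integral>\<omega>. q k (y' \<omega>) \<partial>N) < \<epsilon> / 3"
      using order_tendstoD(2)[OF qN, of "\<epsilon> / 3"] \<epsilon> by (auto simp: eventually_sequentially)
    \<comment> \<open>The tent bounds the error uniformly in the weight, so its mean is taken
      without W; this is what \<open>mom1\<close> is for.\<close>
    have "((\<lambda>l. \<integral>\<omega>. 1 * q k (y l \<omega>) \<partial>M) \<longlongrightarrow> (\<integral>\<omega>. 1 * q k (y' \<omega>) \<partial>N)) F"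
      by (rule continuous_test_tendsto[where W = "\<lambda>_ _. 1" and W' = "\<lambda>_. 1", OF M N _ m(2) _ m(4) y01])
        (use mom1 qc in auto)
    then have 1: "\<forall>\<^sub>F l in F. (\<integral>\<omega>. q k (y l \<omega>) \<partial>M) < \<epsilon> / 3"
      using k by (intro order_tendstoD(2)) auto
    have "((\<lambda>l. \<integral>\<omega>. W l \<omega> * g k (y l \<omega>) \<partial>M) \<longlongrightarrow> (\<integral>\<omega>. W' \<omega> * g k (y' \<omega>) \<partial>N)) F"
      by (rule continuous_test_tendsto[OF M N m y01 Wb mom gc])
    then have 2: "\<forall>\<^sub>F l in F. dist (\<integral>\<omega>. W l \<omega> * g k (y l \<omega>) \<partial>M) (\<integral>\<omega>. W' \<omega> * g k (y' \<omega>) \<partial>N) < \<epsilon> / 3"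
      using \<epsilon> by (intro tendstoD) auto
    show "\<forall>\<^sub>F l in F. dist (\<integral>\<omega>. W l \<omega> * of_bool (y l \<omega> \<ge> e) \<partial>M) (\<integral>\<omega>. W' \<omega> * of_bool (y' \<omega> \<ge> e) \<partial>N) < \<epsilon>"
      using 1 2
    proof eventually_elim
      case (elim l)
      then show ?case using k close[OF M m(1)[of l] Wb(1)[of l] m(2)[of l], of k]
          close[OF N m(3) Wb(2) m(4), of k] unfolding dist_real_def by linarith
    qed
  qed
qed

section \<open>Joint laws through finitely many thresholds\<close>

definition tests :: "(nat \<times> real \<times> bool) list \<Rightarrow> (nat \<Rightarrow> real) \<Rightarrow> bool" where
  "tests ts y \<longleftrightarrow> (\<forall>(i, e, b)\<in>set ts. (y i \<ge> e) = b)"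

lemma tests_Nil [simp]: "tests [] y"
  by (simp add: tests_def)

lemma tests_Cons: "tests ((i, e, b) # ts) y \<longleftrightarrow> (y i \<ge> e) = b \<and> tests ts y"
  by (auto simp: tests_def)

lemma pred_tests:
  assumes "\<And>i. (\<lambda>\<omega>. y \<omega> i) \<in> borel_measurable M"
  shows "Measurable.pred M (\<lambda>\<omega>. tests ts (y \<omega>))"
proof (induction ts)
  case (Cons t ts)
  obtain i e b where t: "t = (i, e, b)" by (cases t)
  note [measurable] = Cons assms
  show ?case unfolding t tests_Cons by measurable
qed simp

text \<open>The thresholds are introduced one at a time: each new indicator is approximated by
  polynomials in the corresponding coordinate, which only change the exponents \<open>n\<close>.\<close>

lemma tests_tendsto:
  fixes M :: "'a measure" and N :: "'b measure" and F :: "'i filter"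
    and y :: "'i \<Rightarrow> 'a \<Rightarrow> nat \<Rightarrow> real" and y' :: "'b \<Rightarrow> nat \<Rightarrow> real"
  assumes M: "prob_space M" and N: "prob_space N"
    and m: "\<And>l i. (\<lambda>\<omega>. y l \<omega> i) \<in> borel_measurable M" "\<And>i. (\<lambda>\<omega>. y' \<omega> i) \<in> borel_measurable N"
    and y01: "\<And>l \<omega> i. 0 \<le> y l \<omega> i \<and> y l \<omega> i \<le> 1" "\<And>\<omega> i. 0 \<le> y' \<omega> i \<and> y' \<omega> i \<le> 1"
    and mom: "\<And>n :: nat \<Rightarrow> nat. ((\<lambda>l. \<integral>\<omega>. (\<Prod>i\<le>Q. y l \<omega> i ^ n i) \<partial>M) \<longlongrightarrow> (\<integral>\<omega>. (\<Prod>i\<le>Q. y' \<omega> i ^ n i) \<partial>N)) F"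
    and ts: "\<And>i e b. (i, e, b) \<in> set ts \<Longrightarrow> i \<le> Q \<and> measure N {\<omega>\<in>space N. y' \<omega> i = e} = 0"
  shows "((\<lambda>l. \<integral>\<omega>. of_bool (tests ts (y l \<omega>)) * (\<Prod>i\<le>Q. y l \<omega> i ^ n i) \<partial>M) \<longlongrightarrow>
     (\<integral>\<omega>. of_bool (tests ts (y' \<omega>)) * (\<Prod>i\<le>Q. y' \<omega> i ^ n i) \<partial>N)) F"
  using ts
proof (induction ts arbitrary: n)
  case Nil
  then show ?case using mom[of n] by simp
next
  case (Cons t ts)
  interpret M: prob_space M by (rule M)
  interpret N: prob_space N by (rule N)
  obtain j e b where t: "t = (j, e, b)" by (cases t)
  have j: "j \<le> Q" and atom: "measure N {\<omega>\<in>space N. y' \<omega> j = e} = 0"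
    using Cons.prems[of j e b] t by auto
  note [measurable] = m
  have [measurable]: "Measurable.pred M (\<lambda>\<omega>. tests ts (y l \<omega>))" "Measurable.pred N (\<lambda>\<omega>. tests ts (y' \<omega>))"
      for l
    by (intro pred_tests m)+
  have IH: "((\<lambda>l. \<integral>\<omega>. of_bool (tests ts (y l \<omega>)) * (\<Prod>i\<le>Q. y l \<omega> i ^ n' i) \<partial>M) \<longlongrightarrow>
     (\<integral>\<omega>. of_bool (tests ts (y' \<omega>)) * (\<Prod>i\<le>Q. y' \<omega> i ^ n' i) \<partial>N)) F" for n'
    by (rule Cons.IH) (use Cons.prems in auto)
  \<comment> \<open>A power of coordinate j is absorbed into the exponents, so the induction
    hypothesis for arbitrary exponents supplies the weighted moments.\<close>
  have upd: "(\<Prod>i\<le>Q. x i ^ n' i) * x j ^ k = (\<Prod>i\<le>Q. x i ^ (n'(j := n' j + k)) i)" for x :: "nat \<Rightarrow> real" and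
      n' k
  proof -
    have *: "(\<Prod>i\<le>Q. f i) = f j * (\<Prod>i\<in>{..Q} - {j}. f i)" for f :: "nat \<Rightarrow> real"
      using j by (intro prod.remove) auto
    have "(\<Prod>i\<in>{..Q} - {j}. x i ^ (n'(j := n' j + k)) i) = (\<Prod>i\<in>{..Q} - {j}. x i ^ n' i)"
      by (rule prod.cong) auto
    then show ?thesis
      by (subst (1 2) *) (simp add: power_add)
  qed
  let ?W = "\<lambda>l \<omega>. of_bool (tests ts (y l \<omega>)) * (\<Prod>i\<le>Q. y l \<omega> i ^ n i) :: real"
  let ?W' = "\<lambda>\<omega>. of_bool (tests ts (y' \<omega>)) * (\<Prod>i\<le>Q. y' \<omega> i ^ n i) :: real"
  have P1: "\<bar>of_bool p * (\<Prod>i\<le>Q. x i ^ n i)\<bar> \<le> 1" if "\<And>i. 0 \<le> x i \<and> x i \<le> (1::real)" for x p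
    using that by (auto simp: of_bool_def abs_prod power_abs intro!: prod_le_1 power_le_one)
  have Wb: "\<bar>?W l \<omega>\<bar> \<le> 1" "\<bar>?W' \<omega>'\<bar> \<le> 1" for l \<omega> \<omega>'
    using y01 by (intro P1; blast)+
  have [measurable]: "(\<lambda>\<omega>. \<Prod>i\<le>Q. y l \<omega> i ^ n i) \<in> borel_measurable M"
      "(\<lambda>\<omega>. \<Prod>i\<le>Q. y' \<omega> i ^ n i) \<in> borel_measurable N" for l
    by (intro borel_measurable_prod borel_measurable_power m)+
  have mW: "?W l \<in> borel_measurable M" for l by measurable
  have mW': "?W' \<in> borel_measurable N" by measurable
  have T: "((\<lambda>l. \<integral>\<omega>. ?W l \<omega> * of_bool (y l \<omega> j \<ge> e) \<partial>M) \<longlongrightarrow> (\<integral>\<omega>. ?W' \<omega> * of_bool (y' \<omega> j \<ge> e) \<partial>N)) F"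
  proof (rule threshold_test_tendsto[OF M N mW m(1) mW' m(2) y01 Wb _ _ atom])
    show "((\<lambda>l. \<integral>\<omega>. ?W l \<omega> * y l \<omega> j ^ k \<partial>M) \<longlongrightarrow> (\<integral>\<omega>. ?W' \<omega> * y' \<omega> j ^ k \<partial>N)) F" for k
      unfolding mult.assoc upd by (rule IH)
    show "((\<lambda>l. \<integral>\<omega>. y l \<omega> j ^ k \<partial>M) \<longlongrightarrow> (\<integral>\<omega>. y' \<omega> j ^ k \<partial>N)) F" for k
      using mom[of "(\<lambda>_. 0)(j := 0 + k)"] unfolding upd[of _ "\<lambda>_. 0" k, symmetric] by simp
  qed
  show ?case
  proof (cases b)
    case True
    have "of_bool (tests (t # ts) x) * c = of_bool (tests ts x) * c * of_bool (x j \<ge> e)" for x and c :: real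
      using True by (simp add: t tests_Cons of_bool_conj)
    then show ?thesis using T by (simp only:)
  next
    case False
    \<comment> \<open>A negated test is the weight without the test minus the weight with
      it.\<close>
    have eq: "of_bool (tests (t # ts) x) * c = of_bool (tests ts x) * c - of_bool (tests ts x) * c * of_bool
        (x j \<ge> e)"
      for x and c :: real
      using False by (auto simp: t tests_Cons of_bool_def)
    have iM: "integrable M (?W l)" "integrable M (\<lambda>\<omega>. ?W l \<omega> * of_bool (y l \<omega> j \<ge> e))" for l
      using Wb by (auto intro!: M.integrable_const_bound[where B=1] simp: abs_mult of_bool_def)
    have iN: "integrable N ?W'" "integrable N (\<lambda>\<omega>. ?W' \<omega> * of_bool (y' \<omega> j \<ge> e))"
      using Wb by (auto intro!: N.integrable_const_bound[where B=1] simp: abs_mult of_bool_def)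
    have "((\<lambda>l. (\<integral>\<omega>. ?W l \<omega> \<partial>M) - (\<integral>\<omega>. ?W l \<omega> * of_bool (y l \<omega> j \<ge> e) \<partial>M)) \<longlongrightarrow>
       (\<integral>\<omega>. ?W' \<omega> \<partial>N) - (\<integral>\<omega>. ?W' \<omega> * of_bool (y' \<omega> j \<ge> e) \<partial>N)) F"
      by (intro tendsto_diff IH T)
    then show ?thesis
      unfolding eq by (subst (1 2) Bochner_Integration.integral_diff) (use iM iN in auto)
  qed
qed

lemma prob_tests_tendsto:
  fixes M :: "'a measure" and N :: "'b measure" and F :: "'i filter"
    and y :: "'i \<Rightarrow> 'a \<Rightarrow> nat \<Rightarrow> real" and y' :: "'b \<Rightarrow> nat \<Rightarrow> real"
  assumes M: "prob_space M" and N: "prob_space N"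
    and m: "\<And>l i. (\<lambda>\<omega>. y l \<omega> i) \<in> borel_measurable M" "\<And>i. (\<lambda>\<omega>. y' \<omega> i) \<in> borel_measurable N"
    and y01: "\<And>l \<omega> i. 0 \<le> y l \<omega> i \<and> y l \<omega> i \<le> 1" "\<And>\<omega> i. 0 \<le> y' \<omega> i \<and> y' \<omega> i \<le> 1"
    and mom: "\<And>n :: nat \<Rightarrow> nat. ((\<lambda>l. \<integral>\<omega>. (\<Prod>i\<le>Q. y l \<omega> i ^ n i) \<partial>M) \<longlongrightarrow> (\<integral>\<omega>. (\<Prod>i\<le>Q. y' \<omega> i ^ n i) \<partial>N)) F"
    and ts: "\<And>i e b. (i, e, b) \<in> set ts \<Longrightarrow> i \<le> Q \<and> measure N {\<omega>\<in>space N. y' \<omega> i = e} = 0"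
  shows "((\<lambda>l. measure M {\<omega>\<in>space M. tests ts (y l \<omega>)}) \<longlongrightarrow> measure N {\<omega>\<in>space N. tests ts (y' \<omega>)}) F"
  unfolding measure_Collect_eq_integral
  using tests_tendsto[OF M N m y01 mom ts, where n = "\<lambda>_. 0"] by simp

section \<open>Monotone paths in the Skorokhod space\<close>

text \<open>Nonnegativity is included so that \<open>nat\<close> in \<open>grid_code\<close> loses
  no information.\<close>

definition increasing_paths :: "(real \<Rightarrow> real) set" where
  "increasing_paths = {y \<in> cadlag_paths. mono_on {0..} y \<and> (\<forall>t\<ge>0. 0 \<le> y t)}"

text \<open>Values at the dyadic times \<open>p / 2 ^ m \<le> m\<close>, rounded down to multiples of \<open>c / 2 ^ m\<close>; time 0
  is left out.\<close>

definition grid_code :: "real \<Rightarrow> nat \<Rightarrow> (real \<Rightarrow> real) \<Rightarrow> nat list" where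
  "grid_code c m y = map (\<lambda>p. nat \<lfloor>y (real p / 2 ^ m) * 2 ^ m / c\<rfloor>) [1..<m * 2 ^ m + 1]"

lemma grid_code_eqD:
  assumes eq: "grid_code c m y = grid_code c m z" and p: "1 \<le> p" "p \<le> m * 2 ^ m"
    and nn: "0 \<le> y (real p / 2 ^ m)" "0 \<le> z (real p / 2 ^ m)" and c: "c > 0"
  shows "\<bar>y (real p / 2 ^ m) - z (real p / 2 ^ m)\<bar> < c / 2 ^ m"
proof -
  define a b where "a = y (real p / 2 ^ m) * 2 ^ m / c" and "b = z (real p / 2 ^ m) * 2 ^ m / c"
  have "p \<in> set [1..<m * 2 ^ m + 1]"
    unfolding set_upt atLeastLessThan_iff using p by linarith
  then have "nat \<lfloor>a\<rfloor> = nat \<lfloor>b\<rfloor>"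
    using eq unfolding grid_code_def map_eq_conv a_def b_def by blast
  moreover have "0 \<le> a" "0 \<le> b" using nn c by (auto simp: a_def b_def)
  ultimately have "\<lfloor>a\<rfloor> = \<lfloor>b\<rfloor>" by (simp add: eq_nat_nat_iff)
  then have "\<bar>a - b\<bar> < 1" by linarith
  moreover have "y (real p / 2 ^ m) - z (real p / 2 ^ m) = (a - b) * (c / 2 ^ m)"
    using c by (simp add: a_def b_def field_simps)
  ultimately have "\<bar>y (real p / 2 ^ m) - z (real p / 2 ^ m)\<bar> = \<bar>a - b\<bar> * (c / 2 ^ m)" and "\<bar>a - b\<bar> < 1"
    using c by (simp_all only: abs_mult) (simp add: abs_mult)
  then show ?thesis using mult_strict_right_mono[of "\<bar>a - b\<bar>" 1 "c / 2 ^ m"] c by simp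
qed

lemma id_time_change: "(\<lambda>t. t) \<in> time_changes"
  by (auto simp: time_changes_def strict_mono_on_def)

text \<open>y is increasing and z continuous: between neighbouring grid times y is squeezed by its
  values there, which agree with those of z up to one rounding step. The identity can therefore
  serve as time change.\<close>

lemma grid_code_nbhd:
  assumes c: "c > 0" and z: "z \<in> increasing_paths" "continuous_on {0..} z" "z 0 = 0" and T: "T > 0" and e:
      "e > 0"
  shows "\<exists>m0. \<forall>m\<ge>m0. \<forall>y\<in>increasing_paths. grid_code c m y = grid_code c m z \<longrightarrow> y \<in> skorokhod_nbhd z T e"
proof -
  have "uniformly_continuous_on {0..T + 1} z"
    by (rule compact_uniformly_continuous[OF continuous_on_subset[OF z(2)]]) auto
  moreover have "e / 3 > 0" using e by simp
  ultimately have "\<exists>\<eta>>0. \<forall>t\<in>{0..T+1}. \<forall>s\<in>{0..T+1}. dist s t < \<eta> \<longrightarrow> dist (z s) (z t) < e / 3"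
    unfolding uniformly_continuous_on_def by blast
  then obtain \<eta> where \<eta>: "\<eta> > 0"
    "\<And>s t. s \<in> {0..T+1} \<Longrightarrow> t \<in> {0..T+1} \<Longrightarrow> dist s t < \<eta> \<Longrightarrow> dist (z s) (z t) < e / 3"
    by blast
  \<comment> \<open>The grid must reach beyond T + 1, be finer than \<eta> in time and finer than e
    / 3 in height; the last two follow from 2 ^ m > m.\<close>
  obtain m0 :: nat where m0: "real m0 > max (T + 1) (max (1 / \<eta>) (3 * c / e))"
    using reals_Archimedean2 by blast
  show ?thesis
  proof (intro exI[of _ m0] allI impI ballI)
    fix m y assume m: "m0 \<le> m" and y: "y \<in> increasing_paths" and eq: "grid_code c m y = grid_code c m z"
    have mm: "real m > T + 1" "real m > 1 / \<eta>" "real m > 3 * c / e" using m0 m by auto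
    have p2: "(2::real) ^ m > real m" by (rule of_nat_less_two_power)
    have h1: "1 / 2 ^ m < \<eta>"
    proof -
      have "1 / \<eta> < 2 ^ m" using mm p2 by linarith
      then show ?thesis using \<eta>(1) by (simp add: field_simps)
    qed
    have h2: "c / 2 ^ m < e / 3"
    proof -
      have "3 * c / e < 2 ^ m" using mm p2 by linarith
      then show ?thesis using e by (simp add: field_simps)
    qed
    have h3: "1 / 2 ^ m < (1::real)"
    proof -
      have "1 < (2::real) ^ m" using mm p2 T by linarith
      then show ?thesis by simp
    qed
    have ymono: "y s \<le> y t" if "0 \<le> s" "s \<le> t" for s t
    proof -
      have "mono_on {0..} y" using y by (simp add: increasing_paths_def)
      then show ?thesis using mono_onD[of "{0..}" y s t] that by simp
    qed
    have ynn: "0 \<le> y t" if "0 \<le> t" for t using y that by (auto simp: increasing_paths_def)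
    have znn: "0 \<le> z t" if "0 \<le> t" for t using z(1) that by (auto simp: increasing_paths_def)
    have close: "\<bar>y t - z t\<bar> < e" if t: "t \<in> {0..T}" for t
    proof -
      define p where "p = nat \<lfloor>t * 2 ^ m\<rfloor>"
      have p: "real p \<le> t * 2 ^ m" "t * 2 ^ m < real p + 1"
        using t by (auto simp: p_def)
      define a b where "a = real p / 2 ^ m" and "b = real (Suc p) / 2 ^ m"
      have a: "0 \<le> a" "a \<le> t" and b: "t < b" using p by (auto simp: a_def b_def field_simps)
      have ba: "b = a + 1 / 2 ^ m" by (simp add: a_def b_def add_divide_distrib)
      have bT: "b \<le> T + 1" using a ba h3 t unfolding atLeastAtMost_iff by linarith
      have "real (Suc p) = b * 2 ^ m" by (simp add: b_def)
      also have "\<dots> \<le> real m * 2 ^ m" using bT mm by (intro mult_right_mono) auto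
      finally have "real (Suc p) \<le> real (m * 2 ^ m)" by simp
      then have pm: "Suc p \<le> m * 2 ^ m" unfolding of_nat_le_iff .
      have zb: "\<bar>z b - z t\<bar> < e / 3"
        using \<eta>(2)[of b t] a b ba bT t h1 by (auto simp: dist_real_def)
      have za: "\<bar>z a - z t\<bar> < e / 3"
        using \<eta>(2)[of a t] a b ba bT t h1 by (auto simp: dist_real_def)
      have "\<bar>y b - z b\<bar> < c / 2 ^ m"
        unfolding b_def by (rule grid_code_eqD[OF eq _ pm _ _ c]) (auto intro: ynn znn)
      moreover have "y t \<le> y b" using b t by (intro ymono) auto
      ultimately have up: "y t - z t < e" using zb h2 by linarith
      have lo: "z t - y t < e"
      proof (cases "p = 0")
        \<comment> \<open>Time 0 is not coded; there z 0 = 0 and y \<ge> 0 give the lower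
          bound.\<close>
        case True
        then have "a = 0" by (simp add: a_def)
        then show ?thesis using za z(3) ynn[of t] t e by auto
      next
        case False
        then have "\<bar>y a - z a\<bar> < c / 2 ^ m"
          unfolding a_def using pm by (intro grid_code_eqD[OF eq _ _ _ _ c]) (auto intro: ynn znn)
        moreover have "y a \<le> y t" using a by (intro ymono) auto
        ultimately show ?thesis using za h2 by linarith
      qed
      show ?thesis using up lo by linarith
    qed
    have "\<exists>h\<in>time_changes. (\<forall>t\<ge>0. \<bar>h t - t\<bar> < e) \<and> (\<forall>t\<in>{0..T}. \<bar>y (h t) - z t\<bar> < e)"
    proof (rule bexI[OF _ id_time_change], intro conjI ballI allI impI)
      show "\<bar>y t - z t\<bar> < e" if "t \<in> {0..T}" for t by (rule close[OF that])
    qed (use e in simp)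
    moreover have "y \<in> cadlag_paths" using y by (simp add: increasing_paths_def)
    ultimately show "y \<in> skorokhod_nbhd z T e" unfolding skorokhod_nbhd_def by blast
  qed
qed

lemma grid_code_open:
  assumes c: "c > 0" and z: "z \<in> increasing_paths" "continuous_on {0..} z" "z 0 = 0"
    and U: "openin skorokhod_topology U" "z \<in> U"
  shows "\<exists>m0. \<forall>m\<ge>m0. \<forall>y\<in>increasing_paths. grid_code c m y = grid_code c m z \<longrightarrow> y \<in> U"
proof -
  obtain T e where "T > 0" "e > 0" "skorokhod_nbhd z T e \<subseteq> U"
    using U unfolding openin_skorokhod skorokhod_open_def by blast
  then show ?thesis using grid_code_nbhd[OF c z, of T e] by blast
qed

text \<open>By \<open>grid_code_open\<close>, Z lies in U iff at some level m its code forces every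
  increasing path with that code into U. So the preimage of U is a countable union of code
  events.\<close>

lemma continuous_path_vimage_sets:
  assumes c: "c > 0" and Z: "\<And>\<omega>. Z \<omega> \<in> increasing_paths" "\<And>\<omega>. continuous_on {0..} (Z \<omega>)" "\<And>\<omega>. Z \<omega> 0 = 0"
    and m: "\<And>m. (\<lambda>\<omega>. grid_code c m (Z \<omega>)) \<in> measurable N (count_space UNIV)"
    and U: "openin skorokhod_topology U"
  shows "Z -` U \<inter> space N \<in> sets N"
proof -
  define C where "C m = {q. \<forall>y\<in>increasing_paths. grid_code c m y = q \<longrightarrow> y \<in> U}" for m
  have "Z \<omega> \<in> U \<longleftrightarrow> (\<exists>m. grid_code c m (Z \<omega>) \<in> C m)" for \<omega>
  proof
    assume "Z \<omega> \<in> U"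
    from grid_code_open[OF c Z U this] show "\<exists>m. grid_code c m (Z \<omega>) \<in> C m"
      by (auto simp: C_def)
  next
    assume "\<exists>m. grid_code c m (Z \<omega>) \<in> C m"
    then show "Z \<omega> \<in> U" using Z(1) by (auto simp: C_def)
  qed
  then have "Z -` U \<inter> space N = (\<Union>m. (\<lambda>\<omega>. grid_code c m (Z \<omega>)) -` C m \<inter> space N)" by auto
  also have "\<dots> \<in> sets N"
    by (intro sets.countable_UN image_subsetI measurable_sets[OF m]) auto
  finally show ?thesis .
qed

text \<open>On a cell where f oscillates little, f is nearly a function of the code. Finitely many
  such cells carry almost all of the limit law, and convergence of their probabilities forces almost
  all mass of X l into them; this takes the place of tightness.\<close>

lemma grid_code_weak_convergence:
  fixes M :: "'a measure" and N :: "'b measure" and F :: "'i filter"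
    and X :: "'i \<Rightarrow> 'a \<Rightarrow> real \<Rightarrow> real" and Z :: "'b \<Rightarrow> real \<Rightarrow> real"
  assumes M: "prob_space M" and N: "prob_space N" and c: "c > 0"
    and X: "\<forall>\<^sub>F l in F. \<forall>\<omega>. X l \<omega> \<in> increasing_paths"
    and Z: "\<And>\<omega>. Z \<omega> \<in> increasing_paths" "\<And>\<omega>. continuous_on {0..} (Z \<omega>)" "\<And>\<omega>. Z \<omega> 0 = 0"
    and mZ: "\<And>m. (\<lambda>\<omega>. grid_code c m (Z \<omega>)) \<in> measurable N (count_space UNIV)"
    and mX: "\<And>m. \<forall>\<^sub>F l in F. (\<lambda>\<omega>. grid_code c m (X l \<omega>)) \<in> measurable M (count_space UNIV)"
    and conv: "\<And>m q. ((\<lambda>l. measure M {\<omega>\<in>space M. grid_code c m (X l \<omega>) = q}) \<longlongrightarrow>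
        measure N {\<omega>\<in>space N. grid_code c m (Z \<omega>) = q}) F"
    and f: "continuous_map skorokhod_topology euclideanreal f" "bounded (f ` cadlag_paths)"
    and mfX: "\<forall>\<^sub>F l in F. (\<lambda>\<omega>. f (X l \<omega>)) \<in> borel_measurable M"
    and mfZ: "(\<lambda>\<omega>. f (Z \<omega>)) \<in> borel_measurable N"
  shows "((\<lambda>l. \<integral>\<omega>. f (X l \<omega>) \<partial>M) \<longlongrightarrow> (\<integral>\<omega>. f (Z \<omega>) \<partial>N)) F"
proof (rule tendstoI)
  fix \<epsilon> :: real assume \<epsilon>: "\<epsilon> > 0"
  interpret M: prob_space M by (rule M)
  interpret N: prob_space N by (rule N)
  obtain B0 where B0: "\<And>y. y \<in> cadlag_paths \<Longrightarrow> \<bar>f y\<bar> \<le> B0"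
    using f(2) unfolding bounded_iff by auto
  define B where "B = max 1 B0"
  have B1: "B \<ge> 1" by (simp add: B_def)
  have B: "\<bar>f y\<bar> \<le> B" if "y \<in> increasing_paths" for y
    using B0[of y] that by (auto simp: B_def increasing_paths_def)
  \<comment> \<open>The errors add up to less than 5 * e + 2 * (B * e), which is at most 7 * (B * e)
    as B \<ge> 1; the factor 16 leaves room.\<close>
  define e where "e = \<epsilon> / (16 * B)"
  have e: "e > 0" using \<epsilon> B1 by (simp add: e_def)
  \<comment> \<open>Codes whose cell is so small that f varies by at most 2 * e on it. By
    \<open>grid_code_open\<close> the code of each path Z \<omega> is eventually of this
    kind.\<close>
  define G where "G m = {q. \<forall>y\<in>increasing_paths. \<forall>y'\<in>increasing_paths. grid_code c m y = q \<longrightarrow> grid_code c m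
      y' = q \<longrightarrow> \<bar>f y - f y'\<bar> \<le> 2 * e}" for m
  have Gev: "\<exists>m0. \<forall>m\<ge>m0. grid_code c m (Z \<omega>) \<in> G m" for \<omega>
  proof -
    let ?U = "{y \<in> topspace skorokhod_topology. f y \<in> {f (Z \<omega>) - e <..< f (Z \<omega>) + e}}"
    have "openin skorokhod_topology ?U"
      by (rule openin_continuous_map_preimage[OF f(1)]) (auto simp: open_openin[symmetric])
    moreover have "Z \<omega> \<in> ?U" using Z(1)[of \<omega>] e by (simp add: topspace_skorokhod increasing_paths_def)
    ultimately have "\<exists>m0. \<forall>m\<ge>m0. \<forall>y\<in>increasing_paths. grid_code c m y = grid_code c m (Z \<omega>) \<longrightarrow> y \<in> ?U"
      by (rule grid_code_open[OF c Z])
    then obtain m0 where m0: "\<And>m y. m \<ge> m0 \<Longrightarrow> y \<in> increasing_paths \<Longrightarrow> grid_code c m y = grid_code c m (Z \<omega>) \<Longrightarrow>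
        y \<in> ?U"
      by blast
    have "grid_code c m (Z \<omega>) \<in> G m" if "m \<ge> m0" for m
      unfolding G_def
    proof (intro CollectI ballI impI)
      fix y y' assume y: "y \<in> increasing_paths" "y' \<in> increasing_paths" "grid_code c m y = grid_code c m (Z
          \<omega>)" "grid_code c m y' = grid_code c m (Z \<omega>)"
      then show "\<bar>f y - f y'\<bar> \<le> 2 * e" using m0[OF that, of y] m0[OF that, of y'] by auto
    qed
    then show ?thesis by blast
  qed
  obtain m where m: "N.prob {\<omega>\<in>space N. grid_code c m (Z \<omega>) \<in> G m} > 1 - e"
  proof -
    have ms: "{\<omega>\<in>space N. grid_code c m (Z \<omega>) \<in> G m} \<in> sets N" for m
    proof -
      have "(\<lambda>\<omega>. grid_code c m (Z \<omega>)) -` G m \<inter> space N \<in> sets N" by (rule measurable_sets[OF mZ]) simp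
      moreover have "(\<lambda>\<omega>. grid_code c m (Z \<omega>)) -` G m \<inter> space N = {\<omega>\<in>space N. grid_code c m (Z \<omega>) \<in> G m}" by
          auto
      ultimately show ?thesis by simp
    qed
    have "(\<lambda>m. \<integral>\<omega>. of_bool (grid_code c m (Z \<omega>) \<in> G m) \<partial>N) \<longlonglongrightarrow> (\<integral>\<omega>. 1 \<partial>N :: real)"
    proof (rule integral_dominated_convergence[where w = "\<lambda>_. 1"])
      show "AE \<omega> in N. (\<lambda>m. of_bool (grid_code c m (Z \<omega>) \<in> G m)) \<longlonglongrightarrow> (1::real)"
      proof (rule AE_I2)
        fix \<omega>
        have "\<forall>\<^sub>F m in sequentially. of_bool (grid_code c m (Z \<omega>) \<in> G m) = (1::real)"
          using Gev[of \<omega>] by (auto simp: eventually_sequentially)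
        then show "(\<lambda>m. of_bool (grid_code c m (Z \<omega>) \<in> G m)) \<longlonglongrightarrow> (1::real)"
          by (rule tendsto_eventually)
      qed
      show "(\<lambda>\<omega>. of_bool (grid_code c m (Z \<omega>) \<in> G m) :: real) \<in> borel_measurable N" for m
        using ms[of m] by measurable
    qed auto
    then have "(\<lambda>m. N.prob {\<omega>\<in>space N. grid_code c m (Z \<omega>) \<in> G m}) \<longlonglongrightarrow> 1"
      by (simp add: measure_Collect_eq_integral N.prob_space)
    then have "\<forall>\<^sub>F m in sequentially. N.prob {\<omega>\<in>space N. grid_code c m (Z \<omega>) \<in> G m} > 1 - e"
      using e by (intro order_tendstoD(1)) auto
    then show ?thesis using that by (auto simp: eventually_sequentially)
  qed
  \<comment> \<open>Finite exhaustion of \<open>G m\<close> along an enumeration of all lists of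
    naturals.\<close>
  define S where "S n = G m \<inter> from_nat ` {..<n}" for n
  have Sfin: "finite (S n)" for n by (simp add: S_def)
  have setZ: "{\<omega>\<in>space N. grid_code c m (Z \<omega>) \<in> A} \<in> sets N" for A
  proof -
    have "(\<lambda>\<omega>. grid_code c m (Z \<omega>)) -` A \<inter> space N \<in> sets N" by (rule measurable_sets[OF mZ]) simp
    moreover have "(\<lambda>\<omega>. grid_code c m (Z \<omega>)) -` A \<inter> space N = {\<omega>\<in>space N. grid_code c m (Z \<omega>) \<in> A}" by auto
    ultimately show ?thesis by simp
  qed
  obtain n where n: "N.prob {\<omega>\<in>space N. grid_code c m (Z \<omega>) \<in> S n} > 1 - e"
  proof -
    have "(\<lambda>n. N.prob {\<omega>\<in>space N. grid_code c m (Z \<omega>) \<in> S n}) \<longlonglongrightarrow> N.prob (\<Union>n. {\<omega>\<in>space N. grid_code c m (Z \<omega>)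
        \<in> S n})"
      by (rule N.finite_Lim_measure_incseq) (use setZ in \<open>auto simp: incseq_def S_def\<close>)
    moreover have "(\<Union>n. {\<omega>\<in>space N. grid_code c m (Z \<omega>) \<in> S n}) = {\<omega>\<in>space N. grid_code c m (Z \<omega>) \<in> G m}"
    proof -
      have "q \<in> from_nat ` {..<Suc (to_nat q)}" for q :: "nat list"
        by (rule image_eqI[of _ _ "to_nat q"]) auto
      then show ?thesis unfolding S_def by blast
    qed
    ultimately have "\<forall>\<^sub>F n in sequentially. N.prob {\<omega>\<in>space N. grid_code c m (Z \<omega>) \<in> S n} > 1 - e"
      using m by (intro order_tendstoD(1)) auto
    then show ?thesis using that by (auto simp: eventually_sequentially)
  qed
  \<comment> \<open>The value of f at an arbitrary path of the cell. Codes outside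
    \<open>S n\<close> are given the value 0 by \<open>F'\<close>, at a cost of at most B.\<close>
  define r where "r q = f (SOME y. y \<in> increasing_paths \<and> grid_code c m y = q)" for q
  define F' where "F' q = (if q \<in> S n then r q else 0)" for q
  have rclose: "\<bar>f y - r (grid_code c m y)\<bar> \<le> 2 * e" and rB: "\<bar>r (grid_code c m y)\<bar> \<le> B"
    if y: "y \<in> increasing_paths" and q: "grid_code c m y \<in> S n" for y
  proof -
    have "\<exists>y'. y' \<in> increasing_paths \<and> grid_code c m y' = grid_code c m y" using y by blast
    then have s: "(SOME y'. y' \<in> increasing_paths \<and> grid_code c m y' = grid_code c m y) \<in> increasing_paths \<and>
        grid_code c m (SOME y'. y' \<in> increasing_paths \<and> grid_code c m y' = grid_code c m y) = grid_code c m
            y" by (rule someI_ex)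
    show "\<bar>f y - r (grid_code c m y)\<bar> \<le> 2 * e"
      unfolding r_def using q y s by (auto simp: S_def G_def)
    show "\<bar>r (grid_code c m y)\<bar> \<le> B" unfolding r_def using B s by blast
  qed
  have F'close: "\<bar>f y - F' (grid_code c m y)\<bar> \<le> 2 * e + B * (1 - of_bool (grid_code c m y \<in> S n))" if y: "y
      \<in> increasing_paths" for y
    using rclose[OF y] B[OF y] e by (auto simp: F'_def)
  have F'sum: "F' q = (\<Sum>s\<in>S n. r s * of_bool (q = s))" for q
  proof (cases "q \<in> S n")
    case True
    then have "(\<Sum>s\<in>S n. r s * of_bool (q = s)) = (\<Sum>s\<in>{q}. r s * of_bool (q = s))"
      by (intro sum.mono_neutral_right Sfin) auto
    then show ?thesis using True by (simp add: F'_def)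
  next
    case False
    have "(\<Sum>s\<in>S n. r s * of_bool (q = s)) = 0"
      by (rule sum.neutral) (use False in auto)
    then show ?thesis using False by (simp add: F'_def)
  qed
  have est: "\<bar>(\<integral>\<omega>. f (V \<omega>) \<partial>K) - (\<Sum>s\<in>S n. r s * measure K {\<omega>\<in>space K. grid_code c m (V \<omega>) = s})\<bar>
      \<le> 2 * e + B * (1 - (\<Sum>s\<in>S n. measure K {\<omega>\<in>space K. grid_code c m (V \<omega>) = s}))"
    if K: "prob_space K" and V: "\<And>\<omega>. V \<omega> \<in> increasing_paths" and mV: "(\<lambda>\<omega>. grid_code c m (V \<omega>)) \<in> measurable
        K (count_space UNIV)"
      and mf: "(\<lambda>\<omega>. f (V \<omega>)) \<in> borel_measurable K" for K :: "'c measure" and V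
  proof -
    interpret K: prob_space K by (rule K)
    note [measurable] = mV mf
    have ib: "integrable K (\<lambda>\<omega>. of_bool (grid_code c m (V \<omega>) = s) :: real)" for s
      by (rule K.integrable_const_bound[where B=1]) auto
    have eb: "(\<integral>\<omega>. of_bool (grid_code c m (V \<omega>) = s) \<partial>K) = K.prob {\<omega>\<in>space K. grid_code c m (V \<omega>) = s}" for
        s
      by (rule measure_Collect_eq_integral[symmetric])
    have i1: "integrable K (\<lambda>\<omega>. f (V \<omega>))"
      using B V by (intro K.integrable_const_bound[where B=B]) auto
    have F'K: "F' (grid_code c m (V \<omega>)) = (\<Sum>s\<in>S n. r s * of_bool (grid_code c m (V \<omega>) = s))" for \<omega>
      by (rule F'sum)
    have i2: "integrable K (\<lambda>\<omega>. F' (grid_code c m (V \<omega>)))"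
      unfolding F'K by (intro Bochner_Integration.integrable_sum integrable_mult_right ib)
    have e2: "(\<integral>\<omega>. F' (grid_code c m (V \<omega>)) \<partial>K) = (\<Sum>s\<in>S n. r s * K.prob {\<omega>\<in>space K. grid_code c m (V \<omega>) =
        s})"
      unfolding F'K by (subst Bochner_Integration.integral_sum) (auto intro: ib simp: eb)
    have SK: "of_bool (grid_code c m (V \<omega>) \<in> S n) = (\<Sum>s\<in>S n. of_bool (grid_code c m (V \<omega>) = s) :: real)" for
        \<omega>
    proof (cases "grid_code c m (V \<omega>) \<in> S n")
      case True
      then have "(\<Sum>s\<in>S n. of_bool (grid_code c m (V \<omega>) = s) :: real) = (\<Sum>s\<in>{grid_code c m (V \<omega>)}. of_bool
          (grid_code c m (V \<omega>) = s))"
        by (intro sum.mono_neutral_right Sfin) auto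
      then show ?thesis using True by simp
    next
      case False
      have "(\<Sum>s\<in>S n. of_bool (grid_code c m (V \<omega>) = s) :: real) = 0"
        by (rule sum.neutral) (use False in auto)
      then show ?thesis using False by (simp only: of_bool_eq)
    qed
    have i3: "integrable K (\<lambda>\<omega>. of_bool (grid_code c m (V \<omega>) \<in> S n) :: real)"
      unfolding SK by (intro Bochner_Integration.integrable_sum ib)
    have e3: "(\<integral>\<omega>. of_bool (grid_code c m (V \<omega>) \<in> S n) \<partial>K) = (\<Sum>s\<in>S n. K.prob {\<omega>\<in>space K. grid_code c m (V \<omega>)
        = s})"
      unfolding SK by (subst Bochner_Integration.integral_sum) (auto intro: ib simp: eb)
    have "\<bar>\<integral>\<omega>. f (V \<omega>) - F' (grid_code c m (V \<omega>)) \<partial>K\<bar> \<le> (\<integral>\<omega>. 2 * e + B * (1 - of_bool (grid_code c m (V \<omega>) \<in>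
        S n)) \<partial>K)"
      by (rule abs_integral_le) (use i1 i2 i3 F'close V in auto)
    also have "\<dots> = 2 * e + B * (1 - (\<Sum>s\<in>S n. K.prob {\<omega>\<in>space K. grid_code c m (V \<omega>) = s}))"
      using i3 by (simp add: e3 K.prob_space)
    finally show ?thesis using i1 i2 by (simp add: e2)
  qed
  have sumZ: "(\<Sum>s\<in>S n. N.prob {\<omega>\<in>space N. grid_code c m (Z \<omega>) = s}) = N.prob {\<omega>\<in>space N. grid_code c m (Z \<omega>)
      \<in> S n}"
  proof -
    have "N.prob (\<Union>s\<in>S n. {\<omega>\<in>space N. grid_code c m (Z \<omega>) = s}) = (\<Sum>s\<in>S n. N.prob {\<omega>\<in>space N. grid_code c m
        (Z \<omega>) = s})"
      using setZ[of "{s}" for s] by (intro N.finite_measure_finite_Union Sfin) (auto simp: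
          disjoint_family_on_def)
    moreover have "(\<Union>s\<in>S n. {\<omega>\<in>space N. grid_code c m (Z \<omega>) = s}) = {\<omega>\<in>space N. grid_code c m (Z \<omega>) \<in> S n}"
        by auto
    ultimately show ?thesis by simp
  qed
  have estZ: "\<bar>(\<integral>\<omega>. f (Z \<omega>) \<partial>N) - (\<Sum>s\<in>S n. r s * N.prob {\<omega>\<in>space N. grid_code c m (Z \<omega>) = s})\<bar> \<le> 2 * e + B *
      e"
  proof -
    have "B * (1 - (\<Sum>s\<in>S n. N.prob {\<omega>\<in>space N. grid_code c m (Z \<omega>) = s})) \<le> B * e"
      using n B1 unfolding sumZ by (intro mult_left_mono) auto
    then show ?thesis using est[OF N Z(1) mZ mfZ] by linarith
  qed
  have "((\<lambda>l. \<Sum>s\<in>S n. M.prob {\<omega>\<in>space M. grid_code c m (X l \<omega>) = s}) \<longlongrightarrow> (\<Sum>s\<in>S n. N.prob {\<omega>\<in>space N. grid_code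
      c m (Z \<omega>) = s})) F"
    by (intro tendsto_sum conv)
  \<comment> \<open>No mass escapes: the finitely many cells eventually carry more than 1 - e under
    M as well.\<close>
  then have ev1: "\<forall>\<^sub>F l in F. (\<Sum>s\<in>S n. M.prob {\<omega>\<in>space M. grid_code c m (X l \<omega>) = s}) > 1 - e"
    using n unfolding sumZ by (intro order_tendstoD(1)) auto
  have "((\<lambda>l. \<Sum>s\<in>S n. r s * M.prob {\<omega>\<in>space M. grid_code c m (X l \<omega>) = s}) \<longlongrightarrow> (\<Sum>s\<in>S n. r s * N.prob {\<omega>\<in>space
      N. grid_code c m (Z \<omega>) = s})) F"
    by (intro tendsto_sum tendsto_mult tendsto_const conv)
  then have ev2: "\<forall>\<^sub>F l in F. dist (\<Sum>s\<in>S n. r s * M.prob {\<omega>\<in>space M. grid_code c m (X l \<omega>) = s}) (\<Sum>s\<in>S n. r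
      s * N.prob {\<omega>\<in>space N. grid_code c m (Z \<omega>) = s}) < e"
    using e by (intro tendstoD) auto
  show "\<forall>\<^sub>F l in F. dist (\<integral>\<omega>. f (X l \<omega>) \<partial>M) (\<integral>\<omega>. f (Z \<omega>) \<partial>N) < \<epsilon>"
    using ev1 ev2 X mX[of m] mfX
  proof eventually_elim
    case (elim l)
    have "B * (1 - (\<Sum>s\<in>S n. M.prob {\<omega>\<in>space M. grid_code c m (X l \<omega>) = s})) \<le> B * e"
      using elim B1 by (intro mult_left_mono) auto
    moreover have "\<bar>(\<integral>\<omega>. f (X l \<omega>) \<partial>M) - (\<Sum>s\<in>S n. r s * M.prob {\<omega>\<in>space M. grid_code c m (X l \<omega>) = s})\<bar>
        \<le> 2 * e + B * (1 - (\<Sum>s\<in>S n. M.prob {\<omega>\<in>space M. grid_code c m (X l \<omega>) = s}))"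
      by (rule est[OF M]) (use elim in auto)
    ultimately have "dist (\<integral>\<omega>. f (X l \<omega>) \<partial>M) (\<integral>\<omega>. f (Z \<omega>) \<partial>N) < 5 * e + 2 * (B * e)"
      using estZ elim unfolding dist_real_def by linarith
    also have "\<dots> \<le> 7 * (B * e)" using mult_right_mono[OF B1, of e] e by simp
    also have "\<dots> < \<epsilon>" using B1 \<epsilon> by (simp add: e_def)
    finally show ?case .
  qed
qed

section \<open>Step paths and their dependence on the jump times\<close>

definition jump_times :: "(nat \<Rightarrow> real) \<Rightarrow> bool" where
  "jump_times s \<longleftrightarrow> s 0 = 0 \<and> (\<forall>k. s k < s (Suc k)) \<and> (\<forall>c. \<exists>k. s k > c)"

definition jump_count :: "(nat \<Rightarrow> real) \<Rightarrow> real \<Rightarrow> nat" where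
  "jump_count s t = card {k. s k \<le> t}"

text \<open>The jump at s 0 = 0 makes the path start at 1 / u, in accordance with the record at
  index 0. Restriction to {0..} yields the extensional functions that \<open>cadlag_paths\<close>
  consists of.\<close>

definition step_path :: "real \<Rightarrow> (nat \<Rightarrow> real) \<Rightarrow> real \<Rightarrow> real" where
  "step_path u s = (\<lambda>t\<in>{0..}. real (jump_count s t) / u)"

context
  fixes s :: "nat \<Rightarrow> real"
  assumes s: "jump_times s"
begin

lemma jump_times_less: "j < k \<Longrightarrow> s j < s k"
  using s lift_Suc_mono_less[of s j k] by (simp add: jump_times_def)

lemma jump_times_le: "j \<le> k \<Longrightarrow> s j \<le> s k"
  using jump_times_less[of j k] by (cases "j = k") auto

lemma jump_count_set: "\<exists>n. {k. s k \<le> t} = {..<n}"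
proof -
  obtain K where K: "s K > t" using s by (auto simp: jump_times_def)
  define n where "n = (LEAST n. s n > t)"
  have n: "s n > t" unfolding n_def by (rule LeastI[of _ K]) (rule K)
  have "s k \<le> t \<longleftrightarrow> k < n" for k
  proof
    assume "s k \<le> t"
    then show "k < n" using jump_times_le[of n k] n by (cases "k < n") auto
  next
    assume "k < n"
    then show "s k \<le> t" using not_less_Least[of k "\<lambda>n. s n > t"] by (simp add: n_def)
  qed
  then show ?thesis by auto
qed

lemma less_jump_count_iff: "k < jump_count s t \<longleftrightarrow> s k \<le> t"
proof -
  obtain n where n: "{k. s k \<le> t} = {..<n}" using jump_count_set by blast
  then have "jump_count s t = n" by (simp add: jump_count_def)
  then show ?thesis using n by blast
qed

lemma jump_count_eqI: "(\<And>k. k < n \<longleftrightarrow> s k \<le> t) \<Longrightarrow> jump_count s t = n"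
  using less_jump_count_iff by (metis less_irrefl nat_neq_iff)

lemma jump_count_mono: "t \<le> t' \<Longrightarrow> jump_count s t \<le> jump_count s t'"
  using less_jump_count_iff[of _ t] less_jump_count_iff[of _ t'] by (metis leI less_irrefl order_trans)

lemma step_path_increasing_paths:
  assumes u: "u > 0"
  shows "step_path u s \<in> increasing_paths"
proof -
  have right: "continuous (at_right t) (step_path u s)" if t: "t \<ge> 0" for t
  proof -
    let ?n = "jump_count s t"
    have n: "s ?n > t" using less_jump_count_iff[of ?n t] by simp
    have "\<forall>\<^sub>F x in at_right t. step_path u s x = step_path u s t"
    proof (rule eventually_at_rightI[OF _ n])
      fix x assume x: "x \<in> {t<..<s ?n}"
      have "jump_count s x \<le> ?n" using less_jump_count_iff[of ?n x] x by auto
      moreover have "?n \<le> jump_count s x" using x by (intro jump_count_mono) auto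
      ultimately show "step_path u s x = step_path u s t" using x t by (simp add: step_path_def)
    qed
    then show ?thesis unfolding continuous_within by (rule tendsto_eventually)
  qed
  have left: "\<exists>l. (step_path u s \<longlongrightarrow> l) (at_left t)" if t: "t > 0" for t
  proof -
    obtain K where K: "s K > t" using s by (auto simp: jump_times_def)
    \<comment> \<open>Exactly n jumps lie strictly before t, so n / u is the left limit.\<close>
    define n where "n = (LEAST n. s n \<ge> t)"
    have n: "s n \<ge> t" unfolding n_def by (rule LeastI[of _ K]) (use K in auto)
    have n0: "n \<noteq> 0" using n t s by (auto simp: jump_times_def intro: ccontr)
    then have n1: "s (n - 1) < t" using not_less_Least[of "n - 1" "\<lambda>n. s n \<ge> t"] by (auto simp: n_def)
    have "\<forall>\<^sub>F x in at_left t. step_path u s x = real n / u"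
    proof (rule eventually_at_leftI[of "max 0 (s (n - 1))"])
      fix x assume x: "x \<in> {max 0 (s (n - 1))<..<t}"
      have "k < n \<longleftrightarrow> s k \<le> x" for k
      proof
        assume "k < n"
        then have "k \<le> n - 1" by simp
        then show "s k \<le> x" using jump_times_le[of k "n - 1"] x by auto
      next
        assume "s k \<le> x"
        then show "k < n" using jump_times_le[of n k] n x by (cases "k < n") auto
      qed
      then have "jump_count s x = n" by (rule jump_count_eqI)
      then show "step_path u s x = real n / u" using x by (simp add: step_path_def)
    qed (use n1 t in auto)
    then show ?thesis by (intro exI[of _ "real n / u"] tendsto_eventually)
  qed
  have "mono_on {0..} (step_path u s)"
    using u by (auto simp: step_path_def intro!: mono_onI divide_right_mono jump_count_mono)
  then show ?thesis
    using right left u by (simp add: increasing_paths_def cadlag_paths_def step_path_def)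
qed

end

lemma tent_lipschitz:
  fixes \<eta> :: real
  assumes "\<eta> > 0"
  shows "\<bar>max 0 (1 - \<bar>t - a\<bar> / \<eta>) - max 0 (1 - \<bar>t' - a\<bar> / \<eta>)\<bar> \<le> \<bar>t - t'\<bar> / \<eta>"
proof -
  have "\<bar>max 0 (1 - p) - max 0 (1 - q)\<bar> \<le> \<bar>p - q\<bar>" for p q :: real by (auto simp: max_def abs_if)
  from this[of "\<bar>t - a\<bar> / \<eta>" "\<bar>t' - a\<bar> / \<eta>"]
  have "\<bar>max 0 (1 - \<bar>t - a\<bar> / \<eta>) - max 0 (1 - \<bar>t' - a\<bar> / \<eta>)\<bar> \<le> \<bar>\<bar>t - a\<bar> / \<eta> - \<bar>t' - a\<bar> / \<eta>\<bar>" .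
  also have "\<dots> = \<bar>\<bar>t - a\<bar> - \<bar>t' - a\<bar>\<bar> / \<eta>"
    using assms by (simp add: diff_divide_distrib[symmetric] abs_divide)
  also have "\<dots> \<le> \<bar>t - t'\<bar> / \<eta>" using assms by (intro divide_right_mono) linarith+
  finally show ?thesis .
qed

text \<open>A small perturbation of the first \<open>n\<close> jump times is absorbed by adding to the identity a
  combination of tent functions centred at the old jump times.\<close>

lemma jump_perturbation:
  fixes s s' :: "nat \<Rightarrow> real"
  assumes s: "jump_times s" and s': "jump_times s'" and \<eta>: "\<eta> > 0" "\<And>k. k < n \<Longrightarrow> s k + \<eta> \<le> s (Suc k)"
    and \<delta>: "\<And>k. k \<le> n \<Longrightarrow> \<bar>s' k - s k\<bar> < \<delta>" "real (Suc n) * \<delta> \<le> \<eta> / 2" "real (Suc n) * \<delta> < e"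
  shows "\<exists>h\<in>time_changes. (\<forall>t\<ge>0. \<bar>h t - t\<bar> < e) \<and> (\<forall>k\<le>n. h (s k) = s' k)"
proof -
  define \<phi> where "\<phi> k t = max 0 (1 - \<bar>t - s k\<bar> / \<eta>)" for k t
  define g where "g t = (\<Sum>k\<le>n. (s' k - s k) * \<phi> k t)" for t
  define h where "h t = t + g t" for t
  have \<delta>0: "\<delta> > 0" using \<delta>(1)[of 0] by auto
  have \<phi>1: "0 \<le> \<phi> k t" "\<phi> k t \<le> 1" for k t using \<eta>(1) by (auto simp: \<phi>_def)
  have \<phi>L: "\<bar>\<phi> k t - \<phi> k t'\<bar> \<le> \<bar>t - t'\<bar> / \<eta>" for k t t'
    unfolding \<phi>_def by (rule tent_lipschitz[OF \<eta>(1)])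
  have gap: "s j + \<eta> \<le> s k" if "j < k" "k \<le> n" for j k
    using \<eta>(2)[of j] jump_times_le[OF s, of "Suc j" k] that by auto
  have gs: "g (s k) = s' k - s k" if k: "k \<le> n" for k
  proof -
    have "\<phi> j (s k) = 0" if "j \<noteq> k" "j \<le> n" for j
    proof -
      have "\<bar>s k - s j\<bar> \<ge> \<eta>" using gap[of j k] gap[of k j] that k by linarith
      then show ?thesis using \<eta>(1) by (simp add: \<phi>_def field_simps)
    qed
    then have "g (s k) = (\<Sum>j\<in>{k}. (s' j - s j) * \<phi> j (s k))"
      unfolding g_def by (intro sum.mono_neutral_right) (use k in auto)
    then show ?thesis by (simp add: \<phi>_def)
  qed
  have gb: "\<bar>g t\<bar> \<le> real (Suc n) * \<delta>" for t
  proof -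
    have "\<bar>g t\<bar> \<le> (\<Sum>k\<le>n. \<bar>(s' k - s k) * \<phi> k t\<bar>)" unfolding g_def by (rule sum_abs)
    also have "\<dots> \<le> (\<Sum>k\<le>n. \<delta>)"
    proof (rule sum_mono)
      fix k assume "k \<in> {..n}"
      then have "\<bar>s' k - s k\<bar> * \<bar>\<phi> k t\<bar> \<le> \<delta> * 1"
        using \<delta>(1)[of k] \<phi>1[of k t] by (intro mult_mono) auto
      then show "\<bar>(s' k - s k) * \<phi> k t\<bar> \<le> \<delta>" by (simp add: abs_mult)
    qed
    finally show ?thesis by simp
  qed
  \<comment> \<open>A Lipschitz constant below 1 keeps the identity plus g strictly increasing; this
    is the purpose of the bound \<eta> / 2.\<close>
  have gL: "\<bar>g t - g t'\<bar> \<le> \<bar>t - t'\<bar> / 2" for t t'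
  proof -
    have "g t - g t' = (\<Sum>k\<le>n. (s' k - s k) * (\<phi> k t - \<phi> k t'))"
      by (simp add: g_def sum_subtractf[symmetric] right_diff_distrib)
    also have "\<bar>\<dots>\<bar> \<le> (\<Sum>k\<le>n. \<bar>(s' k - s k) * (\<phi> k t - \<phi> k t')\<bar>)" by (rule sum_abs)
    also have "\<dots> \<le> (\<Sum>k\<le>n. \<delta> * (\<bar>t - t'\<bar> / \<eta>))"
    proof (rule sum_mono)
      fix k assume "k \<in> {..n}"
      then show "\<bar>(s' k - s k) * (\<phi> k t - \<phi> k t')\<bar> \<le> \<delta> * (\<bar>t - t'\<bar> / \<eta>)"
        unfolding abs_mult using \<delta>(1)[of k] \<phi>L[of k t t'] by (intro mult_mono) auto
    qed
    also have "\<dots> = (real (Suc n) * \<delta>) * (\<bar>t - t'\<bar> / \<eta>)" by simp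
    also have "\<dots> \<le> (\<eta> / 2) * (\<bar>t - t'\<bar> / \<eta>)" using \<delta>(2) \<eta>(1) by (intro mult_right_mono) auto
    also have "\<dots> = \<bar>t - t'\<bar> / 2" using \<eta>(1) by simp
    finally show ?thesis .
  qed
  have h_less: "h t < h t'" if "t < t'" for t t'
  proof -
    have "\<bar>g t - g t'\<bar> \<le> (t' - t) / 2" using gL[of t t'] that by simp
    then have "g t - g t' \<le> (t' - t) / 2" by (rule order_trans[OF abs_ge_self])
    moreover have "(t' - t) / 2 < t' - t" using that by simp
    ultimately show ?thesis unfolding h_def by linarith
  qed
  have h0: "h 0 = 0"
    using gs[of 0] s s' by (simp add: h_def jump_times_def)
  have hc: "continuous_on A h" for A
  proof -
    have "continuous_on A (\<phi> k)" for k unfolding \<phi>_def using \<eta>(1) by (intro continuous_intros) auto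
    then show ?thesis unfolding h_def g_def by (intro continuous_intros)
  qed
  have hb: "\<bar>h t - t\<bar> < e" for t using gb[of t] \<delta>(3) by (simp add: h_def)
  have "h ` {0..} = {0..}"
  proof (intro subset_antisym subsetI)
    fix y assume "y \<in> h ` {0..}"
    then obtain t where t: "t \<ge> 0" "y = h t" by auto
    then show "y \<in> {0..}" using h_less[of 0 t] h0 by (cases "t = 0") auto
  next
    fix y :: real assume y: "y \<in> {0..}"
    \<comment> \<open>Surjectivity by the intermediate value theorem: h moves points by less than e,
      so h (y + e) has passed y.\<close>
    have "h 0 \<le> y" "y \<le> h (y + e)" "0 \<le> y + e"
      using h0 y hb[of "y + e"] hb[of 0] by auto
    then obtain t where "0 \<le> t" "h t = y" using IVT'[of h 0 y "y + e"] hc by auto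
    then show "y \<in> h ` {0..}" by auto
  qed
  then have "h \<in> time_changes"
    using hc h_less by (auto simp: time_changes_def strict_mono_on_def)
  moreover have "h (s k) = s' k" if "k \<le> n" for k using gs[OF that] by (simp add: h_def)
  ultimately show ?thesis using hb by blast
qed

text \<open>A step path depends continuously on its jump times in the Skorokhod topology: up to T
  only finitely many jumps are visible, and moving them slightly is compensated by a time
  change.\<close>

lemma step_path_nbhd:
  assumes s: "jump_times s" and u: "u > 0" and T: "T > 0" and e: "e > 0"
  shows "\<exists>n. \<exists>\<delta>>0. \<forall>s'. jump_times s' \<longrightarrow> (\<forall>k\<le>n. \<bar>s' k - s k\<bar> < \<delta>) \<longrightarrow>
     step_path u s' \<in> skorokhod_nbhd (step_path u s) T e"
proof -
  obtain n where n: "s n > T" using s by (auto simp: jump_times_def)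
  define \<eta> where "\<eta> = Min ((\<lambda>k. s (Suc k) - s k) ` {..n})"
  have \<eta>0: "\<eta> > 0" unfolding \<eta>_def using s by (subst Min_gr_iff) (auto simp: jump_times_def)
  have \<eta>1: "s k + \<eta> \<le> s (Suc k)" if "k < n" for k
  proof -
    have "\<eta> \<le> s (Suc k) - s k" unfolding \<eta>_def using that by (intro Min_le) auto
    then show ?thesis by simp
  qed
  \<comment> \<open>Dividing by n + 1 makes n + 1 tents together small enough; e / 2 in place of e
    gives a strict bound.\<close>
  define \<delta> where "\<delta> = min (\<eta> / 2) (e / 2) / real (Suc n)"
  have \<delta>0: "\<delta> > 0" using \<eta>0 e by (simp add: \<delta>_def)
  have n\<delta>: "real (Suc n) * \<delta> = min (\<eta> / 2) (e / 2)" by (simp add: \<delta>_def)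
  have "step_path u s' \<in> skorokhod_nbhd (step_path u s) T e"
    if s': "jump_times s'" and d: "\<forall>k\<le>n. \<bar>s' k - s k\<bar> < \<delta>" for s'
  proof -
    obtain h where h: "h \<in> time_changes" "\<forall>t\<ge>0. \<bar>h t - t\<bar> < e" "\<forall>k\<le>n. h (s k) = s' k"
    proof -
      have "real (Suc n) * \<delta> \<le> \<eta> / 2" "real (Suc n) * \<delta> < e" unfolding n\<delta> using e by auto
      then show ?thesis using jump_perturbation[OF s s' \<eta>0 \<eta>1, of n \<delta> e] d that by blast
    qed
    have h_less: "h t < h t'" if "0 \<le> t" "t < t'" for t t'
      using h(1) that by (auto simp: time_changes_def strict_mono_on_def)
    have s0: "0 \<le> s k" for k using jump_times_le[OF s, of 0 k] s by (simp add: jump_times_def)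
    have h0: "0 \<le> h t" if "0 \<le> t" for t
    proof -
      have "h t \<in> h ` {0..}" using that by auto
      then show ?thesis using h(1) by (auto simp: time_changes_def)
    qed
    have eq: "step_path u s' (h t) = step_path u s t" if t: "t \<in> {0..T}" for t
    proof -
      have "k < jump_count s t \<longleftrightarrow> s' k \<le> h t" for k
      proof (cases "k \<le> n")
        case True
        then have "s' k = h (s k)" using h(3) by simp
        moreover have "h (s k) \<le> h t \<longleftrightarrow> s k \<le> t"
          using h_less[of t "s k"] h_less[of "s k" t] s0[of k] t
          by (cases "s k" t rule: linorder_cases) auto
        ultimately show ?thesis by (simp add: less_jump_count_iff[OF s])
      next
        case False
        \<comment> \<open>Later jumps of s lie beyond T; those of s' lie beyond h t, because s' n =
          h (s n) > h t.\<close>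
        then have "s k > t" "s' k \<ge> s' n" using jump_times_le[OF s, of n k] jump_times_le[OF s', of n k] n t
            by auto
        moreover have "s' n > h t" using h(3) h_less[of t "s n"] n t by auto
        ultimately show ?thesis by (simp add: less_jump_count_iff[OF s] not_le)
      qed
      then have "jump_count s' (h t) = jump_count s t" by (rule jump_count_eqI[OF s'])
      then show ?thesis using t h0[of t] by (simp add: step_path_def)
    qed
    have "step_path u s' \<in> cadlag_paths" using step_path_increasing_paths[OF s' u] by (simp add:
        increasing_paths_def)
    moreover have "\<forall>t\<in>{0..T}. \<bar>step_path u s' (h t) - step_path u s t\<bar> < e" using eq e by simp
    ultimately show ?thesis unfolding skorokhod_nbhd_def using h by blast
  qed
  then show ?thesis using \<delta>0 by blast
qed

text \<open>By \<open>step_path_nbhd\<close> the jump sequences whose path lies in U are the trace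
  of an open set V of the product topology, and a sequence of measurable coordinates is Borel for
  that topology.\<close>

lemma step_path_vimage_sets:
  assumes u: "u > 0" and T: "\<And>\<omega>. jump_times (\<lambda>k. s k \<omega>)" and m: "\<And>k. s k \<in> borel_measurable M"
    and U: "openin skorokhod_topology U"
  shows "(\<lambda>\<omega>. step_path u (\<lambda>k. s k \<omega>)) -` U \<inter> space M \<in> sets M"
proof -
  define V where "V = \<Union>{B. open B \<and> (\<forall>x\<in>B. jump_times x \<longrightarrow> step_path u x \<in> U)}"
  have V: "open V" unfolding V_def by auto
  have "step_path u x \<in> U \<longleftrightarrow> x \<in> V" if x: "jump_times x" for x
  proof
    assume "step_path u x \<in> U"
    then obtain T e where "T > 0" "e > 0" and Te: "skorokhod_nbhd (step_path u x) T e \<subseteq> U"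
      using U unfolding openin_skorokhod skorokhod_open_def by blast
    then obtain n \<delta> where \<delta>: "\<delta> > 0" and nb: "\<And>s'. jump_times s' \<Longrightarrow> (\<forall>k\<le>n. \<bar>s' k - x k\<bar> < \<delta>) \<Longrightarrow>
        step_path u s' \<in> skorokhod_nbhd (step_path u x) T e"
      using step_path_nbhd[OF x u, of T e] by blast
    define B where "B = (\<Inter>k\<in>{..n}. {s'. \<bar>s' k - x k\<bar> < \<delta>})"
    have "open B" unfolding B_def
      by (intro open_INT ballI open_Collect_less continuous_intros continuous_on_product_coordinates) auto
    moreover have "x \<in> B" using \<delta> by (simp add: B_def)
    moreover have "\<forall>s'\<in>B. jump_times s' \<longrightarrow> step_path u s' \<in> U" using nb Te by (auto simp: B_def)
    ultimately show "x \<in> V" unfolding V_def by blast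
  next
    assume "x \<in> V"
    then show "step_path u x \<in> U" using x unfolding V_def by blast
  qed
  then have "(\<lambda>\<omega>. step_path u (\<lambda>k. s k \<omega>)) -` U \<inter> space M = (\<lambda>\<omega> k. s k \<omega>) -` V \<inter> space M"
    using T by auto
  also have "\<dots> \<in> sets M"
  proof (rule measurable_sets)
    show "(\<lambda>\<omega> k. s k \<omega>) \<in> borel_measurable M"
      using m by (intro measurable_coordinatewise_then_product) simp
  qed (use V in auto)
  finally show ?thesis .
qed

section \<open>The scaling limit of the record times\<close>

lemma sum_blocks:
  fixes f :: "nat \<Rightarrow> real" and k :: "nat \<Rightarrow> nat"
  assumes "mono k" "k 0 = 0"
  shows "(\<Sum>j<k Q. f j) = (\<Sum>i<Q. \<Sum>j=k i..<k (Suc i). f j)"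
proof (induction Q)
  case (Suc Q)
  have "k Q \<le> k (Suc Q)" using assms(1) by (simp add: mono_def)
  then have "(\<Sum>j<k (Suc Q). f j) = (\<Sum>j<k Q. f j) + (\<Sum>j=k Q..<k (Suc Q). f j)"
    using sum.atLeastLessThan_concat[of 0 "k Q" "k (Suc Q)" f] by (simp add: lessThan_atLeast0)
  then show ?case using Suc by simp
qed (simp add: assms)

lemma prod_blocks:
  fixes f :: "nat \<Rightarrow> real" and k :: "nat \<Rightarrow> nat"
  assumes "mono k" "k 0 = 0"
  shows "(\<Prod>j<k Q. f j) = (\<Prod>i<Q. \<Prod>j=k i..<k (Suc i). f j)"
proof (induction Q)
  case (Suc Q)
  have "k Q \<le> k (Suc Q)" using assms(1) by (simp add: mono_def)
  then have "(\<Prod>j<k (Suc Q). f j) = (\<Prod>j<k Q. f j) * (\<Prod>j=k Q..<k (Suc Q). f j)"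
    using prod.atLeastLessThan_concat[of 0 "k Q" "k (Suc Q)" f] by (simp add: lessThan_atLeast0)
  then show ?case using Suc by simp
qed (simp add: assms)

text \<open>Abel summation: a weighted sum of values becomes one of increments, the form in which
  independence is available. The new weights are tail sums of the old ones.\<close>

lemma sum_by_parts:
  fixes n S :: "nat \<Rightarrow> real"
  assumes "S 0 = 0"
  shows "(\<Sum>i\<le>Q. n i * S i) = (\<Sum>i<Q. (\<Sum>m\<in>{i<..Q}. n m) * (S (Suc i) - S i))"
proof (induction Q)
  case (Suc Q)
  have "(\<Sum>m\<in>{i<..Suc Q}. n m) = (\<Sum>m\<in>{i<..Q}. n m) + n (Suc Q)" if "i \<le> Q" for i
  proof -
    have "{i<..Suc Q} = insert (Suc Q) {i<..Q}" using that by auto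
    then show ?thesis by simp
  qed
  then have "(\<Sum>i<Suc Q. (\<Sum>m\<in>{i<..Suc Q}. n m) * (S (Suc i) - S i)) =
      (\<Sum>i<Suc Q. (\<Sum>m\<in>{i<..Q}. n m) * (S (Suc i) - S i) + n (Suc Q) * (S (Suc i) - S i))"
    by (intro sum.cong) (auto simp: algebra_simps)
  also have "\<dots> = (\<Sum>i<Suc Q. (\<Sum>m\<in>{i<..Q}. n m) * (S (Suc i) - S i)) + n (Suc Q) * (\<Sum>i<Suc Q. S (Suc i) - S
      i)"
    by (simp only: sum.distrib sum_distrib_left)
  also have "(\<Sum>i<Suc Q. S (Suc i) - S i) = S (Suc Q)"
    using assms by (subst sum_lessThan_telescope) simp
  finally show ?case using Suc by simp
qed (simp add: assms)

context prob_space
begin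

text \<open>For l > 0 the product with \<open>psi X Y (1 / l)\<close> is 1, so that the Laplace
  transform of v * norming durations between records, at argument b / l, has a nontrivial limit. The
  value 1 for l \<le> 0 makes the norming positive everywhere.\<close>

definition norming :: "(nat \<Rightarrow> 'a \<Rightarrow> real) \<Rightarrow> (nat \<Rightarrow> 'a \<Rightarrow> real) \<Rightarrow> real \<Rightarrow> real" where
  "norming X Y l = (if l > 0 then 1 / psi X Y (1 / l) else 1)"

text \<open>The record at index 0 is counted, so at least \<open>k + 1\<close> records occur by time \<open>t\<close> iff record
  time number \<open>k\<close> is at most \<open>t\<close>. At \<open>i = 0\<close> the subtraction is truncated and gives 0.\<close>

definition level_index :: "(nat \<Rightarrow> 'a \<Rightarrow> real) \<Rightarrow> (nat \<Rightarrow> 'a \<Rightarrow> real) \<Rightarrow> real \<Rightarrow> real \<Rightarrow> nat \<Rightarrow> nat" where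
  "level_index X Y \<delta> l i = nat \<lceil>norming X Y l * (\<delta> * real i)\<rceil> - 1"

end

context heavy_tailed_ctrw
begin

lemmas psi_pos = psi_bounds(1)

text \<open>By Markov's inequality the probability of staying below k is at most exp k times
  \<open>wait_laplace Y 1\<close> to the power n, for every n, and the base is below 1.\<close>

lemma AE_partial_sum_unbounded: "AE \<omega> in M. \<forall>k::nat. \<exists>n. partial_sum (\<lambda>i. \<bar>Y i \<omega>\<bar>) n > real k"
  unfolding AE_all_countable
proof
  fix k :: nat
  have [measurable]: "(\<lambda>\<omega>. partial_sum (\<lambda>i. \<bar>Y i \<omega>\<bar>) n) \<in> borel_measurable M" for n
    by (intro measurable_partial_sum borel_measurable_abs iid_measurable[OF prob_space_axioms iidY])
  have E: "expectation (\<lambda>\<omega>. exp (- partial_sum (\<lambda>i. \<bar>Y i \<omega>\<bar>) n)) = wait_laplace Y 1 ^ n" for n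
    using expectation_exp_weighted[OF iidY, of "\<lambda>_. 1" n] by (simp add: partial_sum_def)
  have i: "integrable M (\<lambda>\<omega>. exp (- partial_sum (\<lambda>i. \<bar>Y i \<omega>\<bar>) n))" for n
  proof (rule integrable_bounded[where B=1])
    show "\<bar>exp (- partial_sum (\<lambda>i. \<bar>Y i \<omega>\<bar>) n)\<bar> \<le> 1" for \<omega>
      by (simp add: partial_sum_def sum_nonneg)
  qed measurable
  have "prob {\<omega>\<in>space M. \<forall>n. partial_sum (\<lambda>i. \<bar>Y i \<omega>\<bar>) n \<le> real k} \<le> 0"
  proof (rule LIMSEQ_le_const)
    show "(\<lambda>n. wait_laplace Y 1 ^ n / exp (- real k)) \<longlonglongrightarrow> 0"
      using wait_laplace_less_1[of 1] wait_laplace_bounds[OF iidY, of 1]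
      by (intro tendsto_divide_0 LIMSEQ_power_zero real_tendsto_divide_at_top tendsto_divide_zero) auto
    show "\<exists>n0. \<forall>n\<ge>n0. prob {\<omega>\<in>space M. \<forall>n. partial_sum (\<lambda>i. \<bar>Y i \<omega>\<bar>) n \<le> real k} \<le> wait_laplace Y 1 ^ n /
        exp (- real k)"
    proof (intro exI allI impI)
      fix n :: nat
      have "prob {\<omega>\<in>space M. \<forall>n. partial_sum (\<lambda>i. \<bar>Y i \<omega>\<bar>) n \<le> real k} \<le>
          prob {\<omega>\<in>space M. exp (- partial_sum (\<lambda>i. \<bar>Y i \<omega>\<bar>) n) \<ge> exp (- real k)}"
        by (intro finite_measure_mono) auto
      also have "\<dots> \<le> expectation (\<lambda>\<omega>. exp (- partial_sum (\<lambda>i. \<bar>Y i \<omega>\<bar>) n)) / exp (- real k)"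
        by (rule integral_Markov_inequality_measure[where A = "space M"]) (use i in auto)
      finally show "prob {\<omega>\<in>space M. \<forall>n. partial_sum (\<lambda>i. \<bar>Y i \<omega>\<bar>) n \<le> real k} \<le> wait_laplace Y 1 ^ n / exp
          (- real k)"
        by (simp only: E)
    qed
  qed
  then have "prob {\<omega>\<in>space M. \<forall>n. partial_sum (\<lambda>i. \<bar>Y i \<omega>\<bar>) n \<le> real k} = 0" by (simp add: measure_le_0_iff)
  then have "AE \<omega> in M. \<not> (\<forall>n. partial_sum (\<lambda>i. \<bar>Y i \<omega>\<bar>) n \<le> real k)"
    by (subst (asm) prob_eq_0) auto
  then show "AE \<omega> in M. \<exists>n. partial_sum (\<lambda>i. \<bar>Y i \<omega>\<bar>) n > real k"
    by (rule AE_mp) (auto simp: not_le)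
qed

text \<open>The record times are altered on a null set so that every sample gives a genuine jump
  sequence; the facts on step paths then apply at every sample point.\<close>

lemma record_times_version:
  obtains s where "\<And>\<omega>. jump_times (\<lambda>k. s k \<omega>)" "\<And>k. s k \<in> borel_measurable M"
    "AE \<omega> in M. \<forall>k. s k \<omega> = record_time X Y k \<omega>"
    "AE \<omega> in M. \<forall>l>0. \<forall>t\<ge>0. ctrw_records X Y (l * t) \<omega> = jump_count (\<lambda>k. s k \<omega> / l) t"
proof -
  define good where "good \<omega> \<longleftrightarrow> (\<forall>i\<ge>1. Y i \<omega> > 0) \<and> (\<forall>k::nat. \<exists>n. partial_sum (\<lambda>i. \<bar>Y i \<omega>\<bar>) n > real k) \<and>
     (\<forall>k. \<exists>n. ladder (\<lambda>i. X i \<omega>) k n)" for \<omega>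
  have "AE \<omega> in M. \<forall>i. i \<ge> 1 \<longrightarrow> Y i \<omega> > 0"
    unfolding AE_all_countable using posY by auto
  then have "AE \<omega> in M. good \<omega>"
    using AE_partial_sum_unbounded AE_ladder[OF iidX nonneg_prob \<rho>] unfolding good_def by eventually_elim
        blast
  then obtain A where A: "{\<omega>\<in>space M. \<not> good \<omega>} \<subseteq> A" "emeasure M A = 0" "A \<in> sets M"
    by (rule AE_E)
  \<comment> \<open>On the exceptional set the deterministic jump times 0, 1, 2, ... serve as
    default.\<close>
  define s where "s k \<omega> = (if \<omega> \<in> space M - A then record_time X Y k \<omega> else real k)" for k \<omega>
  have ae: "AE \<omega> in M. \<omega> \<in> space M - A"
    using A(2,3) by (auto intro!: AE_I[of _ _ A])
  have abs: "partial_sum (\<lambda>i. \<bar>Y i \<omega>\<bar>) n = partial_sum (\<lambda>i. Y i \<omega>) n" if "good \<omega>" for n \<omega>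
    using that by (intro partial_sum_cong) (auto simp: good_def)
  have step: "jump_times (\<lambda>k. record_time X Y k \<omega>)" if g: "good \<omega>" for \<omega>
  proof -
    have ladder: "\<And>k. \<exists>n. ladder (\<lambda>i. X i \<omega>) k n" and pos: "\<And>i. i \<ge> 1 \<Longrightarrow> Y i \<omega> > 0"
      using g unfolding good_def by blast+
    have less: "ladder_epoch (\<lambda>i. X i \<omega>) k < ladder_epoch (\<lambda>i. X i \<omega>) (Suc k)" for k by (rule
        ladder_epoch_less[OF ladder])
    have ge: "k \<le> ladder_epoch (\<lambda>i. X i \<omega>) k" for k
    proof (induction k)
      case (Suc k)
      then show ?case using less[of k] by linarith
    qed simp
    show ?thesis
      unfolding jump_times_def record_time_def abs[OF g]
    proof (intro conjI allI)
      show "partial_sum (\<lambda>i. Y i \<omega>) (ladder_epoch (\<lambda>i. X i \<omega>) k) < partial_sum (\<lambda>i. Y i \<omega>) (ladder_epoch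
          (\<lambda>i. X i \<omega>) (Suc k))" for k
        by (rule partial_sum_strict[OF pos less])
      fix c :: real
      obtain k :: nat where k: "c < real k" using reals_Archimedean2 by blast
      obtain n where n: "partial_sum (\<lambda>i. Y i \<omega>) n > real k"
        using g unfolding good_def abs[OF g] by blast
      have "partial_sum (\<lambda>i. Y i \<omega>) n \<le> partial_sum (\<lambda>i. Y i \<omega>) (ladder_epoch (\<lambda>i. X i \<omega>) n)"
        by (rule partial_sum_mono[OF pos ge])
      then show "\<exists>k. c < partial_sum (\<lambda>i. Y i \<omega>) (ladder_epoch (\<lambda>i. X i \<omega>) k)" using k n by (intro exI[of _
          n]) linarith
    qed simp
  qed
  have 1: "jump_times (\<lambda>k. s k \<omega>)" for \<omega>
  proof (cases "\<omega> \<in> space M - A")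
    case True
    then have "good \<omega>" using A(1) by blast
    then show ?thesis using step True by (simp add: s_def)
  next
    case False
    have "\<exists>k. c < real k" for c by (rule reals_Archimedean2)
    then show ?thesis using False by (auto simp: s_def jump_times_def)
  qed
  have 2: "s k \<in> borel_measurable M" for k
  proof -
    have [measurable]: "record_time X Y k \<in> borel_measurable M" "A \<in> sets M"
      using record_time_measurable[OF iidX iidY] A(3) by auto
    show ?thesis unfolding s_def by measurable
  qed
  have 3: "AE \<omega> in M. \<forall>k. s k \<omega> = record_time X Y k \<omega>"
    using ae by (rule AE_mp) (auto simp: s_def)
  have 4: "AE \<omega> in M. \<forall>l>0. \<forall>t\<ge>0. ctrw_records X Y (l * t) \<omega> = jump_count (\<lambda>k. s k \<omega> / l) t"
    using ae
  proof eventually_elim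
    case (elim \<omega>)
    then have g: "good \<omega>" using A(1) by blast
    have ladder: "\<And>k. \<exists>n. ladder (\<lambda>i. X i \<omega>) k n" and pos: "\<And>i. i \<ge> 1 \<Longrightarrow> Y i \<omega> > 0"
      using g unfolding good_def by blast+
    have unb: "\<exists>n. partial_sum (\<lambda>i. Y i \<omega>) n > c" for c
    proof -
      obtain k :: nat where k: "c < real k" using reals_Archimedean2 by blast
      obtain n where n: "partial_sum (\<lambda>i. Y i \<omega>) n > real k"
        using g unfolding good_def abs[OF g] by blast
      then show ?thesis using k by (intro exI[of _ n]) linarith
    qed
    show ?case
    proof (intro allI impI)
      fix l t :: real assume l: "l > 0" and t: "t \<ge> 0"
      have st: "jump_times (\<lambda>k. s k \<omega> / l)"
      proof -
        have "\<exists>k. c < s k \<omega> / l" for c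
          using 1[of \<omega>] l by (auto simp: jump_times_def pos_less_divide_eq)
        then show ?thesis using 1[of \<omega>] l by (auto simp: jump_times_def divide_strict_right_mono)
      qed
      have "k < ctrw_records X Y (l * t) \<omega> \<longleftrightarrow> s k \<omega> / l \<le> t" for k
        using Suc_le_ctrw_records_iff[of Y \<omega> X "l * t" k, OF pos unb ladder] l t elim
        by (simp add: s_def record_time_def abs[OF g] Suc_le_eq pos_divide_le_eq mult.commute)
      then show "ctrw_records X Y (l * t) \<omega> = jump_count (\<lambda>k. s k \<omega> / l) t"
        by (intro jump_count_eqI[OF st, symmetric])
    qed
  qed
  show ?thesis by (rule that[OF 1 2 3 4])
qed

text \<open>The exponent is constant on the block k i \<le> j < k (Suc i), so each duration between
  records in that block contributes the same factor 1 - \<open>psi X Y (b i)\<close>.\<close>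

lemma block_moments:
  fixes k :: "nat \<Rightarrow> nat"
  assumes k: "mono k" "k 0 = 0" and b: "\<And>i. b i \<ge> 0"
  shows "expectation (\<lambda>\<omega>. exp (- (\<Sum>i<Q. b i * (record_time X Y (k (Suc i)) \<omega> - record_time X Y (k i) \<omega>)))) =
     (\<Prod>i<Q. (1 - psi X Y (b i)) ^ (k (Suc i) - k i))"
proof -
  \<comment> \<open>\<open>Max\<close> finds the block that contains j. Blocks may be empty, so
    several m can have the same k m and the last one counts; m \<le> Q keeps the set finite.\<close>
  define a where "a j = b (Max {m. m \<le> Q \<and> k m \<le> j})" for j
  have a: "a j = b i" if "i < Q" "j \<in> {k i..<k (Suc i)}" for i j
  proof -
    have "m \<le> i" if "m \<le> Q" "k m \<le> j" for m
    proof (rule ccontr)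
      assume "\<not> m \<le> i"
      then have "k (Suc i) \<le> k m" using k(1) by (intro monoD[OF k(1)]) auto
      then show False using that \<open>j \<in> {k i..<k (Suc i)}\<close> by auto
    qed
    then have "Max {m. m \<le> Q \<and> k m \<le> j} = i"
      using that by (intro Max_eqI) auto
    then show ?thesis by (simp add: a_def)
  qed
  have "(\<Sum>j<k Q. a j * (record_time X Y (Suc j) \<omega> - record_time X Y j \<omega>)) =
      (\<Sum>i<Q. b i * (record_time X Y (k (Suc i)) \<omega> - record_time X Y (k i) \<omega>))" for \<omega>
    unfolding sum_blocks[OF k]
  proof (rule sum.cong)
    fix i assume i: "i \<in> {..<Q}"
    have "(\<Sum>j=k i..<k (Suc i). a j * (record_time X Y (Suc j) \<omega> - record_time X Y j \<omega>)) =
        (\<Sum>j=k i..<k (Suc i). b i * (record_time X Y (Suc j) \<omega> - record_time X Y j \<omega>))"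
      by (rule sum.cong) (use a i in auto)
    also have "\<dots> = b i * (\<Sum>j=k i..<k (Suc i). record_time X Y (Suc j) \<omega> - record_time X Y j \<omega>)"
      by (rule sum_distrib_left[symmetric])
    also have "(\<Sum>j=k i..<k (Suc i). record_time X Y (Suc j) \<omega> - record_time X Y j \<omega>) = record_time X Y (k
        (Suc i)) \<omega> - record_time X Y (k i) \<omega>"
      by (rule sum_Suc_diff') (rule monoD[OF k(1)], simp)
    finally show "(\<Sum>j=k i..<k (Suc i). a j * (record_time X Y (Suc j) \<omega> - record_time X Y j \<omega>)) =
      b i * (record_time X Y (k (Suc i)) \<omega> - record_time X Y (k i) \<omega>)" .
  qed simp
  then have "expectation (\<lambda>\<omega>. exp (- (\<Sum>i<Q. b i * (record_time X Y (k (Suc i)) \<omega> - record_time X Y (k i)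
      \<omega>)))) =
      (\<Prod>j<k Q. ladder_gf X (wait_laplace Y (a j)))"
    using expectation_exp_blocks[OF iidX iidY ind AE_ladder[OF iidX nonneg_prob \<rho>], of a "k Q"] b
    by (simp only: a_def)
  also have "\<dots> = (\<Prod>i<Q. \<Prod>j=k i..<k (Suc i). ladder_gf X (wait_laplace Y (a j)))"
    by (rule prod_blocks[OF k])
  also have "\<dots> = (\<Prod>i<Q. (1 - psi X Y (b i)) ^ (k (Suc i) - k i))"
  proof (rule prod.cong)
    fix i assume i: "i \<in> {..<Q}"
    have "(\<Prod>j=k i..<k (Suc i). ladder_gf X (wait_laplace Y (a j))) = (\<Prod>j=k i..<k (Suc i). 1 - psi X Y (b
        i))"
      by (rule prod.cong) (use a i in \<open>auto simp: psi_def\<close>)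
    then show "(\<Prod>j=k i..<k (Suc i). ladder_gf X (wait_laplace Y (a j))) = (1 - psi X Y (b i)) ^ (k (Suc i) -
        k i)"
      by simp
  qed simp
  finally show ?thesis .
qed

lemma psi_0: "psi X Y 0 = 0"
proof -
  have "wait_laplace Y 0 = 1" by (simp add: wait_laplace_def prob_space)
  then show ?thesis by (simp add: psi_def ladder_gf_1[OF iidX nonneg_prob \<rho>])
qed

text \<open>Abel's theorem for nonnegative coefficients: a partial sum that exceeds a at 1 still
  does so near 1 and bounds the series from below.\<close>

lemma ladder_gf_tendsto_1: "(ladder_gf X \<longlongrightarrow> 1) (at_left 1)"
proof (rule order_tendstoI)
  fix a :: real assume a: "a < 1"
  have "ladder_prob X 1 sums 1"
    using ladder_prob_gen_sums[OF iidX, of 1 1] by (simp add: ladder_gf_1[OF iidX nonneg_prob \<rho>])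
  then have "(\<lambda>N. \<Sum>n<N. ladder_prob X 1 n) \<longlonglongrightarrow> 1" by (simp add: sums_def)
  then obtain N where N: "(\<Sum>n<N. ladder_prob X 1 n) > a"
    using order_tendstoD(1)[of _ 1 sequentially a] a by (auto simp: eventually_sequentially)
  have "((\<lambda>z. \<Sum>n<N. z ^ n * ladder_prob X 1 n) \<longlongrightarrow> (\<Sum>n<N. 1 ^ n * ladder_prob X 1 n)) (at_left 1)"
    by (intro tendsto_intros)
  then have "\<forall>\<^sub>F z in at_left 1. (\<Sum>n<N. z ^ n * ladder_prob X 1 n) > a"
    using N by (intro order_tendstoD(1)) auto
  then show "\<forall>\<^sub>F z in at_left 1. a < ladder_gf X z"
    using eventually_at_left_real[of 0 "1::real", OF zero_less_one]
  proof eventually_elim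
    case (elim z)
    have "(\<Sum>n<N. z ^ n * ladder_prob X 1 n) \<le> ladder_gf X z"
      unfolding ladder_gf_def
      by (rule sum_le_suminf) (use elim ladder_prob_nonneg ladder_gf_summable[OF iidX, of z] in auto)
    then show ?case using elim by linarith
  qed
next
  fix a :: real assume a: "1 < a"
  show "\<forall>\<^sub>F z in at_left 1. ladder_gf X z < a"
    using eventually_at_left_real[of 0 "1::real", OF zero_less_one]
  proof eventually_elim
    case (elim z)
    then show ?case using ladder_gf_le[OF iidX, of z] a by auto
  qed
qed

lemma psi_tendsto_0: "(psi X Y \<longlongrightarrow> 0) (at_right 0)"
proof -
  have "filterlim (wait_laplace Y) (at_left 1) (at_right 0)"
    unfolding filterlim_at using wait_laplace_tendsto_1 wait_laplace_less_1
    by (auto intro!: eventually_mono[OF eventually_at_right_less] simp: less_imp_neq)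
  then have "((\<lambda>s. 1 - ladder_gf X (wait_laplace Y s)) \<longlongrightarrow> 1 - 1) (at_right 0)"
    by (intro tendsto_diff tendsto_const filterlim_compose[OF ladder_gf_tendsto_1])
  then show ?thesis by (simp add: psi_def[abs_def])
qed

section \<open>Asymptotics of the norming and of the level indices\<close>

lemma norming_pos: "norming X Y l > 0"
  using psi_pos[of "1 / l"] by (simp add: norming_def)

lemma norming_at_top: "filterlim (norming X Y) at_top at_top"
proof -
  have "filterlim (\<lambda>l. psi X Y (inverse l)) (at_right 0) at_top"
    unfolding filterlim_at
  proof
    show "((\<lambda>l. psi X Y (inverse l)) \<longlongrightarrow> 0) at_top"
      by (rule filterlim_compose[OF psi_tendsto_0 filterlim_inverse_at_right_top])
    show "\<forall>\<^sub>F l in at_top. psi X Y (inverse l) \<in> {0<..} \<and> psi X Y (inverse l) \<noteq> 0"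
      using eventually_gt_at_top[of 0]
    proof eventually_elim
      case (elim l)
      then show ?case using psi_pos[of "inverse l"] by simp
    qed
  qed
  then have "filterlim (\<lambda>l. inverse (psi X Y (inverse l))) at_top at_top"
    by (rule filterlim_compose[OF filterlim_inverse_at_top_right])
  moreover have "\<forall>\<^sub>F l in at_top. inverse (psi X Y (inverse l)) = norming X Y l"
    using eventually_gt_at_top[of 0] by eventually_elim (simp add: norming_def inverse_eq_divide)
  ultimately show ?thesis by (simp cong: filterlim_cong)
qed

lemma level_index_mono: "\<delta> > 0 \<Longrightarrow> mono (level_index X Y \<delta> l)"
  unfolding level_index_def using norming_pos[of l]
  by (intro monoI diff_le_mono nat_mono ceiling_mono mult_left_mono) auto

lemma level_index_0: "level_index X Y \<delta> l 0 = 0"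
  by (simp add: level_index_def)

text \<open>Rounding changes \<open>norming X Y l * (\<delta> * real i)\<close> by at most 1, which
  is negligible because the norming diverges.\<close>

lemma level_index_limit:
  assumes \<delta>: "\<delta> > 0"
  shows "((\<lambda>l. real (level_index X Y \<delta> l i) / norming X Y l) \<longlongrightarrow> \<delta> * real i) at_top"
proof -
  have bd: "\<bar>real (level_index X Y \<delta> l i) - norming X Y l * (\<delta> * real i)\<bar> \<le> 1" for l
  proof (cases "i = 0")
    case False
    then have "norming X Y l * (\<delta> * real i) > 0" using norming_pos[of l] \<delta> by simp
    then have "1 \<le> \<lceil>norming X Y l * (\<delta> * real i)\<rceil>" by simp
    then have "real (level_index X Y \<delta> l i) = real_of_int \<lceil>norming X Y l * (\<delta> * real i)\<rceil> - 1"
      unfolding level_index_def by (simp add: of_nat_diff nat_le_eq_zle le_nat_iff)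
    then show ?thesis by linarith
  qed (simp add: level_index_0)
  have "((\<lambda>l. inverse (norming X Y l)) \<longlongrightarrow> 0) at_top"
    by (rule tendsto_inverse_0_at_top[OF norming_at_top])
  moreover have bd': "norm (real (level_index X Y \<delta> l i) / norming X Y l - \<delta> * real i) \<le> inverse (norming X
      Y l)" for l
  proof -
    have "real (level_index X Y \<delta> l i) / norming X Y l - \<delta> * real i = (real (level_index X Y \<delta> l i) -
        norming X Y l * (\<delta> * real i)) / norming X Y l"
      using norming_pos[of l] by (simp add: field_simps)
    then have "norm (real (level_index X Y \<delta> l i) / norming X Y l - \<delta> * real i) = \<bar>real (level_index X Y \<delta> l
        i) - norming X Y l * (\<delta> * real i)\<bar> / norming X Y l"
      using norming_pos[of l] by (simp add: abs_divide)
    also have "\<dots> \<le> 1 / norming X Y l" using bd[of l] norming_pos[of l] by (intro divide_right_mono) auto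
    finally show ?thesis by (simp add: inverse_eq_divide)
  qed
  ultimately have "((\<lambda>l. real (level_index X Y \<delta> l i) / norming X Y l - \<delta> * real i) \<longlongrightarrow> 0) at_top"
    by (intro Lim_null_comparison[OF always_eventually[OF allI[OF bd']]])
  then show ?thesis by (rule LIM_zero_cancel)
qed

text \<open>The block has about \<delta> * \<open>norming X Y l\<close> records, and by regular
  variation \<open>psi X Y (b / l)\<close> is about b powr (\<alpha> * \<rho>) /
  \<open>norming X Y l\<close>; for b > 0 \<open>power_one_minus_tendsto_exp\<close> concludes. For
  b = 0 both sides are 1 as \<open>psi X Y 0\<close> is 0.\<close>

lemma block_limit:
  assumes \<delta>: "\<delta> > 0" and b: "b \<ge> 0"
  shows "((\<lambda>l. (1 - psi X Y (b / l)) ^ (level_index X Y \<delta> l (Suc i) - level_index X Y \<delta> l i)) \<longlongrightarrow> exp (- \<delta> * b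
      powr (\<alpha> * \<rho>))) at_top"
proof (cases "b = 0")
  case True
  then show ?thesis by (simp add: psi_0)
next
  case False
  then have b: "b > 0" using b by simp
  have bl: "filterlim (\<lambda>l. b * inverse l) (at_right 0) at_top"
    unfolding filterlim_at
  proof
    show "((\<lambda>l. b * inverse l) \<longlongrightarrow> 0) at_top"
      using tendsto_mult[OF tendsto_const tendsto_inverse_0_at_top[OF filterlim_ident], of b] by simp
    show "\<forall>\<^sub>F l in at_top. b * inverse l \<in> {0<..} \<and> b * inverse l \<noteq> 0"
      using eventually_gt_at_top[of 0] by eventually_elim (use b in auto)
  qed
  have "((\<lambda>l. (1 - psi X Y (b * inverse l)) ^ (level_index X Y \<delta> l (Suc i) - level_index X Y \<delta> l i)) \<longlongrightarrow> exp
      (- (\<delta> * b powr (\<alpha> * \<rho>)))) at_top"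
  proof (rule power_one_minus_tendsto_exp)
    show "((\<lambda>l. psi X Y (b * inverse l)) \<longlongrightarrow> 0) at_top"
      by (rule filterlim_compose[OF psi_tendsto_0 bl])
    show "\<forall>\<^sub>F l in at_top. 0 \<le> psi X Y (b * inverse l)"
      using eventually_gt_at_top[of 0]
    proof eventually_elim
      case (elim l)
      then show ?case using psi_pos[of "b * inverse l"] b by simp
    qed
    have "((\<lambda>l. psi X Y (b * inverse l) / psi X Y (inverse l)) \<longlongrightarrow> b powr (\<alpha> * \<rho>)) at_top"
      by (rule filterlim_compose[OF psi_regularly_varying[OF b] filterlim_inverse_at_right_top])
    then have "((\<lambda>l. (real (level_index X Y \<delta> l (Suc i)) / norming X Y l - real (level_index X Y \<delta> l i) /
        norming X Y l) *
        (psi X Y (b * inverse l) / psi X Y (inverse l))) \<longlongrightarrow> (\<delta> * real (Suc i) - \<delta> * real i) * b powr (\<alpha> * \<rho>))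
            at_top"
      by (intro tendsto_mult tendsto_diff level_index_limit \<delta>)
    then have "((\<lambda>l. (real (level_index X Y \<delta> l (Suc i)) / norming X Y l - real (level_index X Y \<delta> l i) /
        norming X Y l) *
        (psi X Y (b * inverse l) / psi X Y (inverse l))) \<longlongrightarrow> \<delta> * b powr (\<alpha> * \<rho>)) at_top"
      by (simp add: algebra_simps)
    moreover have "\<forall>\<^sub>F l in at_top. (real (level_index X Y \<delta> l (Suc i)) / norming X Y l - real (level_index
        X Y \<delta> l i) / norming X Y l) *
        (psi X Y (b * inverse l) / psi X Y (inverse l)) =
        real (level_index X Y \<delta> l (Suc i) - level_index X Y \<delta> l i) * psi X Y (b * inverse l)"
      using eventually_gt_at_top[of 0]
    proof eventually_elim
      case (elim l)
      have "level_index X Y \<delta> l i \<le> level_index X Y \<delta> l (Suc i)" by (rule monoD[OF level_index_mono[OF \<delta>]])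
          simp
      then show ?case
        using elim psi_pos[of "inverse l"]
        by (simp add: norming_def inverse_eq_divide of_nat_diff left_diff_distrib diff_divide_distrib)
    qed
    ultimately show "((\<lambda>l. real (level_index X Y \<delta> l (Suc i) - level_index X Y \<delta> l i) * psi X Y (b * inverse
        l)) \<longlongrightarrow> \<delta> * b powr (\<alpha> * \<rho>)) at_top"
      by (rule Lim_transform_eventually)
  qed
  then show ?thesis by (simp add: divide_inverse)
qed

end

section \<open>Proof of the limit theorem\<close>

lemma completion_sets_AE:
  assumes A: "A \<in> sets M" and B: "B \<subseteq> space M" and ae: "AE \<omega> in M. \<omega> \<in> A \<longleftrightarrow> \<omega> \<in> B"
  shows "B \<in> sets (completion M)"
proof -
  obtain n where n: "{\<omega>\<in>space M. \<not> (\<omega> \<in> A \<longleftrightarrow> \<omega> \<in> B)} \<subseteq> n" "emeasure M n = 0" "n \<in> sets M"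
    using ae by (rule AE_E)
  have "B = (A - n) \<union> (B \<inter> n)"
    using n(1) B sets.sets_into_space[OF A] by auto
  then show ?thesis
    by (rule sets_completionI[where N' = n]) (use n A in auto)
qed

lemma measurable_grid_code:
  assumes "\<And>t. t \<ge> 0 \<Longrightarrow> (\<lambda>\<omega>. z \<omega> t) \<in> borel_measurable M"
  shows "(\<lambda>\<omega>. grid_code c m (z \<omega>)) \<in> measurable M (count_space UNIV)"
proof -
  have "(\<lambda>\<omega>. map (\<lambda>p. nat \<lfloor>z \<omega> (real p / 2 ^ m) * 2 ^ m / c\<rfloor>) ps) \<in> measurable M (count_space UNIV)"
    for ps :: "nat list"
  proof (induction ps)
    case (Cons p ps)
    have [measurable]: "(\<lambda>\<omega>. z \<omega> (real p / 2 ^ m)) \<in> borel_measurable M" by (rule assms) simp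
    have 1: "(\<lambda>\<omega>. nat \<lfloor>z \<omega> (real p / 2 ^ m) * 2 ^ m / c\<rfloor>) \<in> measurable M (count_space UNIV)"
      by measurable
    have 2: "(\<lambda>\<omega>. i # map (\<lambda>p. nat \<lfloor>z \<omega> (real p / 2 ^ m) * 2 ^ m / c\<rfloor>) ps) \<in> measurable M (count_space
        UNIV)" for i
      by (rule measurable_compose[OF Cons]) simp
    show ?case
      using measurable_compose_countable[OF 2 1] by simp
  qed simp
  then show ?thesis unfolding grid_code_def .
qed

section \<open>Grid cells as threshold events, and measurability\<close>

definition cell_tests :: "nat \<Rightarrow> nat list \<Rightarrow> (nat \<times> real \<times> bool) list" where
  "cell_tests m qs = concat (map (\<lambda>p. [(qs ! (p - 1), exp (- (real p / 2 ^ m)), True),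
      (Suc (qs ! (p - 1)), exp (- (real p / 2 ^ m)), False)]) [1..<m * 2 ^ m + 1])"

lemma cell_testsD:
  assumes "(i, e, b) \<in> set (cell_tests m qs)" "length qs = m * 2 ^ m"
  shows "i \<le> Suc (sum_list qs) \<and> (\<exists>p\<ge>1. e = exp (- (real p / 2 ^ m)))"
proof -
  obtain p where p: "p \<in> set [1..<m * 2 ^ m + 1]"
    and ie: "(i, e, b) \<in> {(qs ! (p - 1), exp (- (real p / 2 ^ m)), True),
      (Suc (qs ! (p - 1)), exp (- (real p / 2 ^ m)), False)}"
    using assms(1) unfolding cell_tests_def set_concat set_map by auto
  have p': "1 \<le> p" "p - 1 < length qs"
    using p unfolding set_upt atLeastLessThan_iff assms(2) by linarith+
  have "qs ! (p - 1) \<le> sum_list qs" by (rule elem_le_sum_list[OF p'(2)])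
  then show ?thesis using ie p'(1) by auto
qed

text \<open>A rounded value is q iff the path has reached level q but not level q + 1; these are the
  two tests that \<open>cell_tests\<close> lists per grid time. In \<open>rel\<close>, a level is
  reached by time t iff its crossing time is at most t, and the decreasing map exp (- _) turns this
  into a lower threshold.\<close>

lemma grid_code_eq_iff_tests:
  assumes c: "c > 0" and nn: "\<And>t. t \<ge> 0 \<Longrightarrow> 0 \<le> z t"
    and rel: "\<And>p q. p \<ge> 1 \<Longrightarrow> (c / 2 ^ m * real q \<le> z (real p / 2 ^ m)) = (y q \<ge> exp (- (real p / 2 ^ m)))"
  shows "grid_code c m z = qs \<longleftrightarrow> length qs = m * 2 ^ m \<and> tests (cell_tests m qs) y"
proof -
  have entry: "nat \<lfloor>z (real p / 2 ^ m) * 2 ^ m / c\<rfloor> = q \<longleftrightarrow>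
      y q \<ge> exp (- (real p / 2 ^ m)) \<and> \<not> y (Suc q) \<ge> exp (- (real p / 2 ^ m))" if "p \<ge> 1" for p q
  proof -
    let ?a = "z (real p / 2 ^ m) * 2 ^ m / c"
    have a: "?a \<ge> 0" using nn[of "real p / 2 ^ m"] c by simp
    then have "nat \<lfloor>?a\<rfloor> = q \<longleftrightarrow> \<lfloor>?a\<rfloor> = int q" by (simp add: nat_eq_iff)
    also have "\<dots> \<longleftrightarrow> real q \<le> ?a \<and> ?a < real q + 1" by (simp add: floor_eq_iff)
    also have "real q \<le> ?a \<longleftrightarrow> c / 2 ^ m * real q \<le> z (real p / 2 ^ m)"
      using c by (simp add: field_simps)
    also have "?a < real q + 1 \<longleftrightarrow> \<not> c / 2 ^ m * real (Suc q) \<le> z (real p / 2 ^ m)"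
      using c by (simp add: field_simps not_le)
    finally show ?thesis unfolding rel[OF that] .
  qed
  have "grid_code c m z = qs \<longleftrightarrow> length qs = m * 2 ^ m \<and>
      (\<forall>i<m * 2 ^ m. nat \<lfloor>z (real (Suc i) / 2 ^ m) * 2 ^ m / c\<rfloor> = qs ! i)"
    unfolding grid_code_def list_eq_iff_nth_eq by (auto simp del: upt_Suc)
  also have "(\<forall>i<m * 2 ^ m. nat \<lfloor>z (real (Suc i) / 2 ^ m) * 2 ^ m / c\<rfloor> = qs ! i) \<longleftrightarrow>
      (\<forall>p\<in>{1..<m * 2 ^ m + 1}. nat \<lfloor>z (real p / 2 ^ m) * 2 ^ m / c\<rfloor> = qs ! (p - 1))"
  proof (intro iffI ballI allI impI)
    fix p assume *: "\<forall>i<m * 2 ^ m. nat \<lfloor>z (real (Suc i) / 2 ^ m) * 2 ^ m / c\<rfloor> = qs ! i"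
      and p: "p \<in> {1..<m * 2 ^ m + 1}"
    have "p - 1 < m * 2 ^ m" "Suc (p - 1) = p" using p unfolding atLeastLessThan_iff by linarith+
    then show "nat \<lfloor>z (real p / 2 ^ m) * 2 ^ m / c\<rfloor> = qs ! (p - 1)" using *[rule_format, of "p - 1"] by simp
  next
    fix i assume *: "\<forall>p\<in>{1..<m * 2 ^ m + 1}. nat \<lfloor>z (real p / 2 ^ m) * 2 ^ m / c\<rfloor> = qs ! (p - 1)"
      and i: "i < m * 2 ^ m"
    have "Suc i \<in> {1..<m * 2 ^ m + 1}" using i unfolding atLeastLessThan_iff by linarith
    from *[rule_format, OF this] show "nat \<lfloor>z (real (Suc i) / 2 ^ m) * 2 ^ m / c\<rfloor> = qs ! i" by simp
  qed
  also have "\<dots> \<longleftrightarrow> tests (cell_tests m qs) y"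
    unfolding tests_def cell_tests_def set_concat set_map set_upt using entry by auto
  finally show ?thesis .
qed

text \<open>As a \<open>LEAST\<close>, the count is determined by countably many conditions on
  single jump times.\<close>

lemma measurable_jump_count:
  assumes s: "\<And>\<omega>. jump_times (s \<omega>)" and m: "\<And>k. (\<lambda>\<omega>. s \<omega> k) \<in> borel_measurable M"
  shows "(\<lambda>\<omega>. jump_count (s \<omega>) t) \<in> measurable M (count_space UNIV)"
proof -
  note [measurable] = m
  have "jump_count (s \<omega>) t = (LEAST n. \<not> s \<omega> n \<le> t)" for \<omega>
  proof (rule Least_equality[symmetric])
    show "\<not> s \<omega> (jump_count (s \<omega>) t) \<le> t" using less_jump_count_iff[OF s, of "jump_count (s \<omega>) t" \<omega> t] by
        simp
    show "jump_count (s \<omega>) t \<le> n" if "\<not> s \<omega> n \<le> t" for n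
      using less_jump_count_iff[OF s, of n \<omega> t] that by simp
  qed
  then show ?thesis by (simp only:) measurable
qed

text \<open>Because paths increase, the infimum is below a iff the path exceeds t at some rational q
  in [0, a).\<close>

lemma path_inverse_measurable:
  assumes g: "\<And>\<omega>. subordinator_path (\<lambda>v. D v \<omega>)" and m: "\<And>v. v \<ge> 0 \<Longrightarrow> D v \<in> borel_measurable N"
  shows "(\<lambda>\<omega>. path_inverse (\<lambda>v. D v \<omega>) t) \<in> borel_measurable N"
  unfolding borel_measurable_iff_less
proof
  fix a
  have "path_inverse (\<lambda>v. D v \<omega>) t < a \<longleftrightarrow> (\<exists>q\<in>\<rat> \<inter> {0..<a}. D q \<omega> > t)" for \<omega>
  proof
    assume "path_inverse (\<lambda>v. D v \<omega>) t < a"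
    then obtain w where w: "0 \<le> w" "w < a" "D w \<omega> > t"
      using path_inverse_lessD[OF g] by blast
    obtain q where "q \<in> \<rat>" "w < q" "q < a" using Rats_dense_in_real w(2) by blast
    moreover have "D w \<omega> \<le> D q \<omega>" using subordinator_path_le[OF g w(1), of q \<omega>] \<open>w < q\<close> by simp
    ultimately show "\<exists>q\<in>\<rat> \<inter> {0..<a}. D q \<omega> > t" using w by (intro bexI[of _ q]) auto
  next
    assume "\<exists>q\<in>\<rat> \<inter> {0..<a}. D q \<omega> > t"
    then obtain q where q: "0 \<le> q" "q < a" "D q \<omega> > t" by auto
    then show "path_inverse (\<lambda>v. D v \<omega>) t < a" using path_inverse_le[OF g q(1), of t \<omega>] by simp
  qed
  then have "{\<omega> \<in> space N. path_inverse (\<lambda>v. D v \<omega>) t < a} = (\<Union>q\<in>\<rat> \<inter> {0..<a}. {\<omega> \<in> space N. D q \<omega> > t})"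
    by auto
  also have "\<dots> \<in> sets N"
  proof (intro sets.countable_UN' image_subsetI)
    show "countable (\<rat> \<inter> {0..<a})" using countable_rat by blast
    fix q assume "q \<in> \<rat> \<inter> {0..<a}"
    then have [measurable]: "D q \<in> borel_measurable N" by (intro m) auto
    show "{\<omega> \<in> space N. D q \<omega> > t} \<in> sets N" by measurable
  qed
  finally show "{\<omega> \<in> space N. path_inverse (\<lambda>v. D v \<omega>) t < a} \<in> sets N" .
qed

text \<open>Each \<open>Z t\<close> charges at most countably many points, so some \<open>c\<close> avoids all dyadic rescalings
  of atoms.\<close>

lemma generic_level:
  assumes N: "prob_space N" and m: "\<And>t. Z t \<in> borel_measurable N"
  obtains c :: real where "c > 0" "\<And>m p q :: nat. p \<ge> 1 \<Longrightarrow> q \<ge> 1 \<Longrightarrow>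
     measure N {\<omega>\<in>space N. Z (real p / 2 ^ m) \<omega> = c / 2 ^ m * real q} = 0"
proof -
  interpret N: prob_space N by (rule N)
  define A where "A t = {v. measure (distr N borel (Z t)) {v} \<noteq> 0}" for t
  have A: "countable (A t)" for t
  proof -
    interpret D: prob_space "distr N borel (Z t)" by (rule N.prob_space_distr[OF m])
    show ?thesis unfolding A_def by (rule D.countable_support)
  qed
  define B where "B = (\<Union>m::nat. \<Union>p::nat. \<Union>q::nat. (\<lambda>v. v * 2 ^ m / real q) ` A (real p / 2 ^ m))"
  have "countable B" unfolding B_def using A by auto
  moreover have "uncountable {0<..<1::real}" by (simp add: uncountable_open_interval)
  ultimately have "{0<..<1} - B \<noteq> {}" by (metis countable_subset Diff_eq_empty_iff)
  then obtain c where "c \<in> {0<..<1} - B" by blast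
  then have c: "0 < c" "c \<notin> B" by auto
  have "measure N {\<omega>\<in>space N. Z (real p / 2 ^ m) \<omega> = c / 2 ^ m * real q} = 0" if "q \<ge> 1" for m p q :: nat
  proof (rule ccontr)
    let ?v = "c / 2 ^ m * real q"
    assume "measure N {\<omega>\<in>space N. Z (real p / 2 ^ m) \<omega> = ?v} \<noteq> 0"
    moreover have "measure (distr N borel (Z (real p / 2 ^ m))) {?v} = measure N {\<omega>\<in>space N. Z (real p / 2 ^
        m) \<omega> = ?v}"
      using m by (subst measure_distr) (auto intro!: arg_cong[where f = "measure N"])
    ultimately have "?v \<in> A (real p / 2 ^ m)" by (simp add: A_def)
    then have "?v * 2 ^ m / real q \<in> B" unfolding B_def by blast
    then show False using c(2) that by simp
  qed
  then show ?thesis using that[OF c(1)] by blast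
qed

lemma path_restrict_increasing_paths:
  assumes z: "continuous_on {0..} z" "\<And>s t. 0 \<le> s \<Longrightarrow> s \<le> t \<Longrightarrow> z s \<le> z t" "z 0 = 0"
  shows "(\<lambda>t\<in>{0..}. z t) \<in> increasing_paths" "continuous_on {0..} (\<lambda>t\<in>{0..}. z t)"
proof -
  let ?z = "\<lambda>t\<in>{0..}. z t"
  show c: "continuous_on {0..} ?z" using z(1) by (rule continuous_on_eq) auto
  have within: "(?z \<longlongrightarrow> ?z t) (at t within {0..})" if "t \<ge> 0" for t
    using c that unfolding continuous_on_def by blast
  have "continuous (at_right t) ?z" if "t \<ge> 0" for t
    unfolding continuous_within
    by (rule tendsto_within_subset[OF within[OF that]]) (use that in auto)
  moreover have "\<exists>l. (?z \<longlongrightarrow> l) (at_left t)" if "t > 0" for t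
  proof -
    have "(?z \<longlongrightarrow> ?z t) (at t within {0..<t})"
      by (rule tendsto_within_subset[OF within]) (use that in auto)
    moreover have "at t within {0..<t} = at_left t"
      by (rule at_within_nhd[of _ "{0<..}"]) (use that in auto)
    ultimately show ?thesis by auto
  qed
  moreover have "mono_on {0..} ?z" using z(2) by (auto intro!: mono_onI)
  moreover have "0 \<le> z t" if "t \<ge> 0" for t using z(2)[of 0 t] z(3) that by simp
  ultimately show "?z \<in> increasing_paths" by (auto simp: increasing_paths_def cadlag_paths_def)
qed

section \<open>Moments and level crossings of the record process\<close>

context heavy_tailed_ctrw
begin

text \<open>\<open>sum_by_parts\<close> rewrites the moments through increments, which
  \<open>block_moments\<close> evaluates for given l and \<open>block_limit\<close> in the limit.
  The absolute value of l keeps the variables in [0, 1] for every l, as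
  \<open>prob_tests_tendsto\<close> demands.\<close>

lemma mixed_moments_tendsto:
  assumes s: "\<And>\<omega>. jump_times (\<lambda>k. s k \<omega>)" "\<And>k. s k \<in> borel_measurable M" "AE \<omega> in M. \<forall>k. s k \<omega> = record_time
      X Y k \<omega>"
    and D: "\<And>\<omega>. subordinator_path (\<lambda>v. D v \<omega>)"
    and Dm: "\<And>a \<delta> n. \<delta> \<ge> 0 \<Longrightarrow> (\<And>i. a i \<ge> 0) \<Longrightarrow>
       (\<integral>\<omega>. exp (- (\<Sum>i<n. a i * (D (\<delta> * real (Suc i)) \<omega> - D (\<delta> * real i) \<omega>))) \<partial>N) =
       (\<Prod>i<n. exp (- \<delta> * a i powr (\<alpha> * \<rho>)))"
    and \<delta>: "\<delta> > 0"
  shows "((\<lambda>l. expectation (\<lambda>\<omega>. \<Prod>i\<le>Q. exp (- (s (level_index X Y \<delta> l i) \<omega> / \<bar>l\<bar>)) ^ n i)) \<longlongrightarrow>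
      (\<integral>\<omega>. (\<Prod>i\<le>Q. exp (- D (\<delta> * real i) \<omega>) ^ n i) \<partial>N)) at_top"
proof -
  \<comment> \<open>Increment i enters every coordinate with a larger index, so it collects the
    exponents of all of them.\<close>
  define b where "b i = (\<Sum>m\<in>{i<..Q}. real (n m))" for i
  have b0: "b i \<ge> 0" for i by (simp add: b_def sum_nonneg)
  have P: "(\<Prod>i\<le>Q. exp (- x i) ^ n i) = exp (- (\<Sum>i<Q. b i * (x (Suc i) - x i)))" if "x 0 = 0" for x :: "nat \<Rightarrow>
      real"
  proof -
    have "(\<Prod>i\<le>Q. exp (- x i) ^ n i) = exp (- (\<Sum>i\<le>Q. real (n i) * x i))"
      by (simp add: exp_sum exp_of_nat_mult[symmetric] sum_negf[symmetric])
    also have "(\<Sum>i\<le>Q. real (n i) * x i) = (\<Sum>i<Q. b i * (x (Suc i) - x i))"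
      unfolding b_def by (rule sum_by_parts[where S = x, OF that])
    finally show ?thesis .
  qed
  have N: "(\<integral>\<omega>. (\<Prod>i\<le>Q. exp (- D (\<delta> * real i) \<omega>) ^ n i) \<partial>N) = (\<Prod>i<Q. exp (- \<delta> * b i powr (\<alpha> * \<rho>)))"
  proof -
    have "(\<Prod>i\<le>Q. exp (- D (\<delta> * real i) \<omega>) ^ n i) =
        exp (- (\<Sum>i<Q. b i * (D (\<delta> * real (Suc i)) \<omega> - D (\<delta> * real i) \<omega>)))" for \<omega>
      using P[of "\<lambda>i. D (\<delta> * real i) \<omega>"] D[of \<omega>] by (simp add: subordinator_path_def)
    then show ?thesis using Dm[of \<delta> b Q] b0 \<delta> by (simp only: less_imp_le)
  qed
  have Ml: "expectation (\<lambda>\<omega>. \<Prod>i\<le>Q. exp (- (s (level_index X Y \<delta> l i) \<omega> / \<bar>l\<bar>)) ^ n i) =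
      (\<Prod>i<Q. (1 - psi X Y (b i / l)) ^ (level_index X Y \<delta> l (Suc i) - level_index X Y \<delta> l i))" if l: "l > 0"
          for l
  proof -
    let ?k = "level_index X Y \<delta> l"
    have k0: "?k 0 = 0" by (rule level_index_0)
    have "(\<Prod>i\<le>Q. exp (- (s (?k i) \<omega> / \<bar>l\<bar>)) ^ n i) =
        exp (- (\<Sum>i<Q. b i * (s (?k (Suc i)) \<omega> / \<bar>l\<bar> - s (?k i) \<omega> / \<bar>l\<bar>)))" for \<omega>
      using P[of "\<lambda>i. s (?k i) \<omega> / \<bar>l\<bar>"] s(1)[of \<omega>] k0 by (simp add: jump_times_def)
    then have "expectation (\<lambda>\<omega>. \<Prod>i\<le>Q. exp (- (s (?k i) \<omega> / \<bar>l\<bar>)) ^ n i) =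
        expectation (\<lambda>\<omega>. exp (- (\<Sum>i<Q. b i * (s (?k (Suc i)) \<omega> / \<bar>l\<bar> - s (?k i) \<omega> / \<bar>l\<bar>))))"
      by (rule Bochner_Integration.integral_cong[OF refl])
    also have "\<dots> = expectation (\<lambda>\<omega>. exp (- (\<Sum>i<Q. b i / l * (record_time X Y (?k (Suc i)) \<omega> - record_time X
        Y (?k i) \<omega>))))"
    proof (rule integral_cong_AE)
      show "AE \<omega> in M. exp (- (\<Sum>i<Q. b i * (s (?k (Suc i)) \<omega> / \<bar>l\<bar> - s (?k i) \<omega> / \<bar>l\<bar>))) =
          exp (- (\<Sum>i<Q. b i / l * (record_time X Y (?k (Suc i)) \<omega> - record_time X Y (?k i) \<omega>)))"
        using s(3) by eventually_elim (use l in \<open>simp add: diff_divide_distrib right_diff_distrib\<close>)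
      have [measurable]: "s k \<in> borel_measurable M" "record_time X Y k \<in> borel_measurable M" for k
        using s(2) record_time_measurable[OF iidX iidY] by auto
      show "(\<lambda>\<omega>. exp (- (\<Sum>i<Q. b i * (s (?k (Suc i)) \<omega> / \<bar>l\<bar> - s (?k i) \<omega> / \<bar>l\<bar>)))) \<in> borel_measurable M"
        by measurable
      show "(\<lambda>\<omega>. exp (- (\<Sum>i<Q. b i / l * (record_time X Y (?k (Suc i)) \<omega> - record_time X Y (?k i) \<omega>)))) \<in>
          borel_measurable M"
        by measurable
    qed
    also have "\<dots> = (\<Prod>i<Q. (1 - psi X Y (b i / l)) ^ (?k (Suc i) - ?k i))"
      by (rule block_moments[OF level_index_mono[OF \<delta>] k0]) (use b0 l in auto)
    finally show ?thesis .
  qed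
  have "((\<lambda>l. \<Prod>i<Q. (1 - psi X Y (b i / l)) ^ (level_index X Y \<delta> l (Suc i) - level_index X Y \<delta> l i)) \<longlongrightarrow>
      (\<Prod>i<Q. exp (- \<delta> * b i powr (\<alpha> * \<rho>)))) at_top"
    by (intro tendsto_prod block_limit \<delta> b0)
  moreover have "\<forall>\<^sub>F l in at_top. (\<Prod>i<Q. (1 - psi X Y (b i / l)) ^ (level_index X Y \<delta> l (Suc i) -
      level_index X Y \<delta> l i)) =
      expectation (\<lambda>\<omega>. \<Prod>i\<le>Q. exp (- (s (level_index X Y \<delta> l i) \<omega> / \<bar>l\<bar>)) ^ n i)"
    using eventually_gt_at_top[of 0] by eventually_elim (rule Ml[symmetric])
  ultimately show ?thesis unfolding N by (rule Lim_transform_eventually)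
qed

text \<open>Height \<delta> * q is reached when the number of jumps is at least the ceiling of
  \<open>norming X Y l * (\<delta> * real q)\<close>; since jumps are indexed from 0, the decisive
  one has index one less.\<close>

lemma level_le_jump_count_iff:
  assumes s: "jump_times s" and l: "l > 0" and \<delta>: "\<delta> > 0" and t: "t \<ge> 0"
  shows "\<delta> * real q \<le> step_path (norming X Y l) (\<lambda>k. s k / l) t \<longleftrightarrow> s (level_index X Y \<delta> l q) / l \<le> t"
proof -
  have sl: "jump_times (\<lambda>k. s k / l)"
  proof -
    have "\<exists>k. c < s k / l" for c using s l by (auto simp: jump_times_def pos_less_divide_eq)
    then show ?thesis using s l by (auto simp: jump_times_def divide_strict_right_mono)
  qed
  have u: "norming X Y l > 0" by (rule norming_pos)
  let ?n = "jump_count (\<lambda>k. s k / l) t" and ?x = "norming X Y l * (\<delta> * real q)"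
  have "\<delta> * real q \<le> step_path (norming X Y l) (\<lambda>k. s k / l) t \<longleftrightarrow> ?x \<le> real ?n"
    using u t by (simp add: step_path_def pos_le_divide_eq mult.commute)
  also have "\<dots> \<longleftrightarrow> nat \<lceil>?x\<rceil> \<le> ?n"
    by (simp add: nat_le_iff ceiling_le_iff)
  \<comment> \<open>For q = 0 the truncated subtraction gives index 0, and both sides hold because
    the jump at time 0 is always counted.\<close>
  also have "\<dots> \<longleftrightarrow> level_index X Y \<delta> l q < ?n"
  proof (cases "q = 0")
    case True
    have "0 < ?n" using less_jump_count_iff[OF sl, of 0 t] s t by (simp add: jump_times_def)
    then show ?thesis using True by (simp add: level_index_0)
  next
    case False
    then have "?x > 0" using u \<delta> by simp
    then have "nat \<lceil>?x\<rceil> \<ge> 1" by (simp add: Suc_le_eq)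
    then show ?thesis unfolding level_index_def by linarith
  qed
  also have "\<dots> \<longleftrightarrow> s (level_index X Y \<delta> l q) / l \<le> t" by (rule less_jump_count_iff[OF sl])
  finally show ?thesis .
qed

end

section \<open>Regular versions, completions and the limit theorem\<close>

lemma random_element_AE:
  assumes ae: "AE \<omega> in M. X \<omega> = X' \<omega>" and X': "\<And>\<omega>. X' \<omega> \<in> topspace T"
    and sets: "\<And>U. openin T U \<Longrightarrow> X' -` U \<inter> space M \<in> sets M"
  shows "random_element M T X"
  unfolding random_element_def
proof (intro conjI allI impI)
  show "AE \<omega> in M. X \<omega> \<in> topspace T" using ae by eventually_elim (simp add: X')
  fix U assume "openin T U"
  then show "X -` U \<inter> space M \<in> sets (completion M)"
    using ae AE_space by (intro completion_sets_AE[OF sets[of U]]) auto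
qed

text \<open>The original process need be measurable for the completed measure only; its integral is
  computed from the regular version under the measure itself.\<close>

lemma integral_completion_AE:
  fixes f :: "'c \<Rightarrow> real"
  assumes ae: "AE \<omega> in M. X \<omega> = X' \<omega>" and m: "(\<lambda>\<omega>. f (X' \<omega>)) \<in> borel_measurable M"
  shows "(\<integral>\<omega>. f (X \<omega>) \<partial>completion M) = (\<integral>\<omega>. f (X' \<omega>) \<partial>M)"
proof -
  have "(\<lambda>\<omega>. f (X \<omega>)) \<in> borel_measurable (completion M)"
  proof (rule borel_measurableI)
    fix S :: "real set" assume "open S"
    then have "(\<lambda>\<omega>. f (X' \<omega>)) -` S \<inter> space M \<in> sets M" by (intro measurable_sets[OF m]) auto
    then show "(\<lambda>\<omega>. f (X \<omega>)) -` S \<inter> space (completion M) \<in> sets (completion M)"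
      using ae AE_space by (intro completion_sets_AE) auto
  qed
  moreover have "AE \<omega> in completion M. f (X \<omega>) = f (X' \<omega>)"
    using ae by (intro AE_completion) (auto elim!: eventually_mono)
  moreover have "(\<lambda>\<omega>. f (X' \<omega>)) \<in> borel_measurable (completion M)"
    using m by (rule measurable_completion)
  ultimately have "(\<integral>\<omega>. f (X \<omega>) \<partial>completion M) = (\<integral>\<omega>. f (X' \<omega>) \<partial>completion M)"
    by (intro integral_cong_AE) auto
  also have "\<dots> = (\<integral>\<omega>. f (X' \<omega>) \<partial>M)" by (rule integral_completion[OF m])
  finally show ?thesis .
qed

lemma continuous_map_measurable:
  fixes f :: "'c \<Rightarrow> real"
  assumes f: "continuous_map T euclideanreal f" and X: "\<And>\<omega>. X \<omega> \<in> topspace T"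
    and sets: "\<And>U. openin T U \<Longrightarrow> X -` U \<inter> space M \<in> sets M"
  shows "(\<lambda>\<omega>. f (X \<omega>)) \<in> borel_measurable M"
proof (rule borel_measurableI)
  fix S :: "real set" assume "open S"
  then have "openin T {x \<in> topspace T. f x \<in> S}"
    by (intro openin_continuous_map_preimage[OF f]) (simp add: open_openin[symmetric])
  from sets[OF this] show "(\<lambda>\<omega>. f (X \<omega>)) -` S \<inter> space M \<in> sets M"
    using X by (simp add: vimage_def)
qed

text \<open>Both processes are replaced by the regular versions V and Z, and convergence is checked
  on grid codes. The core is \<open>conv\<close>: a code event is a finite set of threshold tests at
  points that are not atoms of the limit.\<close>

lemma (in heavy_tailed_ctrw) ctrw_records_converge:
  fixes N :: "'b measure" and D :: "real \<Rightarrow> 'b \<Rightarrow> real"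
  assumes S: "stable_subordinator N (\<alpha> * \<rho>) D"
  shows "converges_weakly skorokhod_topology at_top
         M (\<lambda>l \<omega>. \<lambda>t\<in>{0..}. real (ctrw_records X Y (l * t) \<omega>) / norming X Y l)
         N (\<lambda>\<omega>. \<lambda>t\<in>{0..}. inverse_process D t \<omega>)"
proof -
  have PN: "prob_space N" using S by (simp add: stable_subordinator_def subordinator_def)
  interpret N: prob_space N by (rule PN)
  obtain s where s: "\<And>\<omega>. jump_times (\<lambda>k. s k \<omega>)" "\<And>k. s k \<in> borel_measurable M"
    "AE \<omega> in M. \<forall>k. s k \<omega> = record_time X Y k \<omega>"
    "AE \<omega> in M. \<forall>l>0. \<forall>t\<ge>0. ctrw_records X Y (l * t) \<omega> = jump_count (\<lambda>k. s k \<omega> / l) t"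
    using record_times_version by blast
  obtain D' where D': "\<And>\<omega>. subordinator_path (\<lambda>v. D' v \<omega>)" "\<And>v. v \<ge> 0 \<Longrightarrow> D' v \<in> borel_measurable N"
    "AE \<omega> in N. \<forall>v. D' v \<omega> = D v \<omega>"
    and D'm: "\<And>a \<delta> n. \<delta> \<ge> 0 \<Longrightarrow> (\<And>i. a i \<ge> 0) \<Longrightarrow>
       (\<integral>\<omega>. exp (- (\<Sum>i<n. a i * (D' (\<delta> * real (Suc i)) \<omega> - D' (\<delta> * real i) \<omega>))) \<partial>N) =
       (\<Prod>i<n. exp (- \<delta> * a i powr (\<alpha> * \<rho>)))"
    using regular_version[OF S] by blast
  let ?Xo = "\<lambda>l \<omega>. \<lambda>t\<in>{0..}. real (ctrw_records X Y (l * t) \<omega>) / norming X Y l"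
  let ?Zo = "\<lambda>\<omega>. \<lambda>t\<in>{0..}. inverse_process D t \<omega>"
  define Z where "Z \<omega> = (\<lambda>t\<in>{0..}. path_inverse (\<lambda>v. D' v \<omega>) t)" for \<omega>
  define V where "V l \<omega> = step_path (norming X Y l) (\<lambda>k. s k \<omega> / l)" for l \<omega>
  have Z: "Z \<omega> \<in> increasing_paths" "continuous_on {0..} (Z \<omega>)" "Z \<omega> 0 = 0" for \<omega>
    unfolding Z_def
    using path_restrict_increasing_paths[OF path_inverse_continuous[OF D'(1)] path_inverse_mono[OF D'(1)]
        path_inverse_0[OF D'(1)]] path_inverse_0[OF D'(1)]
    by simp_all
  have aeZ: "AE \<omega> in N. ?Zo \<omega> = Z \<omega>"
    using D'(3) by eventually_elim (simp add: Z_def inverse_process_path_inverse)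
  have mpinv: "(\<lambda>\<omega>. path_inverse (\<lambda>v. D' v \<omega>) t) \<in> borel_measurable N" for t
    by (rule path_inverse_measurable[OF D'(1,2)])
  have mZ: "(\<lambda>\<omega>. grid_code c m (Z \<omega>)) \<in> measurable N (count_space UNIV)" for c m
    by (rule measurable_grid_code) (simp add: Z_def mpinv)
  have sl: "jump_times (\<lambda>k. s k \<omega> / l)" if l: "l > 0" for l \<omega>
  proof -
    have "\<exists>k. c < s k \<omega> / l" for c using s(1)[of \<omega>] l by (auto simp: jump_times_def pos_less_divide_eq)
    then show ?thesis using s(1)[of \<omega>] l by (auto simp: jump_times_def divide_strict_right_mono)
  qed
  have msl: "(\<lambda>\<omega>. s k \<omega> / l) \<in> borel_measurable M" for k l using s(2)[of k] by measurable
  have u: "norming X Y l > 0" for l by (rule norming_pos)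
  have V: "V l \<omega> \<in> increasing_paths" if "l > 0" for l \<omega>
    unfolding V_def by (rule step_path_increasing_paths[OF sl[OF that] u])
  have aeV: "AE \<omega> in M. ?Xo l \<omega> = V l \<omega>" if l: "l > 0" for l
    using s(4) by eventually_elim (use l in \<open>auto simp: V_def step_path_def\<close>)
  have mV: "(\<lambda>\<omega>. grid_code c m (V l \<omega>)) \<in> measurable M (count_space UNIV)" if l: "l > 0" for c m l
  proof (rule measurable_grid_code)
    fix t :: real assume t: "t \<ge> 0"
    have [measurable]: "(\<lambda>\<omega>. jump_count (\<lambda>k. s k \<omega> / l) t) \<in> measurable M (count_space UNIV)"
      by (rule measurable_jump_count[OF sl[OF l] msl])
    show "(\<lambda>\<omega>. V l \<omega> t) \<in> borel_measurable M"
      using t unfolding V_def step_path_def by simp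
  qed
  obtain c where c: "c > 0" and cp: "\<And>m p q :: nat. p \<ge> 1 \<Longrightarrow> q \<ge> 1 \<Longrightarrow>
      N.prob {\<omega>\<in>space N. path_inverse (\<lambda>v. D' v \<omega>) (real p / 2 ^ m) = c / 2 ^ m * real q} = 0"
    using generic_level[OF PN, of "\<lambda>t \<omega>. path_inverse (\<lambda>v. D' v \<omega>) t", OF mpinv] by blast
  \<comment> \<open>The choice of c covers the positive heights. Height 0 is harmless because the
    inverse is positive at positive times; at time 0 this would fail, which is why the grid omits
    it.\<close>
  have null: "N.prob {\<omega>\<in>space N. path_inverse (\<lambda>v. D' v \<omega>) (real p / 2 ^ m) = c / 2 ^ m * real q} = 0"
    if p: "p \<ge> 1" for m p q :: nat
  proof (cases "q = 0")
    case True
    have "path_inverse (\<lambda>v. D' v \<omega>) (real p / 2 ^ m) > 0" for \<omega>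
      by (rule path_inverse_pos[OF D'(1)]) (use p in simp)
    then have "{\<omega>\<in>space N. path_inverse (\<lambda>v. D' v \<omega>) (real p / 2 ^ m) = c / 2 ^ m * real q} = {}"
      using True by (auto simp: less_le)
    then show ?thesis by (simp only: measure_empty)
  qed (use cp p in auto)
  have conv: "((\<lambda>l. prob {\<omega>\<in>space M. grid_code c m (V l \<omega>) = qs}) \<longlongrightarrow>
      N.prob {\<omega>\<in>space N. grid_code c m (Z \<omega>) = qs}) at_top" for m qs
  proof (cases "length qs = m * 2 ^ m")
    case False
    then have "grid_code c m z \<noteq> qs" for z by (auto simp: grid_code_def)
    then show ?thesis by simp
  next
    case len: True
    define \<delta> where "\<delta> = c / 2 ^ m"
    have \<delta>: "\<delta> > 0" using c by (simp add: \<delta>_def)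
    \<comment> \<open>Coordinate i encodes the scaled time at which the record path reaches height
      \<delta> * i; \<open>y'\<close> does the same for the inverse process, with D' at \<delta> * i
      as crossing time.\<close>
    define y where "y l \<omega> i = exp (- (s (level_index X Y \<delta> l i) \<omega> / \<bar>l\<bar>))" for l \<omega> i
    define y' where "y' \<omega> i = exp (- D' (\<delta> * real i) \<omega>)" for \<omega> i
    let ?ts = "cell_tests m qs" and ?Q = "Suc (sum_list qs)"
    have s0: "0 \<le> s k \<omega>" for k \<omega> using jump_times_le[OF s(1), of 0 k \<omega>] s(1)[of \<omega>] by (simp add:
        jump_times_def)
    have D0: "0 \<le> D' (\<delta> * real i) \<omega>" for i \<omega> using subordinator_path_nonneg[OF D'(1), of "\<delta> * real i" \<omega>] \<delta>
        by simp
    have T: "((\<lambda>l. prob {\<omega>\<in>space M. tests ?ts (y l \<omega>)}) \<longlongrightarrow> N.prob {\<omega>\<in>space N. tests ?ts (y' \<omega>)}) at_top"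
    proof (rule prob_tests_tendsto[OF prob_space_axioms PN, where Q = ?Q])
      show "(\<lambda>\<omega>. y l \<omega> i) \<in> borel_measurable M" for l i
        unfolding y_def using s(2) by measurable
      show "(\<lambda>\<omega>. y' \<omega> i) \<in> borel_measurable N" for i
        unfolding y'_def using D'(2)[of "\<delta> * real i"] \<delta> by simp
      show "0 \<le> y l \<omega> i \<and> y l \<omega> i \<le> 1" for l \<omega> i by (simp add: y_def s0)
      show "0 \<le> y' \<omega> i \<and> y' \<omega> i \<le> 1" for \<omega> i by (simp add: y'_def D0)
      show "((\<lambda>l. expectation (\<lambda>\<omega>. \<Prod>i\<le>?Q. y l \<omega> i ^ n i)) \<longlongrightarrow> N.expectation (\<lambda>\<omega>. \<Prod>i\<le>?Q. y' \<omega> i ^ n i)) at_top"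
          for n
        unfolding y_def y'_def by (rule mixed_moments_tendsto[OF s(1,2,3) D'(1) D'm \<delta>])
      fix i e b assume t: "(i, e, b) \<in> set ?ts"
      then obtain p :: nat where p: "p \<ge> 1" "e = exp (- (real p / 2 ^ m))" and i: "i \<le> ?Q"
        using cell_testsD[OF t len] by blast
      \<comment> \<open>An atom of \<open>y'\<close> at the threshold would be an atom of the
        inverse process at height \<delta> * i, which the choice of c excludes.\<close>
      have "N.prob {\<omega>\<in>space N. y' \<omega> i = e} \<le>
          N.prob {\<omega>\<in>space N. path_inverse (\<lambda>v. D' v \<omega>) (real p / 2 ^ m) = c / 2 ^ m * real i}"
      proof (rule N.finite_measure_mono)
        show "{\<omega>\<in>space N. y' \<omega> i = e} \<subseteq> {\<omega>\<in>space N. path_inverse (\<lambda>v. D' v \<omega>) (real p / 2 ^ m) = c / 2 ^ m *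
            real i}"
        proof
          fix \<omega> assume \<omega>: "\<omega> \<in> {\<omega>\<in>space N. y' \<omega> i = e}"
          then have "D' (\<delta> * real i) \<omega> = real p / 2 ^ m" by (simp add: y'_def p(2))
          then have "path_inverse (\<lambda>v. D' v \<omega>) (real p / 2 ^ m) = c / 2 ^ m * real i"
            using path_inverse_eq[OF D'(1), of "\<delta> * real i" \<omega>] c by (simp add: \<delta>_def)
          then show "\<omega> \<in> {\<omega>\<in>space N. path_inverse (\<lambda>v. D' v \<omega>) (real p / 2 ^ m) = c / 2 ^ m * real i}"
            using \<omega> by simp
        qed
        show "{\<omega>\<in>space N. path_inverse (\<lambda>v. D' v \<omega>) (real p / 2 ^ m) = c / 2 ^ m * real i} \<in> N.events"
          using mpinv[of "real p / 2 ^ m"] by measurable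
      qed
      then show "i \<le> ?Q \<and> N.prob {\<omega>\<in>space N. y' \<omega> i = e} = 0"
        using null[OF p(1), of m i] i by (simp add: measure_le_0_iff)
    qed
    have "\<forall>\<^sub>F l in at_top. prob {\<omega>\<in>space M. tests ?ts (y l \<omega>)} = prob {\<omega>\<in>space M. grid_code c m (V l \<omega>) =
        qs}"
      using eventually_gt_at_top[of 0]
    proof eventually_elim
      case (elim l)
      have "grid_code c m (V l \<omega>) = qs \<longleftrightarrow> length qs = m * 2 ^ m \<and> tests ?ts (y l \<omega>)" for \<omega>
      proof (rule grid_code_eq_iff_tests[OF c])
        show "0 \<le> V l \<omega> t" if "t \<ge> 0" for t using V[OF elim, of \<omega>] that by (simp add: increasing_paths_def)
        show "(c / 2 ^ m * real q \<le> V l \<omega> (real p / 2 ^ m)) = (y l \<omega> q \<ge> exp (- (real p / 2 ^ m)))" for p q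
          using level_le_jump_count_iff[OF s(1) elim \<delta>, of "real p / 2 ^ m" q \<omega>] elim
          by (simp add: V_def y_def \<delta>_def)
      qed
      then show ?case using len by simp
    qed
    moreover have "N.prob {\<omega>\<in>space N. tests ?ts (y' \<omega>)} = N.prob {\<omega>\<in>space N. grid_code c m (Z \<omega>) = qs}"
    proof (rule N.finite_measure_eq_AE)
      \<comment> \<open>Off these null events the inverse never sits exactly at a grid height, the
        only case in which \<delta> * q \<le> inverse at t and D' (\<delta> * q) \<le> t can
        differ.\<close>
      have "AE \<omega> in N. \<forall>p q :: nat. p \<ge> 1 \<longrightarrow> path_inverse (\<lambda>v. D' v \<omega>) (real p / 2 ^ m) \<noteq> c / 2 ^ m * real q"
        unfolding AE_all_countable
      proof (intro allI)
        fix p q :: nat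
        show "AE \<omega> in N. p \<ge> 1 \<longrightarrow> path_inverse (\<lambda>v. D' v \<omega>) (real p / 2 ^ m) \<noteq> c / 2 ^ m * real q"
        proof (cases "p \<ge> 1")
          case True
          have "AE \<omega> in N. \<not> path_inverse (\<lambda>v. D' v \<omega>) (real p / 2 ^ m) = c / 2 ^ m * real q"
            using null[OF True, of m q] mpinv[of "real p / 2 ^ m"] by (subst (asm) N.prob_eq_0) auto
          then show ?thesis by eventually_elim simp
        qed simp
      qed
      then show "AE \<omega> in N. \<omega> \<in> {\<omega>\<in>space N. tests ?ts (y' \<omega>)} \<longleftrightarrow> \<omega> \<in> {\<omega>\<in>space N. grid_code c m (Z \<omega>) = qs}"
      proof eventually_elim
        case (elim \<omega>)
        have "grid_code c m (Z \<omega>) = qs \<longleftrightarrow> length qs = m * 2 ^ m \<and> tests ?ts (y' \<omega>)"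
        proof (rule grid_code_eq_iff_tests[OF c])
          show "0 \<le> Z \<omega> t" if "t \<ge> 0" for t using Z(1)[of \<omega>] that by (simp add: increasing_paths_def)
          fix p q :: nat assume p: "p \<ge> 1"
          let ?t = "real p / 2 ^ m"
          have "\<delta> * real q \<le> path_inverse (\<lambda>v. D' v \<omega>) ?t \<longleftrightarrow> D' (\<delta> * real q) \<omega> \<le> ?t"
            using path_inverse_ge[OF D'(1), of "\<delta> * real q" \<omega> ?t] path_inverse_le[OF D'(1), of "\<delta> * real q"
                ?t \<omega>]
              elim[rule_format, OF p, of q] \<delta> unfolding \<delta>_def[symmetric] by fastforce
          then show "(c / 2 ^ m * real q \<le> Z \<omega> ?t) = (y' \<omega> q \<ge> exp (- ?t))"
            by (simp add: Z_def y'_def \<delta>_def)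
        qed
        then show ?case using len by simp
      qed
      have "Measurable.pred N (\<lambda>\<omega>. tests ?ts (y' \<omega>))"
        by (rule pred_tests) (use D'(2) \<delta> in \<open>simp add: y'_def\<close>)
      then show "{\<omega>\<in>space N. tests ?ts (y' \<omega>)} \<in> N.events" by simp
      show "{\<omega>\<in>space N. grid_code c m (Z \<omega>) = qs} \<in> N.events"
        using mZ[of c m] by measurable
    qed
    ultimately show ?thesis using T by (simp cong: filterlim_cong)
  qed
  have setsV: "V l -` U \<inter> space M \<in> sets M" if "l > 0" "openin skorokhod_topology U" for l U
    using step_path_vimage_sets[OF u sl[OF that(1)] msl that(2)] by (simp add: V_def[abs_def])
  have setsZ: "Z -` U \<inter> space N \<in> sets N" if "openin skorokhod_topology U" for U
    by (rule continuous_path_vimage_sets[OF c Z mZ that])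
  have topV: "V l \<omega> \<in> topspace skorokhod_topology" if "l > 0" for l \<omega>
    using V[OF that] by (simp add: topspace_skorokhod increasing_paths_def)
  have topZ: "Z \<omega> \<in> topspace skorokhod_topology" for \<omega>
    using Z(1) by (simp add: topspace_skorokhod increasing_paths_def)
  show ?thesis
    unfolding converges_weakly_def
  proof (intro conjI allI impI)
    show "\<forall>\<^sub>F l in at_top. random_element M skorokhod_topology (?Xo l)"
      using eventually_gt_at_top[of 0]
      by eventually_elim (rule random_element_AE[OF aeV topV setsV])
    show "random_element N skorokhod_topology ?Zo"
      by (rule random_element_AE[OF aeZ topZ setsZ])
    fix f :: "(real \<Rightarrow> real) \<Rightarrow> real"
    assume f: "continuous_map skorokhod_topology euclideanreal f" and fb: "bounded (f ` topspace
        skorokhod_topology)"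
    have mfV: "(\<lambda>\<omega>. f (V l \<omega>)) \<in> borel_measurable M" if "l > 0" for l
      by (rule continuous_map_measurable[OF f topV[OF that] setsV[OF that]])
    have mfZ: "(\<lambda>\<omega>. f (Z \<omega>)) \<in> borel_measurable N"
      by (rule continuous_map_measurable[OF f topZ setsZ])
    have ev: "\<forall>\<^sub>F l in at_top. l > (0::real)" by (rule eventually_gt_at_top)
    have "((\<lambda>l. \<integral>\<omega>. f (V l \<omega>) \<partial>M) \<longlongrightarrow> (\<integral>\<omega>. f (Z \<omega>) \<partial>N)) at_top"
    proof (rule grid_code_weak_convergence[OF prob_space_axioms PN c _ Z mZ _ conv f _ _ mfZ])
      show "\<forall>\<^sub>F l in at_top. \<forall>\<omega>. V l \<omega> \<in> increasing_paths" using ev by eventually_elim (simp add: V)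
      show "\<forall>\<^sub>F l in at_top. (\<lambda>\<omega>. grid_code c m (V l \<omega>)) \<in> measurable M (count_space UNIV)" for m
        using ev by eventually_elim (rule mV)
      show "bounded (f ` cadlag_paths)" using fb by (simp add: topspace_skorokhod)
      show "\<forall>\<^sub>F l in at_top. (\<lambda>\<omega>. f (V l \<omega>)) \<in> borel_measurable M"
        using ev by eventually_elim (rule mfV)
    qed
    moreover have "\<forall>\<^sub>F l in at_top. (\<integral>\<omega>. f (V l \<omega>) \<partial>M) = (\<integral>\<omega>. f (?Xo l \<omega>) \<partial>completion M)"
      using ev
    proof eventually_elim
      case (elim l)
      show ?case by (rule integral_completion_AE[where f = f, OF aeV[OF elim] mfV[OF elim], symmetric])
    qed
    moreover have "(\<integral>\<omega>. f (?Zo \<omega>) \<partial>completion N) = (\<integral>\<omega>. f (Z \<omega>) \<partial>N)"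
      by (rule integral_completion_AE[where f = f, OF aeZ mfZ])
    ultimately show "((\<lambda>l. \<integral>\<omega>. f (?Xo l \<omega>) \<partial>completion M) \<longlongrightarrow> (\<integral>\<omega>. f (?Zo \<omega>) \<partial>completion N)) at_top"
      by (simp only:) (rule Lim_transform_eventually)
  qed
qed

theorem theorem5:
  fixes M :: "'a measure" and X Y :: "nat \<Rightarrow> 'a \<Rightarrow> real"
    and \<rho> \<alpha> :: real and L :: "real \<Rightarrow> real"
  assumes "prob_space M"
    and "iid_sequence M X"
    and "\<not> (\<exists>c. AE \<omega> in M. X 1 \<omega> = c)"
    and "iid_sequence M Y"
    and "\<And>i. i \<ge> 1 \<Longrightarrow> AE \<omega> in M. Y i \<omega> > 0"
    and "independent_sequences M X Y"
    and "0 < \<rho>" and "\<rho> \<le> 1"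
    and "(\<lambda>n. measure M {\<omega> \<in> space M. walk X n \<omega> \<ge> 0}) \<longlonglongrightarrow> \<rho>"
    and "0 < \<alpha>" and "\<alpha> < 1"
    and "slowly_varying L"
    and "(\<lambda>x. 1 - cdf (distr M borel (Y 1)) x) \<sim>[at_top]
           (\<lambda>x. 1 / Gamma (1 - \<alpha>) * x powr (- \<alpha>) * L x)"
  shows "\<exists>u :: real \<Rightarrow> real. (\<forall>l>0. u l > 0) \<and>
    (\<forall>(N :: 'b measure) D. stable_subordinator N (\<alpha> * \<rho>) D \<longrightarrow>
       converges_weakly skorokhod_topology at_top
         M (\<lambda>l \<omega>. \<lambda>t\<in>{0..}. real (ctrw_records X Y (l * t) \<omega>) / u l)
         N (\<lambda>\<omega>. \<lambda>t\<in>{0..}. inverse_process D t \<omega>))"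
proof -
  interpret prob_space M by (rule assms(1))
  have nonneg_prob: "nonneg_prob X \<longlonglongrightarrow> \<rho>"
    using assms(9) by (simp add: nonneg_prob_def[abs_def] partial_sum_def walk_def)
  interpret heavy_tailed_ctrw M X Y \<alpha> \<rho> L
    by unfold_locales (use assms nonneg_prob in blast)+
  \<comment> \<open>\<open>norming X Y\<close> is built from steps and waiting times alone, so one u
    serves every N and D.\<close>
  show ?thesis
    using norming_pos ctrw_records_converge by blast
qed

end
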